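(* Let $(\mathcal{E},\mathcal{D}(\mathcal{E}))$ be an irreducible regular Dirichlet form on $L^2(E;m)$ satisfying the strong Feller property, and let $\mu=\mu^+-\mu^-$ be a signed smooth Radon measure such that $(\mathcal{E}^{\mu},\mathcal{D}(\mathcal{E})\cap C_c(E))$ is non-negative definite and closable and such that $\mu^+$ is a Kato class measure. Suppose that for every $g\in C_c(E)$ the unique solution $w$ of the wave equation $$\frac{\partial^2}{\partial t^2}w(x,t)=\mathcal{L}^{\mu}w(x,t)\ \text{ on }E\times(0,\infty),\qquad \frac{\partial}{\partial t}w(x,0)=g(x),\quad w(x,0)=0\ \text{ for }x\in E,$$ is bounded in $L^2(E;m)$, i.e. $\sup_{t\ge0}\|w(\cdot,t)\|_{L^2(E;m)}<\infty$. Then for every $\beta\in(0,1)$, $(-\mathcal{L}^\mu)^\beta$ is subcritical.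
   Context: Setting. $E$ is a locally compact separable metric space, $m$ a positive Radon measure on $E$ with full support, $\langle\cdot,\cdot\rangle_m$ the inner product of real $L^2(E;m)$. A Dirichlet form $(\mathcal{E},\mathcal{D}(\mathcal{E}))$ is a densely defined, non-negative definite, symmetric, closed bilinear form on $L^2(E;m)$ that is Markovian: $f\in\mathcal{D}(\mathcal{E})$ implies $g:=(0\vee f)\wedge1\in\mathcal{D}(\mathcal{E})$ and $\mathcal{E}(g,g)\le\mathcal{E}(f,f)$. Put $\mathcal{E}_1:=\mathcal{E}+\langle\cdot,\cdot\rangle_m$. It is regular if $\mathcal{D}(\mathcal{E})\cap C_c(E)$ is $\mathcal{E}_1$-dense in $\mathcal{D}(\mathcal{E})$ and sup-norm dense in $C_c(E)$ (continuous functions with compact support). With $\mathcal{L}$ the non-positive self-adjoint operator such that $\mathcal{D}(\mathcal{E})=\mathcal{D}(\sqrt{-\mathcal{L}})$, $\mathcal{E}(f,g)=\langle\sqrt{-\mathcal{L}}f,\sqrt{-\mathcal{L}}g\rangle_m$, and $T_t=e^{t\mathcal{L}}$, the form is irreducible if every measurable $A$ with $T_t(1_Af)=1_AT_tf$ for all $t>0$, $f\in L^2(E;m)$ satisfies $m(A)=0$ or $m(A^c)=0$. A nest is an increasing sequence of closed sets $F_k$ with $\bigcup_k\{f\in\mathcal{D}(\mathcal{E}): f=0\ m\text{-a.e. on }E\setminus F_k\}$ $\mathcal{E}_1$-dense in $\mathcal{D}(\mathcal{E})$; a set is $\mathcal{E}$-polar if it is contained in $\bigcap_k(E\setminus F_k)$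 for some nest. A positive Borel measure is smooth if it charges no $\mathcal{E}$-polar set and is finite on each $F_k$ of some nest. A signed smooth Radon measure is $\mu=\mu^+-\mu^-$ with $\mu^\pm$ smooth Radon measures. Strong Feller property and Kato class. Let $X=(X_t,\mathbb{P}_x)$ be the $m$-symmetric Hunt process on $E$ associated with $(\mathcal{E},\mathcal{D}(\mathcal{E}))$ and $P_tf(x)=\mathbb{E}_x[f(X_t)]$ (so $P_tf=T_tf$ $m$-a.e. for $f\in L^2$). Strong Feller property: for each $t>0$, $P_t$ maps bounded Borel functions to bounded continuous functions. It implies that there is a jointly measurable symmetric density $p(t,x,y)$ with $P_tf(x)=\int_Ep(t,x,y)f(y)\,dm(y)$. Put $r_\alpha(x,y)=\int_0^\infty e^{-\alpha t}p(t,x,y)\,dt$ and $R_\alpha\rho(x)=\int_Er_\alpha(x,y)\,d\rho(y)$. A smooth measure $\rho$ is a Kato class measure if $\lim_{\alpha\to\infty}\|R_\alpha\rho\|_\infty=0$, with $\|\cdot\|_\infty$ the $m$-essential supremum. Schrödinger form. $\mathcal{E}^\mu(f,g):=\mathcal{E}(f,g)+\int_E fg\,d\mu^+-\int_E fg\,d\mu^-$ for $f,g\in\mathcal{D}(\mathcal{E})\cap C_c(E)$. When this is non-negative definite and closable on $L^2(E;m)$, $(\mathcal{E}^\mu,\mathcal{D}(\mathcal{E}^\mu))$ denotes its closure and $\mathcal{L}^\mu$ ("$=\mathcal{L}-\mu$") the associated non-positive self-adjoint operator. Subcriticality of $(-\mathcal{L}^\mu)^\beta$. Let $\mathcal{A}(f,g)=\langle(-\mathcal{L}^\mu)^{\beta/2}f,(-\mathcal{L}^\mu)^{\beta/2}g\rangle_m$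 with domain $\mathcal{D}(\mathcal{A})=\mathcal{D}((-\mathcal{L}^\mu)^{\beta/2})$ (the subordinated Schrödinger form for the Bernstein function $\Phi_\beta(\lambda)=\lambda^\beta$). $\mathcal{D}_e(\mathcal{A})$ is the set of ($m$-classes of) $m$-a.e. finite measurable $f$ for which there is an $\mathcal{A}$-Cauchy sequence $\{f_n\}\subset\mathcal{D}(\mathcal{A})$ with $f_n\to f$ $m$-a.e.; $\mathcal{A}(f,f):=\lim_n\mathcal{A}(f_n,f_n)$ (well defined). $(-\mathcal{L}^\mu)^\beta$ is subcritical if there is a strictly positive bounded $g\in L^1(E;m)$ with $\int_E|f|g\,dm\le\sqrt{\mathcal{A}(f,f)}$ for all $f\in\mathcal{D}_e(\mathcal{A})$. Solution of the wave equation. With $A=-\mathcal{L}^{\mu}\ge0$, the (unique) solution is understood in the standard sense of abstract second-order evolution equations: $w(\cdot,t)=\frac{\sin(t\sqrt{A})}{\sqrt{A}}g$ by the functional calculus (the multiplier at spectral value $0$ being $t$). *)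

theory Defs
  imports "HOL-Probability.Probability"
begin

section \<open>The real Hilbert space of square-integrable functions\<close>

text \<open>Elements of \<open>L\<^sup>2(m)\<close> are represented by square-integrable functions; every notion
  below is invariant under modification on null sets.\<close>

definition L2 :: "'a measure \<Rightarrow> ('a \<Rightarrow> real) set" where
  "L2 m = {f \<in> borel_measurable m. integrable m (\<lambda>x. (f x)\<^sup>2)}"

definition ip :: "'a measure \<Rightarrow> ('a \<Rightarrow> real) \<Rightarrow> ('a \<Rightarrow> real) \<Rightarrow> real" where
  "ip m f g = (\<integral>x. f x * g x \<partial>m)"

definition l2norm :: "'a measure \<Rightarrow> ('a \<Rightarrow> real) \<Rightarrow> real" where
  "l2norm m f = sqrt (ip m f f)"

definition dense_in_L2 :: "'a measure \<Rightarrow> ('a \<Rightarrow> real) set \<Rightarrow> bool" where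
  "dense_in_L2 m D \<longleftrightarrow> (\<forall>f\<in>L2 m. \<forall>e>0. \<exists>g\<in>D. l2norm m (\<lambda>x. f x - g x) < e)"


section \<open>Self-adjoint operators and their functional calculus\<close>

text \<open>A possibly unbounded operator is given by its graph, closed under modification of both
  components on null sets; its domain is \<^const>\<open>Domain\<close>.\<close>

type_synonym 'a l2op = "(('a \<Rightarrow> real) \<times> ('a \<Rightarrow> real)) set"

definition op_app :: "'a l2op \<Rightarrow> ('a \<Rightarrow> real) \<Rightarrow> ('a \<Rightarrow> real)" where
  "op_app A f = (SOME h. (f, h) \<in> A)"

definition op_neg :: "'a l2op \<Rightarrow> 'a l2op" where
  "op_neg A = {(f, \<lambda>x. - h x) | f h. (f, h) \<in> A}"

definition op_adjoint :: "'a measure \<Rightarrow> 'a l2op \<Rightarrow> 'a l2op" where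
  "op_adjoint m A = {(u, v). u \<in> L2 m \<and> v \<in> L2 m \<and> (\<forall>(f, h)\<in>A. ip m h u = ip m f v)}"

text \<open>Linearity, closedness and (by density of the domain) single-valuedness are consequences of
  \<open>op_adjoint m A = A\<close>.\<close>

definition self_adjoint :: "'a measure \<Rightarrow> 'a l2op \<Rightarrow> bool" where
  "self_adjoint m A \<longleftrightarrow> A \<subseteq> L2 m \<times> L2 m \<and> dense_in_L2 m (Domain A) \<and> op_adjoint m A = A"

text \<open>Projection-valued measures on the real line. Linearity and compatibility with null sets follow
  from the symmetry clause, idempotency from multiplicativity.\<close>

definition projection_valued_measure ::
    "'a measure \<Rightarrow> (real set \<Rightarrow> ('a \<Rightarrow> real) \<Rightarrow> ('a \<Rightarrow> real)) \<Rightarrow> bool" where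
  "projection_valued_measure m P \<longleftrightarrow>
     (\<forall>B\<in>sets borel. \<forall>f\<in>L2 m. P B f \<in> L2 m) \<and>
     (\<forall>B\<in>sets borel. \<forall>f\<in>L2 m. \<forall>g\<in>L2 m. ip m (P B f) g = ip m f (P B g)) \<and>
     (\<forall>B\<in>sets borel. \<forall>C\<in>sets borel. \<forall>f\<in>L2 m. AE x in m. P (B \<inter> C) f x = P B (P C f) x) \<and>
     (\<forall>f\<in>L2 m. AE x in m. P UNIV f x = f x) \<and>
     (\<forall>B :: nat \<Rightarrow> real set. range B \<subseteq> sets borel \<and> disjoint_family B \<longrightarrow>
        (\<forall>f\<in>L2 m. \<forall>g\<in>L2 m. (\<lambda>i. ip m (P (B i) f) g) sums ip m (P (\<Union>i. B i) f) g))"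

definition diag_measure ::
    "'a measure \<Rightarrow> (real set \<Rightarrow> ('a \<Rightarrow> real) \<Rightarrow> ('a \<Rightarrow> real)) \<Rightarrow> ('a \<Rightarrow> real) \<Rightarrow> real measure" where
  "diag_measure m P f = measure_of UNIV (sets borel) (\<lambda>B. ennreal (ip m (P B f) f))"

definition spectral_domain ::
    "'a measure \<Rightarrow> (real set \<Rightarrow> ('a \<Rightarrow> real) \<Rightarrow> ('a \<Rightarrow> real)) \<Rightarrow> (real \<Rightarrow> real) \<Rightarrow> ('a \<Rightarrow> real) set" where
  "spectral_domain m P \<phi> = {f \<in> L2 m. integrable (diag_measure m P f) (\<lambda>l. (\<phi> l)\<^sup>2)}"

text \<open>The operator \<open>\<integral>\<phi> dP\<close>, characterised by \<open>\<langle>(\<integral>\<phi> dP) f, g\<rangle> = \<integral>\<phi> d\<langle>P f, g\<rangle>\<close>. The signed measure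
  \<open>\<langle>P f, g\<rangle>\<close> is expressed through positive measures by polarisation, and \<open>g\<close> ranges over the (dense)
  domain, on which all integrals converge.\<close>

definition spectral_integral ::
    "'a measure \<Rightarrow> (real set \<Rightarrow> ('a \<Rightarrow> real) \<Rightarrow> ('a \<Rightarrow> real)) \<Rightarrow> (real \<Rightarrow> real) \<Rightarrow> 'a l2op" where
  "spectral_integral m P \<phi> =
     {(f, h). f \<in> spectral_domain m P \<phi> \<and> h \<in> L2 m \<and>
        (\<forall>g\<in>spectral_domain m P \<phi>.
           ip m h g = ((\<integral>l. \<phi> l \<partial>diag_measure m P (\<lambda>x. f x + g x))
                      - (\<integral>l. \<phi> l \<partial>diag_measure m P (\<lambda>x. f x - g x))) / 4)}"

definition is_spectral_measure ::
    "'a measure \<Rightarrow> 'a l2op \<Rightarrow> (real set \<Rightarrow> ('a \<Rightarrow> real) \<Rightarrow> ('a \<Rightarrow> real)) \<Rightarrow> bool" where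
  "is_spectral_measure m A P \<longleftrightarrow>
     projection_valued_measure m P \<and> spectral_integral m P (\<lambda>l. l) = A"

text \<open>The operator \<open>\<phi>(A)\<close>. By the spectral theorem a self-adjoint \<open>A\<close> has exactly one spectral
  measure up to null sets, so the choice is immaterial; \<open>\<phi>(A)\<close> is the empty graph for an \<open>A\<close>
  without spectral measure.\<close>

definition fun_calc :: "'a measure \<Rightarrow> 'a l2op \<Rightarrow> (real \<Rightarrow> real) \<Rightarrow> 'a l2op" where
  "fun_calc m A \<phi> =
     (if \<exists>P. is_spectral_measure m A P
      then spectral_integral m (SOME P. is_spectral_measure m A P) \<phi> else {})"

definition op_form :: "'a measure \<Rightarrow> 'a l2op \<Rightarrow> ('a \<Rightarrow> real) \<Rightarrow> ('a \<Rightarrow> real) \<Rightarrow> real" where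
  "op_form m S f g = ip m (op_app S f) (op_app S g)"


section \<open>Forms\<close>

type_synonym 'a form = "('a \<Rightarrow> real) \<Rightarrow> ('a \<Rightarrow> real) \<Rightarrow> real"

definition form1 :: "'a measure \<Rightarrow> 'a form \<Rightarrow> 'a form" where
  "form1 m E f g = E f g + ip m f g"

definition form_Cauchy :: "'a form \<Rightarrow> (nat \<Rightarrow> 'a \<Rightarrow> real) \<Rightarrow> bool" where
  "form_Cauchy E F \<longleftrightarrow>
     (\<forall>e>0. \<exists>N. \<forall>i\<ge>N. \<forall>j\<ge>N. E (\<lambda>x. F i x - F j x) (\<lambda>x. F i x - F j x) < e)"

definition symmetric_form :: "'a measure \<Rightarrow> ('a \<Rightarrow> real) set \<Rightarrow> 'a form \<Rightarrow> bool" where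
  "symmetric_form m D E \<longleftrightarrow>
     D \<subseteq> L2 m \<and>
     (\<forall>f\<in>D. \<forall>g\<in>D. (\<lambda>x. f x + g x) \<in> D) \<and>
     (\<forall>f\<in>D. \<forall>c. (\<lambda>x. c * f x) \<in> D) \<and>
     (\<forall>f\<in>D. \<forall>g\<in>borel_measurable m. (AE x in m. g x = f x) \<longrightarrow> g \<in> D \<and> (\<forall>h\<in>D. E g h = E f h)) \<and>
     (\<forall>f\<in>D. \<forall>g\<in>D. E f g = E g f) \<and>
     (\<forall>f\<in>D. \<forall>g\<in>D. \<forall>h\<in>D. E (\<lambda>x. f x + g x) h = E f h + E g h) \<and>
     (\<forall>f\<in>D. \<forall>g\<in>D. \<forall>c. E (\<lambda>x. c * f x) g = c * E f g)"

definition nonneg_form :: "('a \<Rightarrow> real) set \<Rightarrow> 'a form \<Rightarrow> bool" where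
  "nonneg_form D E \<longleftrightarrow> (\<forall>f\<in>D. 0 \<le> E f f)"

definition closed_form :: "'a measure \<Rightarrow> ('a \<Rightarrow> real) set \<Rightarrow> 'a form \<Rightarrow> bool" where
  "closed_form m D E \<longleftrightarrow>
     (\<forall>F. (\<forall>n. F n \<in> D) \<and> form_Cauchy (form1 m E) F \<longrightarrow>
        (\<exists>f\<in>D. (\<lambda>n. form1 m E (\<lambda>x. F n x - f x) (\<lambda>x. F n x - f x)) \<longlonglongrightarrow> 0))"

definition markovian_form :: "('a \<Rightarrow> real) set \<Rightarrow> 'a form \<Rightarrow> bool" where
  "markovian_form D E \<longleftrightarrow>
     (\<forall>f\<in>D. (\<lambda>x. min (max 0 (f x)) 1) \<in> D \<and>
        E (\<lambda>x. min (max 0 (f x)) 1) (\<lambda>x. min (max 0 (f x)) 1) \<le> E f f)"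

definition dirichlet_form :: "'a measure \<Rightarrow> ('a \<Rightarrow> real) set \<Rightarrow> 'a form \<Rightarrow> bool" where
  "dirichlet_form m D E \<longleftrightarrow>
     symmetric_form m D E \<and> dense_in_L2 m D \<and> nonneg_form D E \<and> closed_form m D E \<and>
     markovian_form D E"

definition Cc :: "('a::metric_space \<Rightarrow> real) set" where
  "Cc = {f. continuous_on UNIV f \<and> compact (closure {x. f x \<noteq> 0})}"

definition regular_form ::
    "'a::metric_space measure \<Rightarrow> ('a \<Rightarrow> real) set \<Rightarrow> 'a form \<Rightarrow> bool" where
  "regular_form m D E \<longleftrightarrow>
     (\<forall>f\<in>D. \<forall>e>0. \<exists>g\<in>D \<inter> Cc. form1 m E (\<lambda>x. f x - g x) (\<lambda>x. f x - g x) < e) \<and>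
     (\<forall>f\<in>Cc. \<forall>e>0. \<exists>g\<in>D \<inter> Cc. \<forall>x. \<bar>f x - g x\<bar> \<le> e)"

text \<open>\<open>L\<close> is the non-positive self-adjoint operator with \<open>D = D(\<surd>-L)\<close> and
  \<open>E(f, g) = \<langle>\<surd>-L f, \<surd>-L g\<rangle>\<close>.\<close>

definition generates :: "'a measure \<Rightarrow> 'a l2op \<Rightarrow> ('a \<Rightarrow> real) set \<Rightarrow> 'a form \<Rightarrow> bool" where
  "generates m L D E \<longleftrightarrow>
     self_adjoint m L \<and> (\<forall>(f, h)\<in>L. ip m f h \<le> 0) \<and>
     D = Domain (fun_calc m (op_neg L) sqrt) \<and>
     (\<forall>f\<in>D. \<forall>g\<in>D. E f g = op_form m (fun_calc m (op_neg L) sqrt) f g)"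

definition semigroup_op :: "'a measure \<Rightarrow> 'a l2op \<Rightarrow> real \<Rightarrow> 'a l2op" where
  "semigroup_op m L t = fun_calc m L (\<lambda>l. exp (t * l))"

definition irreducible_semigroup :: "'a measure \<Rightarrow> 'a l2op \<Rightarrow> bool" where
  "irreducible_semigroup m L \<longleftrightarrow>
     (\<forall>A\<in>sets m.
        (\<forall>t>0. \<forall>f\<in>L2 m. AE x in m.
           op_app (semigroup_op m L t) (\<lambda>y. indicator A y * f y) x =
             indicator A x * op_app (semigroup_op m L t) f x) \<longrightarrow>
        emeasure m A = 0 \<or> emeasure m (space m - A) = 0)"

text \<open>The closure of a closable form \<open>(E, C)\<close>.\<close>

definition closable_form :: "'a measure \<Rightarrow> ('a \<Rightarrow> real) set \<Rightarrow> 'a form \<Rightarrow> bool" where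
  "closable_form m C E \<longleftrightarrow>
     (\<forall>F. (\<forall>n. F n \<in> C) \<and> form_Cauchy E F \<and> (\<lambda>n. l2norm m (F n)) \<longlonglongrightarrow> 0 \<longrightarrow>
        (\<lambda>n. E (F n) (F n)) \<longlonglongrightarrow> 0)"

definition form_approx ::
    "'a measure \<Rightarrow> ('a \<Rightarrow> real) set \<Rightarrow> 'a form \<Rightarrow> ('a \<Rightarrow> real) \<Rightarrow> (nat \<Rightarrow> 'a \<Rightarrow> real) \<Rightarrow> bool" where
  "form_approx m C E f F \<longleftrightarrow>
     (\<forall>n. F n \<in> C) \<and> form_Cauchy E F \<and> (\<lambda>n. l2norm m (\<lambda>x. F n x - f x)) \<longlonglongrightarrow> 0"

definition closure_dom :: "'a measure \<Rightarrow> ('a \<Rightarrow> real) set \<Rightarrow> 'a form \<Rightarrow> ('a \<Rightarrow> real) set" where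
  "closure_dom m C E = {f \<in> L2 m. \<exists>F. form_approx m C E f F}"

definition closure_form :: "'a measure \<Rightarrow> ('a \<Rightarrow> real) set \<Rightarrow> 'a form \<Rightarrow> 'a form" where
  "closure_form m C E f g =
     (THE l. \<forall>F G. form_approx m C E f F \<and> form_approx m C E g G \<longrightarrow>
        (\<lambda>n. E (F n) (G n)) \<longlonglongrightarrow> l)"


section \<open>Radon and smooth measures\<close>

definition radon_measure :: "'a::metric_space measure \<Rightarrow> bool" where
  "radon_measure \<rho> \<longleftrightarrow>
     sets \<rho> = sets borel \<and>
     (\<forall>K. compact K \<longrightarrow> emeasure \<rho> K < \<infinity>) \<and>
     (\<forall>B\<in>sets borel. emeasure \<rho> B = (SUP K\<in>{K. compact K \<and> K \<subseteq> B}. emeasure \<rho> K))"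

definition full_support :: "'a::metric_space measure \<Rightarrow> bool" where
  "full_support m \<longleftrightarrow> (\<forall>U. open U \<and> U \<noteq> {} \<longrightarrow> emeasure m U > 0)"

definition nest ::
    "'a::metric_space measure \<Rightarrow> ('a \<Rightarrow> real) set \<Rightarrow> 'a form \<Rightarrow> (nat \<Rightarrow> 'a set) \<Rightarrow> bool" where
  "nest m D E F \<longleftrightarrow>
     incseq F \<and> (\<forall>k. closed (F k)) \<and>
     (\<forall>f\<in>D. \<forall>e>0. \<exists>k. \<exists>g\<in>D. (AE x in m. x \<notin> F k \<longrightarrow> g x = 0) \<and>
        form1 m E (\<lambda>x. f x - g x) (\<lambda>x. f x - g x) < e)"

definition form_polar ::
    "'a::metric_space measure \<Rightarrow> ('a \<Rightarrow> real) set \<Rightarrow> 'a form \<Rightarrow> 'a set \<Rightarrow> bool" where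
  "form_polar m D E N \<longleftrightarrow> (\<exists>F. nest m D E F \<and> N \<subseteq> (\<Inter>k. - F k))"

definition smooth_measure ::
    "'a::metric_space measure \<Rightarrow> ('a \<Rightarrow> real) set \<Rightarrow> 'a form \<Rightarrow> 'a measure \<Rightarrow> bool" where
  "smooth_measure m D E \<rho> \<longleftrightarrow>
     sets \<rho> = sets borel \<and>
     (\<forall>N\<in>sets borel. form_polar m D E N \<longrightarrow> emeasure \<rho> N = 0) \<and>
     (\<exists>F. nest m D E F \<and> (\<forall>k. emeasure \<rho> (F k) < \<infinity>))"

definition smooth_radon_measure ::
    "'a::metric_space measure \<Rightarrow> ('a \<Rightarrow> real) set \<Rightarrow> 'a form \<Rightarrow> 'a measure \<Rightarrow> bool" where
  "smooth_radon_measure m D E \<rho> \<longleftrightarrow> smooth_measure m D E \<rho> \<and> radon_measure \<rho>"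

definition schroedinger_form :: "'a form \<Rightarrow> 'a measure \<Rightarrow> 'a measure \<Rightarrow> 'a form" where
  "schroedinger_form E \<mu>p \<mu>m f g =
     E f g + (\<integral>x. f x * g x \<partial>\<mu>p) - (\<integral>x. f x * g x \<partial>\<mu>m)"


section \<open>Hunt processes, the strong Feller property and the Kato class\<close>

text \<open>The cemetery is \<^const>\<open>None\<close>: it is the point at infinity of the one-point compactification
  of the state space, and isolated if the state space is compact.\<close>

abbreviation compactified :: "'a::metric_space option topology" where
  "compactified \<equiv> Alexandroff_compactification euclidean"

definition borel_cemetery :: "'a::metric_space option measure" where
  "borel_cemetery = sigma UNIV {U. openin compactified U}"

text \<open>The time set is \<open>[0, \<infinity>]\<close>. Requiring the strong Markov property and quasi-left-continuity under
  every point mass \<open>P x\<close> is the same as requiring them under every initial distribution, since both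
  are identities between integrals over events that do not involve the initial distribution.
  The (simple) Markov property is the case of constant stopping times.\<close>

definition strong_markov ::
    "('a::metric_space option \<Rightarrow> 'w measure) \<Rightarrow> (ennreal \<Rightarrow> 'w \<Rightarrow> 'a option) \<Rightarrow> (ennreal \<Rightarrow> 'w measure) \<Rightarrow> bool" where
  "strong_markov P X F \<longleftrightarrow>
     (\<forall>x \<sigma> s. stopping_time F \<sigma> \<longrightarrow>
        (\<forall>B\<in>sets borel_cemetery.
         \<forall>A\<in>sets (filtration.pre_sigma (space (P None)) F \<sigma>).
           emeasure (P x) {\<omega>\<in>A. X (\<sigma> \<omega> + s) \<omega> \<in> B} =
             (\<integral>\<^sup>+\<omega>\<in>A. emeasure (P (X (\<sigma> \<omega>) \<omega>)) {\<omega>'\<in>space (P None). X s \<omega>' \<in> B} \<partial>P x)))"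

definition quasi_left_continuous ::
    "('a::metric_space option \<Rightarrow> 'w measure) \<Rightarrow> (ennreal \<Rightarrow> 'w \<Rightarrow> 'a option) \<Rightarrow> (ennreal \<Rightarrow> 'w measure) \<Rightarrow> bool" where
  "quasi_left_continuous P X F \<longleftrightarrow>
     (\<forall>x \<sigma>. (\<forall>n::nat. stopping_time F (\<sigma> n)) \<and>
        (\<forall>\<omega>\<in>space (P None). incseq (\<lambda>n. \<sigma> n \<omega>)) \<longrightarrow>
        (AE \<omega> in P x. (SUP n. \<sigma> n \<omega>) < \<infinity> \<longrightarrow>
           limitin compactified (\<lambda>n. X (\<sigma> n \<omega>) \<omega>) (X (SUP n. \<sigma> n \<omega>) \<omega>) sequentially))"

definition hunt_process ::
    "('a::metric_space option \<Rightarrow> 'w measure) \<Rightarrow> (ennreal \<Rightarrow> 'w \<Rightarrow> 'a option) \<Rightarrow> bool" where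
  "hunt_process P X \<longleftrightarrow>
     (\<forall>x. prob_space (P x) \<and> sets (P x) = sets (P None)) \<and>
     (\<forall>t. \<forall>B\<in>sets borel_cemetery.
        (\<lambda>x. emeasure (P (Some x)) {\<omega>\<in>space (P None). X t \<omega> \<in> B}) \<in> borel_measurable borel) \<and>
     (\<forall>x. AE \<omega> in P (Some x). X 0 \<omega> = Some x) \<and>
     (\<forall>t. AE \<omega> in P None. X t \<omega> = None) \<and>
     (\<forall>\<omega>\<in>space (P None).
        X \<infinity> \<omega> = None \<and>
        (\<forall>t. Inf {s. X s \<omega> = None} \<le> t \<longrightarrow> X t \<omega> = None) \<and>
        (\<forall>t<\<infinity>. limitin compactified (\<lambda>s. X s \<omega>) (X t \<omega>) (at_right t)) \<and>
        (\<forall>t. 0 < t \<and> t < \<infinity> \<longrightarrow> (\<exists>z. limitin compactified (\<lambda>s. X s \<omega>) z (at_left t)))) \<and>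
     (\<forall>t. \<exists>\<theta>. \<forall>\<omega>\<in>space (P None). \<theta> \<omega> \<in> space (P None) \<and> (\<forall>s. X s (\<theta> \<omega>) = X (t + s) \<omega>)) \<and>
     (\<exists>F. filtration (space (P None)) F \<and>
        (\<forall>t. sets (F t) \<subseteq> sets (P None)) \<and>
        (\<forall>t. X t \<in> measurable (F t) borel_cemetery) \<and>
        (\<forall>t<\<infinity>. sets (F t) = (\<Inter>s\<in>{t<..}. sets (F s))) \<and>
        strong_markov P X F \<and> quasi_left_continuous P X F)"

text \<open>\<open>P\<^sub>t f(x) = E\<^sub>x[f(X\<^sub>t)]\<close>, where \<open>f\<close> vanishes at the cemetery.\<close>

definition transition_op ::
    "('a option \<Rightarrow> 'w measure) \<Rightarrow> (ennreal \<Rightarrow> 'w \<Rightarrow> 'a option) \<Rightarrow> real \<Rightarrow> ('a \<Rightarrow> real) \<Rightarrow> ('a \<Rightarrow> real)" where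
  "transition_op P X t f x = (\<integral>\<omega>. case_option 0 f (X (ennreal t) \<omega>) \<partial>P (Some x))"

definition associated_process ::
    "'a measure \<Rightarrow> 'a l2op \<Rightarrow> ('a option \<Rightarrow> 'w measure) \<Rightarrow> (ennreal \<Rightarrow> 'w \<Rightarrow> 'a option) \<Rightarrow> bool" where
  "associated_process m L P X \<longleftrightarrow>
     (\<forall>t>0. \<forall>f\<in>L2 m. AE x in m. transition_op P X t f x = op_app (semigroup_op m L t) f x)"

definition strong_feller ::
    "('a::metric_space option \<Rightarrow> 'w measure) \<Rightarrow> (ennreal \<Rightarrow> 'w \<Rightarrow> 'a option) \<Rightarrow> bool" where
  "strong_feller P X \<longleftrightarrow>
     (\<forall>t>0. \<forall>f. f \<in> borel_measurable borel \<and> bounded (range f) \<longrightarrow>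
        continuous_on UNIV (transition_op P X t f) \<and> bounded (range (transition_op P X t f)))"

definition transition_density ::
    "'a::metric_space measure \<Rightarrow> ('a option \<Rightarrow> 'w measure) \<Rightarrow> (ennreal \<Rightarrow> 'w \<Rightarrow> 'a option) \<Rightarrow>
      (real \<Rightarrow> 'a \<Rightarrow> 'a \<Rightarrow> real) \<Rightarrow> bool" where
  "transition_density m P X p \<longleftrightarrow>
     (\<lambda>(t, x, y). p t x y) \<in> borel_measurable (restrict_space borel {0<..} \<Otimes>\<^sub>M borel \<Otimes>\<^sub>M borel) \<and>
     (\<forall>t>0. \<forall>x y. 0 \<le> p t x y \<and> p t x y = p t y x) \<and>
     (\<forall>t>0. \<forall>x. \<forall>f. f \<in> borel_measurable borel \<and> bounded (range f) \<longrightarrow>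
        integrable m (\<lambda>y. p t x y * f y) \<and>
        transition_op P X t f x = (\<integral>y. p t x y * f y \<partial>m))"

definition resolvent_density :: "(real \<Rightarrow> 'a \<Rightarrow> 'a \<Rightarrow> real) \<Rightarrow> real \<Rightarrow> 'a \<Rightarrow> 'a \<Rightarrow> ennreal" where
  "resolvent_density p \<alpha> x y = (\<integral>\<^sup>+t\<in>{0<..}. ennreal (exp (- \<alpha> * t) * p t x y) \<partial>lborel)"

definition resolvent_potential ::
    "(real \<Rightarrow> 'a \<Rightarrow> 'a \<Rightarrow> real) \<Rightarrow> real \<Rightarrow> 'a measure \<Rightarrow> 'a \<Rightarrow> ennreal" where
  "resolvent_potential p \<alpha> \<rho> x = (\<integral>\<^sup>+y. resolvent_density p \<alpha> x y \<partial>\<rho>)"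

text \<open>Any two symmetric densities have, for each \<open>t\<close> and \<open>y\<close>, the same value at \<open>m\<close>-almost every
  \<open>x\<close>; hence, by Fubini, the essential supremum does not depend on the choice of \<open>p\<close>.\<close>

definition kato_class ::
    "'a::metric_space measure \<Rightarrow> ('a \<Rightarrow> real) set \<Rightarrow> 'a form \<Rightarrow>
      ('a option \<Rightarrow> 'w measure) \<Rightarrow> (ennreal \<Rightarrow> 'w \<Rightarrow> 'a option) \<Rightarrow> 'a measure \<Rightarrow> bool" where
  "kato_class m D E P X \<rho> \<longleftrightarrow>
     smooth_measure m D E \<rho> \<and>
     (\<exists>p. transition_density m P X p \<and>
        ((\<lambda>\<alpha>. esssup m (resolvent_potential p \<alpha> \<rho>)) \<longlongrightarrow> 0) at_top)"


section \<open>Wave equation and subcriticality\<close>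

text \<open>The solution \<open>w(t) = sin(t\<surd>A)/\<surd>A g\<close> of \<open>w'' = - A w\<close>, \<open>w(0) = 0\<close>, \<open>w'(0) = g\<close>.\<close>

definition wave_solution :: "'a measure \<Rightarrow> 'a l2op \<Rightarrow> ('a \<Rightarrow> real) \<Rightarrow> real \<Rightarrow> 'a \<Rightarrow> real" where
  "wave_solution m A g t =
     op_app (fun_calc m A (\<lambda>l. if l = 0 then t else sin (t * sqrt l) / sqrt l)) g"

definition extended_approx ::
    "'a measure \<Rightarrow> ('a \<Rightarrow> real) set \<Rightarrow> 'a form \<Rightarrow> ('a \<Rightarrow> real) \<Rightarrow> (nat \<Rightarrow> 'a \<Rightarrow> real) \<Rightarrow> bool" where
  "extended_approx m D E f F \<longleftrightarrow>
     (\<forall>n. F n \<in> D) \<and> form_Cauchy E F \<and> (AE x in m. (\<lambda>n. F n x) \<longlonglongrightarrow> f x)"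

definition extended_dom :: "'a measure \<Rightarrow> ('a \<Rightarrow> real) set \<Rightarrow> 'a form \<Rightarrow> ('a \<Rightarrow> real) set" where
  "extended_dom m D E = {f \<in> borel_measurable m. \<exists>F. extended_approx m D E f F}"

text \<open>The extended form at \<open>f\<close> is \<open>lim E(F\<^sub>n, F\<^sub>n)\<close>; the inequality is stated for every approximating
  sequence \<open>F\<close>, so it does not rely on the limit being independent of \<open>F\<close>.\<close>

definition subcritical_form :: "'a measure \<Rightarrow> ('a \<Rightarrow> real) set \<Rightarrow> 'a form \<Rightarrow> bool" where
  "subcritical_form m D E \<longleftrightarrow>
     (\<exists>g. (\<forall>x. 0 < g x) \<and> bounded (range g) \<and> integrable m g \<and>
        (\<forall>f\<in>extended_dom m D E. \<forall>F. extended_approx m D E f F \<longrightarrow>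
           (\<integral>\<^sup>+x. ennreal (\<bar>f x\<bar> * g x) \<partial>m) \<le> ennreal (sqrt (lim (\<lambda>n. E (F n) (F n))))))"

text \<open>Subcriticality of \<open>A\<^sup>\<beta>\<close>, via the form \<open>\<langle>A\<^bsup>\<beta>/2\<^esup> f, A\<^bsup>\<beta>/2\<^esup> g\<rangle>\<close>.\<close>

definition subcritical_power :: "'a measure \<Rightarrow> 'a l2op \<Rightarrow> real \<Rightarrow> bool" where
  "subcritical_power m A \<beta> \<longleftrightarrow>
     subcritical_form m (Domain (fun_calc m A (\<lambda>l. l powr (\<beta> / 2))))
       (op_form m (fun_calc m A (\<lambda>l. l powr (\<beta> / 2))))"

end

theory Submission
  imports Defs
begin

text \<open>Let \<open>A = -L\<^sup>\<mu>\<close> with spectral measure \<open>P\<close>. Since \<open>\<parallel>w(t)\<parallel>\<^sup>2 = \<integral> sin\<^sup>2(t\<surd>l) / l d\<langle>P g, g\<rangle>\<close>, boundedness of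
  the wave at the dyadic times \<open>t = 2\<^sup>k\<close> bounds \<open>\<integral> l\<^bsup>-\<gamma>\<^esup> d\<langle>P g, g\<rangle>\<close> for every \<open>\<gamma> < 1\<close>. The
  Cauchy--Schwarz inequality \<open>\<bar>\<langle>f, g\<rangle>\<bar> \<le> \<parallel>A\<^bsup>\<gamma>/2\<^esup> f\<parallel> \<parallel>A\<^bsup>-\<gamma>/2\<^esup> g\<parallel>\<close> then has to be applied to \<open>\<bar>f\<bar>\<close> in place
  of \<open>f\<close>. This is possible because \<open>\<integral> l s / (l + s) d\<langle>P f, f\<rangle>\<close> is the minimum over \<open>v\<close> of
  \<open>E\<^sup>\<mu>(v, v) + s \<parallel>f - v\<parallel>\<^sup>2\<close>, which decreases when \<open>f\<close> and \<open>v\<close> are replaced by \<open>\<bar>f\<bar>\<close> and \<open>\<bar>v\<bar>\<close>, and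
  the weight \<open>l\<^sup>\<gamma>\<close> is comparable near \<open>0\<close> to a superposition of such functions of \<open>l\<close>. Fatou's
  lemma extends the resulting bound to the extended domain, and a convergent combination of
  countably many \<open>g\<close> in \<^const>\<open>Cc\<close> gives a strictly positive reference function.

  The spectral theorem is not needed: \<^const>\<open>fun_calc\<close> is the empty graph for an operator without
  spectral measure, whereas \<open>0\<close> lies in the domain of \<open>A\<^bsup>1/2\<^esup>\<close>. The spectrum need not be located in
  \<open>[0, \<infinity>)\<close> either, since \<open>(sqrt l)\<^sup>2 = \<bar>l\<bar>\<close> and \<open>l powr b = \<bar>l\<bar> powr b\<close> for all real \<open>l\<close>.\<close>

section \<open>Square-integrable functions\<close>

text \<open>Passing to |f| is the obstacle: the spectral calculus sees f only through the measures
  <P f, f>, and the order of functions enters only through the form. Because a potential is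
  subtracted, truncation at 1 need not decrease the form, but the absolute value does, since the
  potential terms depend on f^2 alone. A variational minimum inherits this contraction, and
  inequalities between minima add up; hence weights that are sums of \<open>psi s\<close> with
  nonnegative coefficients.

  The dyadic times arise because sin(t sqrt l) / sqrt l has size |l|^(-1/2) on the shell 4^(-k-1) <
  |l| <= 4^(-k) when t = 2^k. Each shell is thus controlled with the same constant, and the factors
  p^(-k), p = 2^(1-\<beta>) > 1, make the sum over shells finite. On the side of f the weight must
  stay below a multiple of |l|^\<beta>; there 4^(-k(1-\<beta>)) = p^(-2k) pays for the coefficient
  p^k and leaves p^(-k) again. The exponent (1 + \<beta>) / 2 is the one for which both losses are
  the same geometric series. At l = 0 the multiplier equals t, which excludes spectral mass of g
  there.\<close>

lemma discriminant_bound: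
  fixes a b c :: real
  assumes nonneg: "\<And>t. 0 \<le> a + 2 * t * b + t\<^sup>2 * c" and "0 \<le> c"
  shows "b\<^sup>2 \<le> a * c"
\<comment> \<open>The degenerate case matters because the semi-inner products of spectral integrals
  and of the Schroedinger form may vanish. There the polynomial is linear, and if \<open>b\<close>
  were nonzero the chosen \<open>t\<close> would give it the value -1. Otherwise
  \<open>t = - b / c\<close> is its minimum.\<close>
proof (cases "c = 0")
  case True
  have "b = 0"
  proof (rule ccontr)
    assume "b \<noteq> 0"
    then show False
      using nonneg[of "- (a + 1) / (2 * b)"] True by (simp add: field_simps)
  qed
  then show ?thesis using True by simp
next
  case False
  with \<open>0 \<le> c\<close> have "0 < c" by simp
  moreover have "0 \<le> a - b\<^sup>2 / c"
    using nonneg[of "- b / c"] \<open>0 < c\<close> by (simp add: field_simps power2_eq_square)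
  ultimately show ?thesis by (simp add: field_simps)
qed

lemma L2_measurable: "f \<in> L2 m \<Longrightarrow> f \<in> borel_measurable m"
  by (simp add: L2_def)

lemma L2_integrable_mult:
  assumes "f \<in> L2 m" "g \<in> L2 m"
  shows "integrable m (\<lambda>x. f x * g x)"
proof (rule Bochner_Integration.integrable_bound)
  show "integrable m (\<lambda>x. (f x)\<^sup>2 + (g x)\<^sup>2)"
    using assms by (simp add: L2_def)
  show "(\<lambda>x. f x * g x) \<in> borel_measurable m"
    using assms[THEN L2_measurable] by measurable
  have "\<bar>a * b\<bar> \<le> a\<^sup>2 + b\<^sup>2" for a b :: real
  proof -
    have "2 * (\<bar>a\<bar> * \<bar>b\<bar>) \<le> a\<^sup>2 + b\<^sup>2"
      using sum_squares_bound[of "\<bar>a\<bar>" "\<bar>b\<bar>"] by (simp add: mult.assoc)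
    moreover have "0 \<le> \<bar>a\<bar> * \<bar>b\<bar>" by simp
    ultimately show ?thesis unfolding abs_mult by linarith
  qed
  then show "AE x in m. norm (f x * g x) \<le> norm ((f x)\<^sup>2 + (g x)\<^sup>2)"
    by (simp only: real_norm_def) simp
qed

lemma L2_add:
  assumes "f \<in> L2 m" "g \<in> L2 m"
  shows "(\<lambda>x. f x + g x) \<in> L2 m"
proof -
  have "integrable m (\<lambda>x. f x * f x + 2 * (f x * g x) + g x * g x)"
    using assms by (intro Bochner_Integration.integrable_add integrable_mult_right L2_integrable_mult)
  then have "integrable m (\<lambda>x. (f x + g x)\<^sup>2)"
    by (rule Bochner_Integration.integrable_cong[THEN iffD1, rotated 2])
       (auto simp: power2_eq_square algebra_simps)
  then show ?thesis using assms by (auto simp: L2_def)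
qed

lemma L2_scale: "f \<in> L2 m \<Longrightarrow> (\<lambda>x. c * f x) \<in> L2 m"
  by (auto simp: L2_def power_mult_distrib)

lemma L2_uminus: "f \<in> L2 m \<Longrightarrow> (\<lambda>x. - f x) \<in> L2 m"
  by (auto simp: L2_def)

lemma L2_diff:
  assumes "f \<in> L2 m" "g \<in> L2 m"
  shows "(\<lambda>x. f x - g x) \<in> L2 m"
  using L2_add[OF assms(1) L2_uminus[OF assms(2)]] by simp

lemma L2_abs: "f \<in> L2 m \<Longrightarrow> (\<lambda>x. \<bar>f x\<bar>) \<in> L2 m"
  by (auto simp: L2_def)

lemma L2_zero: "(\<lambda>x. 0) \<in> L2 m"
  by (auto simp: L2_def)

lemmas L2_intros = L2_add L2_diff L2_scale L2_uminus L2_abs L2_zero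

lemma ip_commute: "ip m f g = ip m g f"
  by (simp add: ip_def mult.commute)

lemma ip_add_left:
  assumes "f \<in> L2 m" "g \<in> L2 m" "h \<in> L2 m"
  shows "ip m (\<lambda>x. f x + g x) h = ip m f h + ip m g h"
  using L2_integrable_mult[OF assms(1,3)] L2_integrable_mult[OF assms(2,3)]
  by (simp add: ip_def distrib_right)

lemma ip_diff_left:
  assumes "f \<in> L2 m" "g \<in> L2 m" "h \<in> L2 m"
  shows "ip m (\<lambda>x. f x - g x) h = ip m f h - ip m g h"
  using L2_integrable_mult[OF assms(1,3)] L2_integrable_mult[OF assms(2,3)]
  by (simp add: ip_def left_diff_distrib)

lemma ip_scale_left: "ip m (\<lambda>x. c * f x) h = c * ip m f h"
  by (simp add: ip_def mult.assoc)

lemma ip_add_right: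
  assumes "f \<in> L2 m" "g \<in> L2 m" "h \<in> L2 m"
  shows "ip m h (\<lambda>x. f x + g x) = ip m h f + ip m h g"
  using ip_add_left[OF assms] by (simp add: ip_commute)

lemma ip_diff_right:
  assumes "f \<in> L2 m" "g \<in> L2 m" "h \<in> L2 m"
  shows "ip m h (\<lambda>x. f x - g x) = ip m h f - ip m h g"
  using ip_diff_left[OF assms] by (simp add: ip_commute)

lemma ip_scale_right: "ip m h (\<lambda>x. c * f x) = c * ip m h f"
  using ip_scale_left[of m c f h] by (simp add: ip_commute)

lemmas ip_linear = ip_add_left ip_diff_left ip_scale_left ip_add_right ip_diff_right ip_scale_right

lemma ip_cong_AE:
  assumes "AE x in m. f x = f' x" "f \<in> borel_measurable m" "f' \<in> borel_measurable m"
    and "g \<in> borel_measurable m"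
  shows "ip m f g = ip m f' g"
  unfolding ip_def
  by (rule integral_cong_AE) (use assms in auto)

lemma ip_self_nonneg: "0 \<le> ip m f f"
  by (simp add: ip_def)

lemma l2norm_power2: "(l2norm m f)\<^sup>2 = ip m f f"
  by (simp add: l2norm_def ip_self_nonneg)

lemma l2norm_nonneg: "0 \<le> l2norm m f"
  by (simp add: l2norm_def ip_self_nonneg)

lemma ip_Cauchy_Schwarz:
  assumes "f \<in> L2 m" "g \<in> L2 m"
  shows "\<bar>ip m f g\<bar> \<le> l2norm m f * l2norm m g"
proof -
  have "0 \<le> ip m f f + 2 * t * ip m f g + t\<^sup>2 * ip m g g" for t
  proof -
    have "ip m (\<lambda>x. f x + t * g x) (\<lambda>x. f x + t * g x)
        = ip m f f + 2 * t * ip m f g + t\<^sup>2 * ip m g g"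
      using assms
      by (simp add: ip_linear L2_intros ip_commute[of m g f] algebra_simps power2_eq_square)
    then show ?thesis by (metis ip_self_nonneg)
  qed
  then have "(ip m f g)\<^sup>2 \<le> ip m f f * ip m g g"
    by (rule discriminant_bound) (rule ip_self_nonneg)
  then have "sqrt ((ip m f g)\<^sup>2) \<le> sqrt (ip m f f * ip m g g)"
    by (rule real_sqrt_le_mono)
  then show ?thesis by (simp add: l2norm_def real_sqrt_mult)
qed

lemma l2norm_triangle:
  assumes "f \<in> L2 m" "g \<in> L2 m"
  shows "l2norm m (\<lambda>x. f x + g x) \<le> l2norm m f + l2norm m g"
proof (rule power2_le_imp_le)
  have "ip m f g \<le> l2norm m f * l2norm m g"
    using ip_Cauchy_Schwarz[OF assms] by simp
  then show "(l2norm m (\<lambda>x. f x + g x))\<^sup>2 \<le> (l2norm m f + l2norm m g)\<^sup>2"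
    using assms
    by (simp add: l2norm_power2 power2_sum ip_linear L2_intros ip_commute[of m g f])
qed (simp add: l2norm_nonneg)

lemma l2norm_minus_commute: "l2norm m (\<lambda>x. f x - g x) = l2norm m (\<lambda>x. g x - f x)"
proof -
  have "(f x - g x) * (f x - g x) = (g x - f x) * (g x - f x)" for x
    by (simp add: algebra_simps)
  then show ?thesis by (simp add: l2norm_def ip_def)
qed

lemma l2norm_triangle_diff:
  assumes "f \<in> L2 m" "g \<in> L2 m"
  shows "\<bar>l2norm m f - l2norm m g\<bar> \<le> l2norm m (\<lambda>x. f x - g x)"
proof -
  have "l2norm m f \<le> l2norm m (\<lambda>x. f x - g x) + l2norm m g"
    using l2norm_triangle[OF L2_diff[OF assms] assms(2)] by simp
  moreover have "l2norm m g \<le> l2norm m (\<lambda>x. g x - f x) + l2norm m f"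
    using l2norm_triangle[OF L2_diff[OF assms(2,1)] assms(1)] by simp
  ultimately show ?thesis by (simp add: l2norm_minus_commute[of m g f])
qed

lemma nn_integral_square_L2:
  assumes "f \<in> L2 m"
  shows "(\<integral>\<^sup>+x. ennreal ((f x)\<^sup>2) \<partial>m) = ennreal ((l2norm m f)\<^sup>2)"
  unfolding l2norm_power2 ip_def power2_eq_square[symmetric]
  using assms by (intro nn_integral_eq_integral) (auto simp: L2_def)

lemma L2_tendsto_ip:
  assumes "\<And>n. F n \<in> L2 m" "f \<in> L2 m" "g \<in> L2 m"
    and lim: "(\<lambda>n. l2norm m (\<lambda>x. F n x - f x)) \<longlonglongrightarrow> 0"
  shows "(\<lambda>n. ip m (F n) g) \<longlonglongrightarrow> ip m f g"
proof (rule LIM_zero_cancel, rule tendsto_rabs_zero_cancel, rule tendsto_sandwich[of "\<lambda>_. 0"])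
  show "(\<lambda>n. l2norm m (\<lambda>x. F n x - f x) * l2norm m g) \<longlonglongrightarrow> 0"
    using tendsto_mult_left_zero[OF lim] .
  show "\<forall>\<^sub>F n in sequentially. \<bar>ip m (F n) g - ip m f g\<bar> \<le> l2norm m (\<lambda>x. F n x - f x) * l2norm m g"
    using assms ip_Cauchy_Schwarz[OF L2_diff, of "F _" m f g] by (simp add: ip_linear)
qed auto

text \<open>The measure may be infinite, so the increments \<open>d k\<close> cannot simply be
  estimated in L1. Instead 2^k d_k^2 has integral at most 2^(-k), so its sum is finite almost
  everywhere, and |d_k| <= 2^(-k) + 2^k d_k^2 turns this into absolute convergence of the
  telescoping series.\<close>

lemma L2_AE_convergent_of_fast_Cauchy:
  assumes G: "\<And>k. G k \<in> L2 m"
    and fast: "\<And>k. l2norm m (\<lambda>x. G (Suc k) x - G k x) \<le> (1 / 2) ^ k"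
  shows "AE x in m. convergent (\<lambda>k. G k x)"
proof -
  note [measurable] = G[THEN L2_measurable]
  define d where "d k x = G (Suc k) x - G k x" for k x
  have [measurable]: "d k \<in> borel_measurable m" for k by (simp add: d_def[abs_def])
  have dL: "d k \<in> L2 m" for k unfolding d_def[abs_def] by (intro L2_intros G)
  have "(\<integral>\<^sup>+x. (\<Sum>k. ennreal (2 ^ k * (d k x)\<^sup>2)) \<partial>m) = (\<Sum>k. \<integral>\<^sup>+x. ennreal (2 ^ k * (d k x)\<^sup>2) \<partial>m)"
    by (rule nn_integral_suminf) measurable
  also have "\<dots> \<le> (\<Sum>k. ennreal ((1 / 2) ^ k))"
  proof (rule suminf_le)
    fix k
    have "(l2norm m (d k))\<^sup>2 \<le> ((1 / 2) ^ k)\<^sup>2"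
      using fast[of k] by (intro power_mono) (auto simp: d_def[abs_def] l2norm_nonneg)
    then have "2 ^ k * (l2norm m (d k))\<^sup>2 \<le> 2 ^ k * ((1 / 2) ^ k)\<^sup>2"
      by (rule mult_left_mono) simp
    also have "\<dots> = (1 / 2) ^ k"
      by (simp add: power2_eq_square power_divide)
    finally have "ennreal (2 ^ k) * ennreal ((l2norm m (d k))\<^sup>2) \<le> ennreal ((1 / 2) ^ k)"
      by (subst ennreal_mult[symmetric]) (auto intro: ennreal_leI)
    moreover have "(\<integral>\<^sup>+x. ennreal (2 ^ k * (d k x)\<^sup>2) \<partial>m)
        = ennreal (2 ^ k) * (\<integral>\<^sup>+x. ennreal ((d k x)\<^sup>2) \<partial>m)"
    proof -
      have "(\<lambda>x. ennreal (2 ^ k * (d k x)\<^sup>2)) = (\<lambda>x. ennreal (2 ^ k) * ennreal ((d k x)\<^sup>2))"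
        by (rule ext, rule ennreal_mult) simp_all
      moreover have "(\<lambda>x. ennreal ((d k x)\<^sup>2)) \<in> borel_measurable m" by measurable
      ultimately show ?thesis by (simp only: nn_integral_cmult)
    qed
    ultimately show "(\<integral>\<^sup>+x. ennreal (2 ^ k * (d k x)\<^sup>2) \<partial>m) \<le> ennreal ((1 / 2) ^ k)"
      by (simp only: nn_integral_square_L2[OF dL])
  qed auto
  also have "\<dots> < \<infinity>"
    by (subst suminf_ennreal2) (auto intro!: summable_geometric simp: less_top[symmetric])
  finally have "AE x in m. (\<Sum>k. ennreal (2 ^ k * (d k x)\<^sup>2)) \<noteq> \<infinity>"
    by (intro nn_integral_PInf_AE) auto
  then show ?thesis
  proof eventually_elim
    fix x assume "(\<Sum>k. ennreal (2 ^ k * (d k x)\<^sup>2)) \<noteq> \<infinity>"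
    then have "summable (\<lambda>k. 2 ^ k * (d k x)\<^sup>2)"
      by (intro summable_suminf_not_top) auto
    then have "summable (\<lambda>k. (1 / 2) ^ k + 2 ^ k * (d k x)\<^sup>2)"
      by (intro summable_add) auto
    then have "summable (\<lambda>k. d k x)"
    proof (rule summable_comparison_test[rotated], intro exI[of _ 0] allI impI)
      fix k :: nat
      have "\<bar>t\<bar> \<le> 1 / a + a * t\<^sup>2" if "0 < a" for a t :: real
      proof -
        have "0 \<le> (a * \<bar>t\<bar> - 1)\<^sup>2" "0 \<le> a * \<bar>t\<bar>" using that by auto
        then have "a * \<bar>t\<bar> \<le> 1 + (a * t)\<^sup>2"
          by (simp add: power2_eq_square algebra_simps)
        then show ?thesis using that by (simp add: field_simps power2_eq_square)
      qed
      from this[of "2 ^ k" "d k x"] show "norm (d k x) \<le> (1 / 2) ^ k + 2 ^ k * (d k x)\<^sup>2"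
        by (simp add: power_divide)
    qed
    then have "convergent (\<lambda>n. \<Sum>k<n. d k x)"
      by (simp add: summable_iff_convergent)
    then have "convergent (\<lambda>n. (\<Sum>k<n. d k x) + G 0 x)"
      by (intro convergent_add convergent_const)
    then show "convergent (\<lambda>n. G n x)"
      by (simp add: d_def sum_lessThan_telescope[of "\<lambda>n. G n x"])
  qed
qed

text \<open>Riesz-Fischer: the limit is the pointwise limit along a fast subsequence, and Fatou's
  lemma bounds the distance from each late term to it.\<close>

lemma L2_complete:
  assumes F: "\<And>n. F n \<in> L2 m"
    and Cauchy: "\<And>e. 0 < e \<Longrightarrow> \<exists>N. \<forall>i\<ge>N. \<forall>j\<ge>N. l2norm m (\<lambda>x. F i x - F j x) < e"
  obtains f where "f \<in> L2 m" "(\<lambda>n. l2norm m (\<lambda>x. F n x - f x)) \<longlonglongrightarrow> 0"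
proof -
  note [measurable] = F[THEN L2_measurable]
  have "\<exists>N. \<forall>i\<ge>N. \<forall>j\<ge>N. l2norm m (\<lambda>x. F i x - F j x) < (1 / 2) ^ k" for k :: nat
    by (rule Cauchy) simp
  then obtain N where N: "\<And>k i j. N k \<le> i \<Longrightarrow> N k \<le> j \<Longrightarrow> l2norm m (\<lambda>x. F i x - F j x) < (1 / 2) ^ k"
    by metis
  \<comment> \<open>The sum makes \<open>r\<close> increasing with \<open>N k \<le> r k\<close>; the
    extra \<open>k\<close> gives \<open>k \<le> r k\<close>, so that in the Fatou argument every
    late index \<open>n\<close> satisfies \<open>N k \<le> r n\<close>.\<close>
  define r where "r k = (\<Sum>i\<le>k. N i) + k" for k
  have N_le_r: "N k \<le> r k" and r_le: "r k \<le> r (Suc k)" and k_le_r: "k \<le> r k" for k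
    by (auto simp: r_def atMost_Suc intro: trans_le_add1 member_le_sum)
  have "AE x in m. convergent (\<lambda>k. F (r k) x)"
  proof (rule L2_AE_convergent_of_fast_Cauchy)
    show "l2norm m (\<lambda>x. F (r (Suc k)) x - F (r k) x) \<le> (1 / 2) ^ k" for k
      using N[of k "r (Suc k)" "r k"] N_le_r[of k] r_le[of k] by simp
  qed (rule F)
  moreover define f where "f x = lim (\<lambda>k. F (r k) x)" for x
  ultimately have f_lim: "AE x in m. (\<lambda>k. F (r k) x) \<longlonglongrightarrow> f x"
    by (simp add: convergent_LIMSEQ_iff)
  have [measurable]: "f \<in> borel_measurable m"
    unfolding f_def[abs_def] by measurable
  have Fatou: "(\<integral>\<^sup>+x. ennreal ((F i x - f x)\<^sup>2) \<partial>m) \<le> ennreal (((1 / 2) ^ k)\<^sup>2)" if "N k \<le> i" for i k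
  proof -
    have "AE x in m. ennreal ((F i x - f x)\<^sup>2) = liminf (\<lambda>n. ennreal ((F i x - F (r n) x)\<^sup>2))"
      using f_lim
    proof eventually_elim
      fix x assume "(\<lambda>n. F (r n) x) \<longlonglongrightarrow> f x"
      then have "(\<lambda>n. ennreal ((F i x - F (r n) x)\<^sup>2)) \<longlonglongrightarrow> ennreal ((F i x - f x)\<^sup>2)"
        by (intro tendsto_ennrealI tendsto_intros)
      from lim_imp_Liminf[OF _ this]
      show "ennreal ((F i x - f x)\<^sup>2) = liminf (\<lambda>n. ennreal ((F i x - F (r n) x)\<^sup>2))"
        by simp
    qed
    then have "(\<integral>\<^sup>+x. ennreal ((F i x - f x)\<^sup>2) \<partial>m)
        = (\<integral>\<^sup>+x. liminf (\<lambda>n. ennreal ((F i x - F (r n) x)\<^sup>2)) \<partial>m)"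
      by (rule nn_integral_cong_AE)
    also have "\<dots> \<le> liminf (\<lambda>n. \<integral>\<^sup>+x. ennreal ((F i x - F (r n) x)\<^sup>2) \<partial>m)"
      by (rule nn_integral_liminf) measurable
    also have "\<dots> \<le> ennreal (((1 / 2) ^ k)\<^sup>2)"
    proof (rule Liminf_le)
      have "(\<integral>\<^sup>+x. ennreal ((F i x - F (r n) x)\<^sup>2) \<partial>m) \<le> ennreal (((1 / 2) ^ k)\<^sup>2)" if "N k \<le> n" for n
      proof -
        have "l2norm m (\<lambda>x. F i x - F (r n) x) \<le> (1 / 2) ^ k"
          using N[of k i "r n"] \<open>N k \<le> i\<close> that k_le_r[of n] by simp
        then show ?thesis
          by (subst nn_integral_square_L2)
             (auto intro!: L2_intros F ennreal_leI power_mono l2norm_nonneg)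
      qed
      then show "\<forall>\<^sub>F n in sequentially. (\<integral>\<^sup>+x. ennreal ((F i x - F (r n) x)\<^sup>2) \<partial>m) \<le> ennreal (((1 / 2) ^ k)\<^sup>2)"
        by (auto simp: eventually_sequentially)
    qed simp
    finally show ?thesis .
  qed
  have diff: "(\<lambda>x. F i x - f x) \<in> L2 m" if "N 0 \<le> i" for i
    using order.strict_trans1[OF Fatou[OF that] ennreal_less_top]
    by (auto simp: L2_def intro!: integrableI_nonneg)
  have f: "f \<in> L2 m"
    using L2_diff[OF F[of "N 0"] diff[OF order_refl]] by simp
  moreover have "(\<lambda>n. l2norm m (\<lambda>x. F n x - f x)) \<longlonglongrightarrow> 0"
  proof (rule LIMSEQ_I)
    fix e :: real assume "0 < e"
    then obtain k where k: "(1 / 2 :: real) ^ k < e"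
      using real_arch_pow_inv[of e "1 / 2"] by auto
    have "l2norm m (\<lambda>x. F n x - f x) \<le> (1 / 2) ^ k" if "N k \<le> n" for n
    proof (rule power2_le_imp_le)
      have "ennreal ((l2norm m (\<lambda>x. F n x - f x))\<^sup>2) \<le> ennreal (((1 / 2) ^ k)\<^sup>2)"
        using Fatou[OF that] unfolding nn_integral_square_L2[OF L2_diff[OF F f]] .
      then show "(l2norm m (\<lambda>x. F n x - f x))\<^sup>2 \<le> ((1 / 2) ^ k)\<^sup>2"
        by (subst (asm) ennreal_le_iff) (rule zero_le_power2)
    qed simp
    from le_less_trans[OF this k]
    have "norm (l2norm m (\<lambda>x. F n x - f x) - 0) < e" if "N k \<le> n" for n
      using that by (simp add: abs_of_nonneg[OF l2norm_nonneg])
    then show "\<exists>no. \<forall>n\<ge>no. norm (l2norm m (\<lambda>x. F n x - f x) - 0) < e"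
      by blast
  qed
  ultimately show thesis by (rule that)
qed


section \<open>Bounded Borel functional calculus\<close>

definition bdd_borel :: "(real \<Rightarrow> real) set" where
  "bdd_borel = {\<phi> \<in> borel_measurable borel. \<exists>K. \<forall>l. \<bar>\<phi> l\<bar> \<le> K}"

lemma bdd_borelI: "\<phi> \<in> borel_measurable borel \<Longrightarrow> (\<And>l. \<bar>\<phi> l\<bar> \<le> K) \<Longrightarrow> \<phi> \<in> bdd_borel"
  by (auto simp: bdd_borel_def)

lemma bdd_borel_measurable: "\<phi> \<in> bdd_borel \<Longrightarrow> \<phi> \<in> borel_measurable borel"
  by (simp add: bdd_borel_def)

lemma bdd_borel_bound:
  assumes "\<phi> \<in> bdd_borel"
  obtains K where "0 \<le> K" "\<And>l. \<bar>\<phi> l\<bar> \<le> K"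
proof -
  obtain K where K: "\<And>l. \<bar>\<phi> l\<bar> \<le> K" using assms by (auto simp: bdd_borel_def)
  with order_trans[OF abs_ge_zero K] show thesis by (intro that[of K]) auto
qed

lemma bdd_borel_indicator: "B \<in> sets borel \<Longrightarrow> indicator B \<in> bdd_borel"
  by (rule bdd_borelI[of _ 1]) (auto simp: indicator_def)

lemma bdd_borel_const: "(\<lambda>l. c) \<in> bdd_borel"
  by (rule bdd_borelI[of _ "\<bar>c\<bar>"]) auto

lemma bdd_borel_add:
  assumes "\<phi> \<in> bdd_borel" "\<eta> \<in> bdd_borel"
  shows "(\<lambda>l. \<phi> l + \<eta> l) \<in> bdd_borel"
proof -
  from assms obtain K K' where K: "\<And>l. \<bar>\<phi> l\<bar> \<le> K" "\<And>l. \<bar>\<eta> l\<bar> \<le> K'"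
    by (metis bdd_borel_bound)
  have "\<bar>\<phi> l + \<eta> l\<bar> \<le> K + K'" for l
    using K[of l] by linarith
  moreover have "(\<lambda>l. \<phi> l + \<eta> l) \<in> borel_measurable borel"
    using assms[THEN bdd_borel_measurable] by (rule borel_measurable_add)
  ultimately show ?thesis by (auto intro: bdd_borelI)
qed

lemma bdd_borel_mult:
  assumes "\<phi> \<in> bdd_borel" "\<eta> \<in> bdd_borel"
  shows "(\<lambda>l. \<phi> l * \<eta> l) \<in> bdd_borel"
proof -
  from assms obtain K K' where K: "0 \<le> K" "\<And>l. \<bar>\<phi> l\<bar> \<le> K" "\<And>l. \<bar>\<eta> l\<bar> \<le> K'"
    by (metis bdd_borel_bound)
  have "\<bar>\<phi> l * \<eta> l\<bar> \<le> K * K'" for l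
    unfolding abs_mult using K by (intro mult_mono) auto
  moreover have "(\<lambda>l. \<phi> l * \<eta> l) \<in> borel_measurable borel"
    using assms[THEN bdd_borel_measurable] by (rule borel_measurable_times)
  ultimately show ?thesis by (auto intro: bdd_borelI)
qed

lemma bdd_borel_diff:
  assumes "\<phi> \<in> bdd_borel" "\<eta> \<in> bdd_borel"
  shows "(\<lambda>l. \<phi> l - \<eta> l) \<in> bdd_borel"
  using bdd_borel_add[OF assms(1) bdd_borel_mult[OF bdd_borel_const[of "-1"] assms(2)]] by simp

lemma bdd_borel_power2: "\<phi> \<in> bdd_borel \<Longrightarrow> (\<lambda>l. (\<phi> l)\<^sup>2) \<in> bdd_borel"
  unfolding power2_eq_square by (intro bdd_borel_mult)

lemmas bdd_borel_intros =
  bdd_borel_indicator bdd_borel_const bdd_borel_add bdd_borel_diff bdd_borel_mult bdd_borel_power2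

text \<open>In the limit case the approximations are nonnegative, increasing and uniformly bounded,
  which is what dominated convergence for the finite spectral measures requires. The underlying
  induction runs through arbitrary nonnegative functions, so boundedness is carried as a premise of
  the induction statement; signs are restored by splitting into positive and negative part.\<close>

lemma bdd_borel_induct [consumes 1, case_names indicator add scale lim]:
  assumes \<phi>: "\<phi> \<in> bdd_borel"
    and indicator: "\<And>A. A \<in> sets borel \<Longrightarrow> Q (indicator A)"
    and add: "\<And>u v. u \<in> bdd_borel \<Longrightarrow> v \<in> bdd_borel \<Longrightarrow> Q u \<Longrightarrow> Q v \<Longrightarrow> Q (\<lambda>l. u l + v l)"
    and scale: "\<And>c u. u \<in> bdd_borel \<Longrightarrow> Q u \<Longrightarrow> Q (\<lambda>l. c * u l)"
    and lim: "\<And>U u K. (\<And>i. U i \<in> bdd_borel) \<Longrightarrow> u \<in> bdd_borel \<Longrightarrow> (\<And>i l. 0 \<le> U i l) \<Longrightarrow>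
      (\<And>i l. U i l \<le> K) \<Longrightarrow> incseq U \<Longrightarrow> (\<And>l. (\<lambda>i. U i l) \<longlonglongrightarrow> u l) \<Longrightarrow> (\<And>i. Q (U i)) \<Longrightarrow> Q u"
  shows "Q \<phi>"
proof -
  have nonneg: "u \<in> bdd_borel \<longrightarrow> Q u" if "u \<in> borel_measurable borel" "\<And>l. 0 \<le> u l"
    for u :: "real \<Rightarrow> real"
    using that
  proof (induction u rule: borel_measurable_induct_real)
    case (set A)
    then show ?case by (simp add: indicator)
  next
    case (mult u c)
    show ?case
    \<comment> \<open>If \<open>c = 0\<close>, boundedness of \<open>c * u\<close> says nothing
      about \<open>u\<close>, so the zero function is produced as a multiple of an
      indicator.\<close>
    proof (cases "c = 0")
      case True
      then show ?thesis using scale[OF bdd_borel_indicator indicator, of UNIV 0] by simp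
    next
      case False
      show ?thesis
      proof
        assume *: "(\<lambda>l. c * u l) \<in> bdd_borel"
        have "(\<lambda>l. inverse c * (c * u l)) \<in> bdd_borel"
          by (intro bdd_borel_mult bdd_borel_const *)
        with False have "u \<in> bdd_borel" by (simp add: mult.assoc[symmetric])
        with mult show "Q (\<lambda>l. c * u l)" by (intro scale) auto
      qed
    qed
  next
    case (add u v)
    show ?case
    proof
      assume "(\<lambda>l. v l + u l) \<in> bdd_borel"
      then obtain K where K: "\<And>l. \<bar>v l + u l\<bar> \<le> K" by (rule bdd_borel_bound) blast
      have "\<bar>u l\<bar> \<le> K" "\<bar>v l\<bar> \<le> K" for l
        using K[of l] add.hyps(2)[of l] add.hyps(4)[of l] by linarith+
      then have "u \<in> bdd_borel" "v \<in> bdd_borel"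
        using add.hyps by (auto intro: bdd_borelI[of _ K])
      with add show "Q (\<lambda>l. v l + u l)" by (intro assms(3)) auto
    qed
  next
    case (seq U)
    show ?case
    proof
      assume u: "u \<in> bdd_borel"
      then obtain K where K: "\<And>l. \<bar>u l\<bar> \<le> K" by (rule bdd_borel_bound) blast
      have le: "U i l \<le> u l" for i l
        using seq.hyps(3) seq.hyps(4)[of l] by (intro incseq_le) (auto simp: incseq_def le_fun_def)
      have "U i l \<le> K" for i l using le[of i l] K[of l] by linarith
      moreover from this have "U i \<in> bdd_borel" for i
        using seq.hyps(1,2) by (intro bdd_borelI[of _ K]) auto
      ultimately show "Q u" using seq u by (intro lim[of U u K]) auto
    qed
  qed
  from \<phi> obtain K where K: "0 \<le> K" "\<And>l. \<bar>\<phi> l\<bar> \<le> K" by (metis bdd_borel_bound)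
  have parts: "(\<lambda>l. max 0 (\<phi> l)) \<in> bdd_borel" "(\<lambda>l. max 0 (- \<phi> l)) \<in> bdd_borel"
    using K \<phi>[THEN bdd_borel_measurable] by (auto intro!: bdd_borelI[of _ K] simp: abs_le_iff)
  then have "Q (\<lambda>l. max 0 (\<phi> l) + (-1) * max 0 (- \<phi> l))"
    using nonneg[OF bdd_borel_measurable] by (intro add scale bdd_borel_mult bdd_borel_const) auto
  also have "(\<lambda>l. max 0 (\<phi> l) + (-1) * max 0 (- \<phi> l)) = \<phi>"
    by (auto simp: max_def)
  finally show ?thesis .
qed

section \<open>Diagonal measures and polarised integrals of a projection-valued measure\<close>

locale pvm =
  fixes m :: "'a measure" and P :: "real set \<Rightarrow> ('a \<Rightarrow> real) \<Rightarrow> ('a \<Rightarrow> real)"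
  assumes pvm: "projection_valued_measure m P"
begin

lemma P_L2: "B \<in> sets borel \<Longrightarrow> f \<in> L2 m \<Longrightarrow> P B f \<in> L2 m"
  using pvm by (auto simp: projection_valued_measure_def)

lemma P_symmetric:
  "B \<in> sets borel \<Longrightarrow> f \<in> L2 m \<Longrightarrow> g \<in> L2 m \<Longrightarrow> ip m (P B f) g = ip m f (P B g)"
  using pvm by (auto simp: projection_valued_measure_def)

lemma ip_P_P:
  assumes "B \<in> sets borel" "C \<in> sets borel" "f \<in> L2 m" "g \<in> L2 m"
  shows "ip m (P B f) (P C g) = ip m (P (B \<inter> C) f) g"
proof -
  have "AE x in m. P (C \<inter> B) f x = P C (P B f) x"
    using pvm assms by (auto simp: projection_valued_measure_def)
  then have "ip m (P (C \<inter> B) f) g = ip m (P C (P B f)) g"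
    by (rule ip_cong_AE) (auto intro!: L2_measurable P_L2 assms)
  also have "\<dots> = ip m (P B f) (P C g)"
    using assms by (intro P_symmetric P_L2)
  finally show ?thesis by (simp add: Int_commute)
qed

lemma ip_P_UNIV:
  assumes "f \<in> L2 m" "g \<in> L2 m"
  shows "ip m (P UNIV f) g = ip m f g"
proof (rule ip_cong_AE)
  show "AE x in m. P UNIV f x = f x"
    using pvm assms by (auto simp: projection_valued_measure_def)
qed (auto intro!: L2_measurable P_L2 assms)

lemma ip_P_sums:
  assumes "range B \<subseteq> sets borel" "disjoint_family B" "f \<in> L2 m" "g \<in> L2 m"
  shows "(\<lambda>i::nat. ip m (P (B i) f) g) sums ip m (P (\<Union>i. B i) f) g"
  using pvm assms unfolding projection_valued_measure_def by blast

lemma ip_P_linear: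
  assumes "B \<in> sets borel" "f \<in> L2 m" "g \<in> L2 m" "h \<in> L2 m"
  shows ip_P_add: "ip m (P B (\<lambda>x. f x + g x)) h = ip m (P B f) h + ip m (P B g) h"
    and ip_P_diff: "ip m (P B (\<lambda>x. f x - g x)) h = ip m (P B f) h - ip m (P B g) h"
  using assms by (simp_all add: P_symmetric ip_linear L2_intros P_L2)

lemma ip_P_commute:
  assumes "B \<in> sets borel" "f \<in> L2 m" "g \<in> L2 m"
  shows "ip m (P B f) g = ip m (P B g) f"
  using P_symmetric[OF assms] ip_commute[of m f] by simp

lemma ip_P_nonneg:
  assumes "B \<in> sets borel" "f \<in> L2 m"
  shows "0 \<le> ip m (P B f) f"
  using ip_P_P[of B B f f] assms ip_self_nonneg[of m "P B f"] by simp

lemma space_diag [simp]: "space (diag_measure m P f) = UNIV"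
  by (simp add: diag_measure_def)

lemma sets_diag [simp, measurable_cong]: "sets (diag_measure m P f) = sets borel"
  by (simp add: diag_measure_def sets.sigma_sets_eq[of borel, simplified])

lemma emeasure_diag:
  assumes B: "B \<in> sets borel" and f: "f \<in> L2 m"
  shows "emeasure (diag_measure m P f) B = ennreal (ip m (P B f) f)"
proof (rule emeasure_measure_of[OF diag_measure_def])
  \<comment> \<open>The empty sets form a disjoint family, so the value at the empty set is the sum
    of a constant series and must be 0.\<close>
  have "(\<lambda>i. ip m (P {} f) f) sums ip m (P {} f) f"
    using ip_P_sums[of "\<lambda>_. {}" f f] f by (auto simp: disjoint_family_on_def)
  then have "ip m (P {} f) f = 0"
    by (simp add: sums_iff summable_const_iff)
  then show "positive (sets (diag_measure m P f)) (\<lambda>B. ennreal (ip m (P B f) f))"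
    by (simp add: positive_def)
  show "countably_additive (sets (diag_measure m P f)) (\<lambda>B. ennreal (ip m (P B f) f))"
  proof (rule countably_additiveI)
    fix A :: "nat \<Rightarrow> real set"
    assume A: "range A \<subseteq> sets (diag_measure m P f)" "disjoint_family A"
    then have "(\<lambda>i. ip m (P (A i) f) f) sums ip m (P (\<Union>i. A i) f) f"
      using f by (intro ip_P_sums) auto
    then show "(\<Sum>i. ennreal (ip m (P (A i) f) f)) = ennreal (ip m (P (\<Union>i. A i) f) f)"
      using A f by (subst suminf_ennreal2) (auto simp: sums_iff intro!: ip_P_nonneg)
  qed
qed (use B in auto)

lemma measure_diag:
  assumes "B \<in> sets borel" "f \<in> L2 m"
  shows "measure (diag_measure m P f) B = ip m (P B f) f"
  using assms by (simp add: measure_def emeasure_diag ip_P_nonneg)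

lemma finite_measure_diag: "f \<in> L2 m \<Longrightarrow> finite_measure (diag_measure m P f)"
  by (rule finite_measureI) (simp add: emeasure_diag)

lemma integrable_diag:
  assumes "f \<in> L2 m" "\<phi> \<in> bdd_borel"
  shows "integrable (diag_measure m P f) \<phi>"
proof -
  interpret finite_measure "diag_measure m P f" by (rule finite_measure_diag) fact
  obtain K where "\<And>l. \<bar>\<phi> l\<bar> \<le> K" using assms(2) by (metis bdd_borel_bound)
  then show ?thesis
    using bdd_borel_measurable[OF assms(2)] by (intro integrable_const_bound[where B = K]) auto
qed

lemma integral_diag_tendsto:
  fixes U :: "nat \<Rightarrow> real \<Rightarrow> real" and K :: real
  assumes f: "f \<in> L2 m" and U: "\<And>i. U i \<in> borel_measurable borel" "\<And>i l. \<bar>U i l\<bar> \<le> K"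
    and u: "u \<in> borel_measurable borel" and lim: "\<And>l. (\<lambda>i. U i l) \<longlonglongrightarrow> u l"
  shows "(\<lambda>i. integral\<^sup>L (diag_measure m P f) (U i)) \<longlonglongrightarrow> integral\<^sup>L (diag_measure m P f) u"
proof (rule integral_dominated_convergence[where w = "\<lambda>_. K"])
  show "integrable (diag_measure m P f) (\<lambda>_. K)"
    by (rule integrable_diag[OF f bdd_borel_const])
qed (use assms in auto)

lemma diag_minus_commute:
  assumes "f \<in> L2 m" "g \<in> L2 m"
  shows "diag_measure m P (\<lambda>x. f x - g x) = diag_measure m P (\<lambda>x. g x - f x)"
  by (rule measure_eqI)
     (use assms in \<open>auto simp: emeasure_diag L2_intros ip_P_linear ip_linear P_L2 algebra_simps\<close>)

text \<open>\<open>polar \<phi> f g\<close> is \<open>\<integral>\<phi> d\<langle>P f, g\<rangle>\<close>.\<close>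

definition polar :: "(real \<Rightarrow> real) \<Rightarrow> ('a \<Rightarrow> real) \<Rightarrow> ('a \<Rightarrow> real) \<Rightarrow> real" where
  "polar \<phi> f g = ((\<integral>l. \<phi> l \<partial>diag_measure m P (\<lambda>x. f x + g x))
                - (\<integral>l. \<phi> l \<partial>diag_measure m P (\<lambda>x. f x - g x))) / 4"

lemma polar_indicator:
  assumes "B \<in> sets borel" "f \<in> L2 m" "g \<in> L2 m"
  shows "polar (indicator B) f g = ip m (P B f) g"
  using assms
  by (simp add: polar_def measure_diag L2_intros ip_P_linear ip_linear P_L2 ip_P_commute[of B g f])

lemma polar_add_fun:
  assumes "\<phi> \<in> bdd_borel" "\<eta> \<in> bdd_borel" "f \<in> L2 m" "g \<in> L2 m"
  shows "polar (\<lambda>l. \<phi> l + \<eta> l) f g = polar \<phi> f g + polar \<eta> f g"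
  using assms by (simp add: polar_def integrable_diag L2_intros field_simps)

lemma polar_scale_fun: "polar (\<lambda>l. c * \<phi> l) f g = c * polar \<phi> f g"
  by (simp add: polar_def right_diff_distrib)

lemma polar_commute:
  assumes "f \<in> L2 m" "g \<in> L2 m"
  shows "polar \<phi> f g = polar \<phi> g f"
  using diag_minus_commute[OF assms] by (simp add: polar_def add.commute)

lemma polar_tendsto:
  assumes f: "f \<in> L2 m" "g \<in> L2 m"
    and U: "\<And>i. U i \<in> borel_measurable borel" "\<And>i l. \<bar>U i l\<bar> \<le> K"
    and u: "u \<in> borel_measurable borel" and lim: "\<And>l. (\<lambda>i. U i l) \<longlonglongrightarrow> u l"
  shows "(\<lambda>i. polar (U i) f g) \<longlonglongrightarrow> polar u f g"
  unfolding polar_def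
  by (intro tendsto_divide tendsto_diff integral_diag_tendsto[OF _ U u lim] L2_intros f tendsto_const)
     simp

lemma polar_self:
  assumes "\<phi> \<in> bdd_borel" "f \<in> L2 m"
  shows "polar \<phi> f f = (\<integral>l. \<phi> l \<partial>diag_measure m P f)"
  using assms(1)
proof (induction \<phi> rule: bdd_borel_induct)
  case (indicator A)
  then show ?case using assms by (simp add: polar_indicator measure_diag)
next
  case (add u v)
  then show ?case using assms by (simp add: polar_add_fun integrable_diag)
next
  case (scale c u)
  then show ?case by (simp add: polar_scale_fun)
next
  case (lim U u K)
  then have "(\<lambda>i. polar (U i) f f) \<longlonglongrightarrow> polar u f f"
    by (intro polar_tendsto[where K = K] assms) (auto intro: bdd_borel_measurable)
  moreover have "(\<lambda>i. polar (U i) f f) \<longlonglongrightarrow> (\<integral>l. u l \<partial>diag_measure m P f)"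
    using lim unfolding lim(7)
    by (intro integral_diag_tendsto[where K = K] assms) (auto intro: bdd_borel_measurable)
  ultimately show ?case by (rule LIMSEQ_unique)
qed

text \<open>\<open>polar\<close> is a difference of quadratic expressions, and its linearity is
  visible only for indicators, where it is an inner product with a projected vector. The induction
  carries it to bounded functions.\<close>

lemma polar_linear_right:
  assumes "\<phi> \<in> bdd_borel" "f \<in> L2 m" "g \<in> L2 m" "h \<in> L2 m"
  shows "polar \<phi> f (\<lambda>x. g x + c * h x) = polar \<phi> f g + c * polar \<phi> f h"
  using assms(1)
proof (induction \<phi> rule: bdd_borel_induct)
  case (indicator A)
  then show ?case using assms by (simp add: polar_indicator ip_linear L2_intros P_L2)
next
  case (add u v)
  then show ?case using assms by (simp add: polar_add_fun L2_intros algebra_simps)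
next
  case (scale c u)
  then show ?case by (simp add: polar_scale_fun algebra_simps)
next
  case (lim U u K)
  have lims: "(\<lambda>i. polar (U i) f k) \<longlonglongrightarrow> polar u f k" if "k \<in> L2 m" for k
    using lim that by (intro polar_tendsto[where K = K] assms) (auto intro: bdd_borel_measurable)
  have "(\<lambda>i. polar (U i) f (\<lambda>x. g x + c * h x)) \<longlonglongrightarrow> polar u f g + c * polar u f h"
    unfolding lim(7) by (intro tendsto_intros lims assms)
  moreover have "(\<lambda>i. polar (U i) f (\<lambda>x. g x + c * h x)) \<longlonglongrightarrow> polar u f (\<lambda>x. g x + c * h x)"
    by (intro lims L2_intros assms)
  ultimately show ?case using LIMSEQ_unique by blast
qed

text \<open>For nonnegative \<open>\<phi>\<close>, \<open>polar \<phi>\<close> is a semi-inner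
  product. The inequality is obtained before any operator for \<open>\<phi>\<close> has been
  constructed, because that construction relies on it.\<close>

lemma polar_Cauchy_Schwarz:
  assumes "\<phi> \<in> bdd_borel" "\<And>l. 0 \<le> \<phi> l" "f \<in> L2 m" "g \<in> L2 m"
  shows "(polar \<phi> f g)\<^sup>2 \<le> (\<integral>l. \<phi> l \<partial>diag_measure m P f) * (\<integral>l. \<phi> l \<partial>diag_measure m P g)"
proof (rule discriminant_bound)
  fix t
  let ?k = "\<lambda>x. f x + t * g x"
  have k: "?k \<in> L2 m" by (intro L2_intros assms)
  have "0 \<le> polar \<phi> ?k ?k"
    using assms k by (simp add: polar_self integral_nonneg)
  also have "\<dots> = polar \<phi> f ?k + t * polar \<phi> g ?k"
    using assms k by (simp add: polar_linear_right polar_commute[of ?k])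
  also have "\<dots> = (\<integral>l. \<phi> l \<partial>diag_measure m P f) + 2 * t * polar \<phi> f g
      + t\<^sup>2 * (\<integral>l. \<phi> l \<partial>diag_measure m P g)"
    using assms
    by (simp add: polar_linear_right polar_self polar_commute[of g f] algebra_simps power2_eq_square)
  finally show "0 \<le> \<dots>" .
qed (use assms in \<open>simp add: integral_nonneg\<close>)

lemma integral_diag_le_const:
  assumes "\<phi> \<in> bdd_borel" "\<And>l. \<phi> l \<le> K" "f \<in> L2 m"
  shows "(\<integral>l. \<phi> l \<partial>diag_measure m P f) \<le> K * ip m f f"
proof -
  have "(\<integral>l. \<phi> l \<partial>diag_measure m P f) \<le> (\<integral>l. K \<partial>diag_measure m P f)"
    using assms by (intro integral_mono integrable_diag bdd_borel_const)
  also have "\<dots> = K * ip m f f"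
    using assms by (simp add: measure_diag ip_P_UNIV)
  finally show ?thesis .
qed

text \<open>In the limit case the representing vectors are shown to be Cauchy and completeness gives
  the new vector. The estimate \<open>\<parallel>\<eta>(A) f\<parallel>\<^sup>2 \<le> K
  \<integral>\<eta> d\<langle>P f, f\<rangle>\<close> for 0 <= \<eta> <= K, which multiplicativity
  of the calculus would give at once, is obtained here from Cauchy-Schwarz for
  \<open>polar\<close>.\<close>

lemma bounded_calculus_exists:
  assumes "\<phi> \<in> bdd_borel"
  shows "\<forall>f\<in>L2 m. \<exists>h\<in>L2 m. \<forall>g\<in>L2 m. ip m h g = polar \<phi> f g"
  using assms
proof (induction \<phi> rule: bdd_borel_induct)
  case (indicator A)
  then show ?case by (auto intro!: bexI[of _ "P A _"] simp: polar_indicator P_L2)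
next
  case (add u v)
  show ?case
  proof
    fix f assume f: "f \<in> L2 m"
    with add obtain h k where "h \<in> L2 m" "\<And>g. g \<in> L2 m \<Longrightarrow> ip m h g = polar u f g"
      "k \<in> L2 m" "\<And>g. g \<in> L2 m \<Longrightarrow> ip m k g = polar v f g" by metis
    with f add show "\<exists>h\<in>L2 m. \<forall>g\<in>L2 m. ip m h g = polar (\<lambda>l. u l + v l) f g"
      by (intro bexI[of _ "\<lambda>x. h x + k x"]) (auto simp: polar_add_fun ip_linear L2_intros)
  qed
next
  case (scale c u)
  show ?case
  proof
    fix f assume f: "f \<in> L2 m"
    with scale obtain h where "h \<in> L2 m" "\<And>g. g \<in> L2 m \<Longrightarrow> ip m h g = polar u f g" by metis
    with f scale show "\<exists>h\<in>L2 m. \<forall>g\<in>L2 m. ip m h g = polar (\<lambda>l. c * u l) f g"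
      by (intro bexI[of _ "\<lambda>x. c * h x"]) (auto simp: polar_scale_fun ip_linear L2_intros)
  qed
next
  case (lim U u K)
  show ?case
  proof
    fix f assume f: "f \<in> L2 m"
    let ?I = "\<lambda>i. \<integral>l. U i l \<partial>diag_measure m P f"
    have "\<forall>i. \<exists>h\<in>L2 m. \<forall>g\<in>L2 m. ip m h g = polar (U i) f g"
      using lim(7) f by blast
    then obtain h where h: "\<And>i. h i \<in> L2 m"
      "\<And>i g. g \<in> L2 m \<Longrightarrow> ip m (h i) g = polar (U i) f g" by metis
    have "0 \<le> K" using lim(3,4)[of 0 0] by linarith
    have key: "(l2norm m (\<lambda>x. h i x - h j x))\<^sup>2 \<le> K * (?I i - ?I j)" if "j \<le> i" for i j
    proof -
      let ?\<eta> = "\<lambda>l. U i l + (-1) * U j l"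
      let ?d = "\<lambda>x. h i x - h j x"
      have d: "?d \<in> L2 m" by (intro L2_intros h)
      have \<eta>: "?\<eta> \<in> bdd_borel" by (intro bdd_borel_intros lim)
      have \<eta>0: "0 \<le> ?\<eta> l" and \<eta>K: "?\<eta> l \<le> K" for l
        using lim(5) that lim(3)[of j l] lim(4)[of i l] by (auto simp: incseq_def le_fun_def)
      \<comment> \<open>Testing the difference of the two vectors against itself. Cauchy-Schwarz
        then yields |d|^4 <= (\<integral>\<eta>) * K |d|^2 with \<open>\<eta>\<close> the difference
        of the two multipliers, and one factor |d|^2 cancels.\<close>
      have dd: "ip m ?d ?d = polar ?\<eta> f ?d"
        using f d h lim(1)
        by (simp only: ip_diff_left polar_add_fun polar_scale_fun bdd_borel_mult bdd_borel_const)
      have "(ip m ?d ?d)\<^sup>2 \<le> (\<integral>l. ?\<eta> l \<partial>diag_measure m P f) * (\<integral>l. ?\<eta> l \<partial>diag_measure m P ?d)"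
        unfolding dd by (rule polar_Cauchy_Schwarz[OF \<eta> \<eta>0 f d])
      also have "\<dots> \<le> (\<integral>l. ?\<eta> l \<partial>diag_measure m P f) * (K * ip m ?d ?d)"
        using \<eta>0 by (intro mult_left_mono integral_diag_le_const \<eta> \<eta>K d integral_nonneg_AE) auto
      also have "(\<integral>l. ?\<eta> l \<partial>diag_measure m P f) = ?I i - ?I j"
        using f lim(1) by (simp add: integrable_diag)
      finally have "ip m ?d ?d * ip m ?d ?d \<le> (K * (?I i - ?I j)) * ip m ?d ?d"
        by (simp add: power2_eq_square algebra_simps)
      moreover have "0 \<le> K * (?I i - ?I j)"
        using \<open>0 \<le> K\<close> f lim(1) lim(5) that
        by (intro mult_nonneg_nonneg) (auto intro!: integral_mono integrable_diag simp: incseq_def le_fun_def)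
      ultimately have "ip m ?d ?d \<le> K * (?I i - ?I j)"
        using ip_self_nonneg[of m ?d] by (cases "ip m ?d ?d = 0") auto
      then show ?thesis by (simp add: l2norm_power2)
    qed
    have "?I \<longlonglongrightarrow> (\<integral>l. u l \<partial>diag_measure m P f)"
      using lim by (intro integral_diag_tendsto[where K = K] f) (auto intro: bdd_borel_measurable)
    then have Cauchy: "Cauchy ?I" by (rule LIMSEQ_imp_Cauchy)
    have sym: "(l2norm m (\<lambda>x. h i x - h j x))\<^sup>2 \<le> K * \<bar>?I i - ?I j\<bar>" for i j
    proof (cases "j \<le> i")
      case True
      show ?thesis using key[OF True] mult_left_mono[OF abs_ge_self \<open>0 \<le> K\<close>] by (rule order_trans)
    next
      case False
      then have "(l2norm m (\<lambda>x. h i x - h j x))\<^sup>2 \<le> K * (?I j - ?I i)"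
        using key[of i j] by (simp add: l2norm_minus_commute[of m "h i"])
      also have "\<dots> \<le> K * \<bar>?I i - ?I j\<bar>" using \<open>0 \<le> K\<close> by (intro mult_left_mono) auto
      finally show ?thesis .
    qed
    obtain k where k: "k \<in> L2 m" "(\<lambda>n. l2norm m (\<lambda>x. h n x - k x)) \<longlonglongrightarrow> 0"
    proof (rule L2_complete[OF h(1)])
      fix e :: real assume "0 < e"
      \<comment> \<open>\<open>K + 1\<close> serves as the denominator because \<open>K\<close> may
        be 0.\<close>
      then have "0 < e\<^sup>2 / (K + 1)" using \<open>0 \<le> K\<close> by simp
      from CauchyD[OF Cauchy this] obtain N where
        N: "\<And>i j. N \<le> i \<Longrightarrow> N \<le> j \<Longrightarrow> \<bar>?I i - ?I j\<bar> < e\<^sup>2 / (K + 1)" by auto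
      have "l2norm m (\<lambda>x. h i x - h j x) < e" if "N \<le> i" "N \<le> j" for i j
      proof (rule power2_less_imp_less)
        have "(l2norm m (\<lambda>x. h i x - h j x))\<^sup>2 \<le> (K + 1) * \<bar>?I i - ?I j\<bar>"
          using sym[of i j] by (rule order_trans) (intro mult_right_mono, auto)
        also have "\<dots> < (K + 1) * (e\<^sup>2 / (K + 1))"
          using N[OF that] \<open>0 \<le> K\<close> by (intro mult_strict_left_mono) auto
        finally show "(l2norm m (\<lambda>x. h i x - h j x))\<^sup>2 < e\<^sup>2" using \<open>0 \<le> K\<close> by simp
      qed (use \<open>0 < e\<close> in simp)
      then show "\<exists>N. \<forall>i\<ge>N. \<forall>j\<ge>N. l2norm m (\<lambda>x. h i x - h j x) < e" by blast
    qed
    have "ip m k g = polar u f g" if g: "g \<in> L2 m" for g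
    proof (rule LIMSEQ_unique)
      show "(\<lambda>n. ip m (h n) g) \<longlonglongrightarrow> ip m k g"
        by (intro L2_tendsto_ip h k g)
      show "(\<lambda>n. ip m (h n) g) \<longlonglongrightarrow> polar u f g"
        unfolding h(2)[OF g] using lim
        by (intro polar_tendsto[where K = K] f g) (auto intro: bdd_borel_measurable)
    qed
    with k(1) show "\<exists>h\<in>L2 m. \<forall>g\<in>L2 m. ip m h g = polar u f g" by blast
  qed
qed

text \<open>The vector \<phi>(A) f for bounded \<phi>, with A the operator whose spectral measure is
  \<open>P\<close>. Its inner products determine it up to null sets, so the choice is only one of a
  representative.\<close>

definition calc :: "(real \<Rightarrow> real) \<Rightarrow> ('a \<Rightarrow> real) \<Rightarrow> ('a \<Rightarrow> real)" where
  "calc \<phi> f = (SOME h. h \<in> L2 m \<and> (\<forall>g\<in>L2 m. ip m h g = polar \<phi> f g))"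

lemma calc:
  assumes "\<phi> \<in> bdd_borel" "f \<in> L2 m"
  shows calc_L2: "calc \<phi> f \<in> L2 m"
    and ip_calc: "\<And>g. g \<in> L2 m \<Longrightarrow> ip m (calc \<phi> f) g = polar \<phi> f g"
proof -
  have "\<exists>h. h \<in> L2 m \<and> (\<forall>g\<in>L2 m. ip m h g = polar \<phi> f g)"
    using bounded_calculus_exists assms by blast
  from someI_ex[OF this] show "calc \<phi> f \<in> L2 m" "\<And>g. g \<in> L2 m \<Longrightarrow> ip m (calc \<phi> f) g = polar \<phi> f g"
    by (auto simp: calc_def)
qed

text \<open>The first half of multiplicativity. For an indicator \<open>\<phi>\<close> it is the
  product rule for projections; the induction on \<open>\<phi>\<close> does the rest.\<close>

lemma polar_P_right:
  assumes "\<phi> \<in> bdd_borel" "f \<in> L2 m" "g \<in> L2 m" "C \<in> sets borel"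
  shows "polar \<phi> f (P C g) = polar (\<lambda>l. \<phi> l * indicator C l) f g"
  using assms(1)
proof (induction \<phi> rule: bdd_borel_induct)
  case (indicator A)
  have "(\<lambda>l. indicator A l * indicator C l) = (indicator (A \<inter> C) :: real \<Rightarrow> real)"
    by (auto simp: indicator_def)
  with indicator assms show ?case by (simp add: polar_indicator P_L2 ip_P_P)
next
  case (add u v)
  have "(\<lambda>l. (u l + v l) * indicator C l) = (\<lambda>l. u l * indicator C l + v l * indicator C l)"
    by (simp add: algebra_simps)
  with add assms show ?case by (simp add: polar_add_fun P_L2 bdd_borel_mult bdd_borel_indicator)
next
  case (scale c u)
  then show ?case by (simp add: polar_scale_fun mult.assoc)
next
  case (lim U u K)
  have "(\<lambda>i. polar (U i) f (P C g)) \<longlonglongrightarrow> polar u f (P C g)"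
    using lim by (intro polar_tendsto[where K = K] assms P_L2) (auto intro: bdd_borel_measurable)
  moreover have "(\<lambda>i. polar (U i) f (P C g)) \<longlonglongrightarrow> polar (\<lambda>l. u l * indicator C l) f g"
    unfolding lim(7)
  proof (intro polar_tendsto[where K = K] assms tendsto_intros lim)
    show "\<bar>U i l * indicator C l\<bar> \<le> K" for i l
      using lim(3)[of i l] lim(4)[of i l] by (auto simp: indicator_def)
  qed (use lim(1,2)[THEN bdd_borel_measurable] assms in measurable)
  ultimately show ?case by (rule LIMSEQ_unique)
qed

text \<open>Multiplicativity of the calculus in weak form. Symmetry of the inner product rewrites
  the left side as \<open>polar \<eta> g (calc \<phi> f)\<close>, which exposes
  \<open>\<eta>\<close> to a second induction whose indicator case is
  \<open>polar_P_right\<close>.\<close>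

lemma polar_calc_right:
  assumes \<phi>: "\<phi> \<in> bdd_borel" and \<eta>: "\<eta> \<in> bdd_borel" and fg: "f \<in> L2 m" "g \<in> L2 m"
  shows "polar \<phi> f (calc \<eta> g) = polar (\<lambda>l. \<phi> l * \<eta> l) f g"
proof -
  have "polar \<phi> f (calc \<eta> g) = ip m (calc \<phi> f) (calc \<eta> g)"
    using assms by (simp add: ip_calc calc_L2)
  also have "\<dots> = polar \<eta> g (calc \<phi> f)"
    using assms by (simp add: ip_calc calc_L2 ip_commute[of m "calc \<phi> f"])
  also have "\<dots> = polar (\<lambda>l. \<phi> l * \<eta> l) f g"
    using \<eta>
  proof (induction \<eta> rule: bdd_borel_induct)
    case (indicator C)
    then have "polar (indicator C) g (calc \<phi> f) = ip m (calc \<phi> f) (P C g)"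
      using \<phi> fg by (simp add: polar_indicator calc_L2 ip_commute)
    then show ?case using indicator \<phi> fg by (simp add: ip_calc P_L2 polar_P_right)
  next
    case (add u v)
    have "(\<lambda>l. \<phi> l * (u l + v l)) = (\<lambda>l. \<phi> l * u l + \<phi> l * v l)"
      by (simp add: algebra_simps)
    with add \<phi> fg show ?case by (simp add: polar_add_fun bdd_borel_mult calc_L2)
  next
    case (scale c u)
    then show ?case by (simp add: polar_scale_fun mult.left_commute[of _ c])
  next
    case (lim U u K)
    obtain K' where K': "0 \<le> K'" "\<And>l. \<bar>\<phi> l\<bar> \<le> K'" using \<phi> by (metis bdd_borel_bound)
    have "(\<lambda>i. polar (U i) g (calc \<phi> f)) \<longlonglongrightarrow> polar u g (calc \<phi> f)"
      using lim \<phi> by (intro polar_tendsto[where K = K] fg calc_L2) (auto intro: bdd_borel_measurable)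
    moreover have "(\<lambda>i. polar (U i) g (calc \<phi> f)) \<longlonglongrightarrow> polar (\<lambda>l. \<phi> l * u l) f g"
      unfolding lim(7)
    proof (intro polar_tendsto[where K = "K' * K"] fg tendsto_intros lim)
      show "\<bar>\<phi> l * U i l\<bar> \<le> K' * K" for i l
        unfolding abs_mult using lim(3)[of i l] lim(4)[of i l] K' by (intro mult_mono) auto
    qed (use lim(1,2)[THEN bdd_borel_measurable] \<phi>[THEN bdd_borel_measurable] in measurable)
    ultimately show ?case by (rule LIMSEQ_unique)
  qed
  finally show ?thesis .
qed

lemma ip_calc_calc:
  assumes "\<phi> \<in> bdd_borel" "\<eta> \<in> bdd_borel" "f \<in> L2 m" "g \<in> L2 m"
  shows "ip m (calc \<phi> f) (calc \<eta> g) = polar (\<lambda>l. \<phi> l * \<eta> l) f g"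
  using assms by (simp add: ip_calc calc_L2 polar_calc_right)

lemma ip_calc_self:
  assumes "\<phi> \<in> bdd_borel" "f \<in> L2 m"
  shows "ip m (calc \<phi> f) (calc \<phi> f) = (\<integral>l. (\<phi> l)\<^sup>2 \<partial>diag_measure m P f)"
  using assms by (simp add: ip_calc_calc polar_self bdd_borel_intros power2_eq_square)

text \<open>Two applications of multiplicativity bring \<phi>^2 under the integral. With this
  density formula, membership of \<open>calc \<phi> f\<close> in the domain of an unbounded function
  becomes an integral over the spectral measure of \<open>f\<close>.\<close>

lemma diag_calc:
  assumes \<phi>: "\<phi> \<in> bdd_borel" and f: "f \<in> L2 m"
  shows "diag_measure m P (calc \<phi> f) = density (diag_measure m P f) (\<lambda>l. ennreal ((\<phi> l)\<^sup>2))"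
proof (rule measure_eqI)
  note [measurable] = \<phi>[THEN bdd_borel_measurable]
  let ?h = "calc \<phi> f"
  fix B assume "B \<in> sets (diag_measure m P ?h)"
  then have [measurable]: "B \<in> sets borel" by simp
  have ind: "(indicator B :: real \<Rightarrow> real) \<in> bdd_borel" by (rule bdd_borel_indicator) fact
  have h: "?h \<in> L2 m" by (intro calc_L2 assms)
  have "ip m (P B ?h) ?h = polar (indicator B) ?h ?h"
    using h by (simp add: polar_indicator)
  also have "\<dots> = polar (\<lambda>l. indicator B l * \<phi> l) f ?h"
    using polar_calc_right[OF ind \<phi> h f] polar_commute[OF f h] by simp
  also have "\<dots> = polar (\<lambda>l. (indicator B l * \<phi> l) * \<phi> l) f f"
    using ind assms by (intro polar_calc_right bdd_borel_mult)
  also have "\<dots> = (\<integral>l. (\<phi> l)\<^sup>2 * indicator B l \<partial>diag_measure m P f)"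
    using ind assms by (simp add: polar_self bdd_borel_mult power2_eq_square ac_simps)
  finally have eq: "ip m (P B ?h) ?h = (\<integral>l. (\<phi> l)\<^sup>2 * indicator B l \<partial>diag_measure m P f)" .
  have "emeasure (density (diag_measure m P f) (\<lambda>l. ennreal ((\<phi> l)\<^sup>2))) B
      = (\<integral>\<^sup>+l. ennreal ((\<phi> l)\<^sup>2) * indicator B l \<partial>diag_measure m P f)"
    by (rule emeasure_density) measurable
  also have "\<dots> = (\<integral>\<^sup>+l. ennreal ((\<phi> l)\<^sup>2 * indicator B l) \<partial>diag_measure m P f)"
    by (rule nn_integral_cong) (simp split: split_indicator)
  also have "\<dots> = ennreal (\<integral>l. (\<phi> l)\<^sup>2 * indicator B l \<partial>diag_measure m P f)"
    using ind assms
    by (intro nn_integral_eq_integral integrable_diag bdd_borel_intros) auto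
  finally show "emeasure (diag_measure m P ?h) B
      = emeasure (density (diag_measure m P f) (\<lambda>l. ennreal ((\<phi> l)\<^sup>2))) B"
    using h by (simp add: emeasure_diag eq)
qed simp

end


section \<open>Unbounded spectral integrals\<close>

context pvm
begin

text \<open>The parallelogram identity for the semi-inner product of \<open>P B\<close>, with the
  nonnegative term of the difference dropped.\<close>

lemma emeasure_diag_add_le:
  assumes "B \<in> sets borel" "f \<in> L2 m" "g \<in> L2 m"
  shows "emeasure (diag_measure m P (\<lambda>x. f x + g x)) B
    \<le> 2 * emeasure (diag_measure m P f) B + 2 * emeasure (diag_measure m P g) B"
proof -
  have "0 \<le> ip m (P B (\<lambda>x. f x - g x)) (\<lambda>x. f x - g x)"
    using assms by (intro ip_P_nonneg L2_intros)
  then have "ip m (P B (\<lambda>x. f x + g x)) (\<lambda>x. f x + g x) \<le> 2 * ip m (P B f) f + 2 * ip m (P B g) g"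
    using assms by (simp add: ip_P_linear ip_linear L2_intros P_L2)
  then have "ennreal (ip m (P B (\<lambda>x. f x + g x)) (\<lambda>x. f x + g x))
      \<le> ennreal (2 * ip m (P B f) f + 2 * ip m (P B g) g)"
    by (rule ennreal_leI)
  also have "\<dots> = 2 * ennreal (ip m (P B f) f) + 2 * ennreal (ip m (P B g) g)"
    using assms by (simp add: ennreal_plus ennreal_mult ip_P_nonneg)
  finally show ?thesis using assms by (simp add: emeasure_diag L2_intros)
qed

text \<open>Stated for nonnegative extended integrals, so that it can prove that a sum of domain
  elements is again in the domain, where integrability is the claim.\<close>

lemma nn_integral_diag_add_le:
  fixes u :: "real \<Rightarrow> ennreal"
  assumes "u \<in> borel_measurable borel" and fg: "f \<in> L2 m" "g \<in> L2 m"
  shows "(\<integral>\<^sup>+l. u l \<partial>diag_measure m P (\<lambda>x. f x + g x))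
    \<le> 2 * (\<integral>\<^sup>+l. u l \<partial>diag_measure m P f) + 2 * (\<integral>\<^sup>+l. u l \<partial>diag_measure m P g)"
  using assms(1)
proof (induction u rule: borel_measurable_induct)
  case (cong u v)
  then have "u = v" by auto
  with cong show ?case by simp
next
  case (set A)
  then show ?case using emeasure_diag_add_le[OF _ fg, of A] by simp
next
  case (mult u c)
  then show ?case
    using mult_left_mono[OF mult.IH, of c]
    by (simp add: nn_integral_cmult distrib_left ac_simps)
next
  case (add u v)
  then show ?case
    using add_mono[OF add.IH]
    by (simp add: nn_integral_add distrib_left ac_simps)
next
  case (seq U)
  have mono: "(\<integral>\<^sup>+l. U i l \<partial>M) \<le> (\<integral>\<^sup>+l. (SUP i. U i) l \<partial>M)" for i and M :: "real measure"
    by (intro nn_integral_mono) (auto intro: SUP_upper)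
  have "(\<integral>\<^sup>+l. (SUP i. U i) l \<partial>diag_measure m P (\<lambda>x. f x + g x))
      = (SUP i. \<integral>\<^sup>+l. U i l \<partial>diag_measure m P (\<lambda>x. f x + g x))"
  proof -
    have "(SUP i. U i) = (\<lambda>l. SUP i. U i l)" by (simp add: fun_eq_iff image_comp)
    then show ?thesis
      using seq.hyps by (simp only:) (subst nn_integral_monotone_convergence_SUP, auto)
  qed
  also have "\<dots> \<le> 2 * (\<integral>\<^sup>+l. (SUP i. U i) l \<partial>diag_measure m P f)
      + 2 * (\<integral>\<^sup>+l. (SUP i. U i) l \<partial>diag_measure m P g)"
    by (rule SUP_least, rule order_trans[OF seq.IH]) (intro add_mono mult_left_mono mono; simp)
  finally show ?case .
qed

lemma spectral_domain_iff:
  assumes "\<phi> \<in> borel_measurable borel"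
  shows "f \<in> spectral_domain m P \<phi>
    \<longleftrightarrow> f \<in> L2 m \<and> (\<integral>\<^sup>+l. ennreal ((\<phi> l)\<^sup>2) \<partial>diag_measure m P f) < \<infinity>"
  using assms by (auto simp: spectral_domain_def integrable_iff_bounded)

lemma spectral_domain_L2: "f \<in> spectral_domain m P \<phi> \<Longrightarrow> f \<in> L2 m"
  by (simp add: spectral_domain_def)

lemma spectral_domain_bdd:
  assumes "\<phi> \<in> bdd_borel"
  shows "spectral_domain m P \<phi> = L2 m"
  using assms by (auto simp: spectral_domain_def integrable_diag bdd_borel_power2)

lemma spectral_domain_add:
  assumes \<phi>: "\<phi> \<in> borel_measurable borel"
    and "f \<in> spectral_domain m P \<phi>" "g \<in> spectral_domain m P \<phi>"
  shows "(\<lambda>x. f x + g x) \<in> spectral_domain m P \<phi>"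
proof -
  note fg = assms(2,3)[unfolded spectral_domain_iff[OF \<phi>]]
  have "(\<integral>\<^sup>+l. ennreal ((\<phi> l)\<^sup>2) \<partial>diag_measure m P (\<lambda>x. f x + g x))
      \<le> 2 * (\<integral>\<^sup>+l. ennreal ((\<phi> l)\<^sup>2) \<partial>diag_measure m P f)
      + 2 * (\<integral>\<^sup>+l. ennreal ((\<phi> l)\<^sup>2) \<partial>diag_measure m P g)"
    using \<phi> fg by (intro nn_integral_diag_add_le) auto
  also have "\<dots> < \<infinity>" using fg by (auto simp: ennreal_mult_less_top)
  finally show ?thesis using fg by (simp add: spectral_domain_iff[OF \<phi>] L2_add)
qed

lemma spectral_domain_uminus:
  assumes f: "f \<in> spectral_domain m P \<phi>"
  shows "(\<lambda>x. - f x) \<in> spectral_domain m P \<phi>"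
  using diag_minus_commute[OF L2_zero spectral_domain_L2[OF f]] f
  by (simp add: spectral_domain_def L2_uminus)

lemma spectral_domain_diff:
  assumes "\<phi> \<in> borel_measurable borel"
    and "f \<in> spectral_domain m P \<phi>" "g \<in> spectral_domain m P \<phi>"
  shows "(\<lambda>x. f x - g x) \<in> spectral_domain m P \<phi>"
  using spectral_domain_add[OF assms(1,2) spectral_domain_uminus[OF assms(3)]] by simp

lemma integrable_of_spectral_domain:
  assumes \<phi>: "\<phi> \<in> borel_measurable borel" and f: "f \<in> spectral_domain m P \<phi>"
  shows "integrable (diag_measure m P f) \<phi>"
proof (rule Bochner_Integration.integrable_bound)
  have "integrable (diag_measure m P f) (\<lambda>l. (\<phi> l)\<^sup>2)" "integrable (diag_measure m P f) (\<lambda>l. 1 :: real)"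
    using f integrable_diag[OF spectral_domain_L2[OF f] bdd_borel_const]
    by (simp_all only: spectral_domain_def mem_Collect_eq)
  then show "integrable (diag_measure m P f) (\<lambda>l. 1 + (\<phi> l)\<^sup>2)"
    by (intro Bochner_Integration.integrable_add)
  have "\<bar>t\<bar> \<le> 1 + t\<^sup>2" for t :: real
    using zero_le_power2[of "\<bar>t\<bar> - 1"] abs_ge_zero[of t]
    unfolding power2_diff power2_abs by simp
  then show "AE l in diag_measure m P f. norm (\<phi> l) \<le> norm (1 + (\<phi> l)\<^sup>2)"
    by (simp add: abs_of_nonneg)
qed (use \<phi> in simp)

text \<open>Large values are replaced by 0 rather than clamped. Truncating is then multiplication by
  an indicator, which corresponds to a spectral projection, and truncations of different levels
  agree where the smaller one is active.\<close>

definition trunc :: "(real \<Rightarrow> real) \<Rightarrow> nat \<Rightarrow> real \<Rightarrow> real" where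
  "trunc \<phi> n l = \<phi> l * indicator {l. \<bar>\<phi> l\<bar> \<le> real n} l"

lemma trunc_bdd_borel [intro]:
  assumes [measurable]: "\<phi> \<in> borel_measurable borel"
  shows "trunc \<phi> n \<in> bdd_borel"
  unfolding trunc_def
  by (rule bdd_borelI[of _ "real n"]) (auto simp: indicator_def)

lemma trunc_abs_le: "\<bar>trunc \<phi> n l\<bar> \<le> \<bar>\<phi> l\<bar>"
  by (simp add: trunc_def indicator_def)

lemma trunc_tendsto: "(\<lambda>n. trunc \<phi> n l) \<longlonglongrightarrow> \<phi> l"
proof (rule tendsto_eventually)
  obtain N where "\<bar>\<phi> l\<bar> \<le> real N" using real_arch_simple by blast
  then show "\<forall>\<^sub>F n in sequentially. trunc \<phi> n l = \<phi> l"
    by (auto simp: eventually_sequentially trunc_def intro!: exI[of _ N])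
qed

lemma polar_trunc_tendsto:
  assumes \<phi>: "\<phi> \<in> borel_measurable borel"
    and fg: "f \<in> spectral_domain m P \<phi>" "g \<in> spectral_domain m P \<phi>"
  shows "(\<lambda>n. polar (trunc \<phi> n) f g) \<longlonglongrightarrow> polar \<phi> f g"
proof -
  have lim: "(\<lambda>n. \<integral>l. trunc \<phi> n l \<partial>diag_measure m P h) \<longlonglongrightarrow> (\<integral>l. \<phi> l \<partial>diag_measure m P h)"
    if "h \<in> spectral_domain m P \<phi>" for h
  proof (rule integral_dominated_convergence[where w = "\<lambda>l. \<bar>\<phi> l\<bar>"])
    show "integrable (diag_measure m P h) (\<lambda>l. \<bar>\<phi> l\<bar>)"
      by (intro integrable_abs integrable_of_spectral_domain \<phi> that)
  qed (use \<phi> trunc_bdd_borel[OF \<phi>, THEN bdd_borel_measurable] in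
      \<open>auto simp: trunc_tendsto trunc_abs_le\<close>)
  show ?thesis
    unfolding polar_def
    by (intro tendsto_divide tendsto_diff tendsto_const lim spectral_domain_add spectral_domain_diff \<phi> fg) simp_all
qed

lemma spectral_integral_iff:
  "(f, h) \<in> spectral_integral m P \<phi> \<longleftrightarrow>
    f \<in> spectral_domain m P \<phi> \<and> h \<in> L2 m \<and> (\<forall>g\<in>spectral_domain m P \<phi>. ip m h g = polar \<phi> f g)"
  by (simp add: spectral_integral_def polar_def)

lemma spectral_integral_bdd:
  assumes "\<phi> \<in> bdd_borel" "f \<in> L2 m"
  shows "(f, calc \<phi> f) \<in> spectral_integral m P \<phi>"
  using assms by (simp add: spectral_integral_iff spectral_domain_bdd calc_L2 ip_calc)

lemma polar_diff_left:
  assumes "\<phi> \<in> bdd_borel" "f \<in> L2 m" "g \<in> L2 m" "h \<in> L2 m"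
  shows "polar \<phi> (\<lambda>x. f x - g x) h = polar \<phi> f h - polar \<phi> g h"
  using polar_linear_right[OF assms(1,4,2,3), of "-1"] assms
  by (simp add: polar_commute[of _ h] L2_intros)

text \<open>The graph is described by a polarised quadratic expression, so its linearity is not
  formal. It holds for the bounded truncations and passes to the limit, all vectors involved lying
  in the domain.\<close>

lemma spectral_integral_diff:
  assumes \<phi>: "\<phi> \<in> borel_measurable borel"
    and fh: "(f, h) \<in> spectral_integral m P \<phi>" and gk: "(g, k) \<in> spectral_integral m P \<phi>"
  shows "(\<lambda>x. f x - g x, \<lambda>x. h x - k x) \<in> spectral_integral m P \<phi>"
proof -
  note fh = fh[unfolded spectral_integral_iff] and gk = gk[unfolded spectral_integral_iff]
  have "ip m (\<lambda>x. h x - k x) u = polar \<phi> (\<lambda>x. f x - g x) u" if u: "u \<in> spectral_domain m P \<phi>" for u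
  proof (rule LIMSEQ_unique)
    show "(\<lambda>n. polar (trunc \<phi> n) (\<lambda>x. f x - g x) u) \<longlonglongrightarrow> polar \<phi> (\<lambda>x. f x - g x) u"
      using fh gk u by (intro polar_trunc_tendsto spectral_domain_diff \<phi>) auto
    have "(\<lambda>n. polar (trunc \<phi> n) f u - polar (trunc \<phi> n) g u) \<longlonglongrightarrow> polar \<phi> f u - polar \<phi> g u"
      using fh gk u by (intro tendsto_diff polar_trunc_tendsto \<phi>) auto
    also have "polar \<phi> f u - polar \<phi> g u = ip m (\<lambda>x. h x - k x) u"
      using fh gk u spectral_domain_L2[OF u] by (simp add: ip_diff_left)
    also have "(\<lambda>n. polar (trunc \<phi> n) f u - polar (trunc \<phi> n) g u)
        = (\<lambda>n. polar (trunc \<phi> n) (\<lambda>x. f x - g x) u)"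
      using fh gk u trunc_bdd_borel[OF \<phi>] by (auto simp: polar_diff_left spectral_domain_L2)
    finally show "(\<lambda>n. polar (trunc \<phi> n) (\<lambda>x. f x - g x) u) \<longlonglongrightarrow> ip m (\<lambda>x. h x - k x) u" .
  qed
  with fh gk show ?thesis
    by (auto simp: spectral_integral_iff L2_diff intro!: spectral_domain_diff \<phi>)
qed

lemma nn_integral_diag_calc:
  assumes "\<phi> \<in> bdd_borel" "f \<in> L2 m" "u \<in> borel_measurable borel"
  shows "(\<integral>\<^sup>+l. u l \<partial>diag_measure m P (calc \<phi> f))
    = (\<integral>\<^sup>+l. ennreal ((\<phi> l)\<^sup>2) * u l \<partial>diag_measure m P f)"
  unfolding diag_calc[OF assms(1,2)]
  using assms(3) bdd_borel_measurable[OF assms(1)] by (intro nn_integral_density) auto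

lemma calc_in_spectral_domain:
  assumes \<phi>: "\<phi> \<in> borel_measurable borel" and \<eta>: "\<eta> \<in> bdd_borel" and f: "f \<in> L2 m"
    and prod: "(\<lambda>l. \<phi> l * \<eta> l) \<in> bdd_borel"
  shows "calc \<eta> f \<in> spectral_domain m P \<phi>"
proof -
  have "(\<integral>\<^sup>+l. ennreal ((\<phi> l)\<^sup>2) \<partial>diag_measure m P (calc \<eta> f))
      = (\<integral>\<^sup>+l. ennreal ((\<phi> l * \<eta> l)\<^sup>2) \<partial>diag_measure m P f)"
    using \<phi> by (subst nn_integral_diag_calc[OF \<eta> f])
      (auto simp: ennreal_mult[symmetric] power_mult_distrib mult.commute)
  also have "\<dots> = ennreal (\<integral>l. (\<phi> l * \<eta> l)\<^sup>2 \<partial>diag_measure m P f)"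
    by (intro nn_integral_eq_integral integrable_diag f bdd_borel_power2 prod) simp
  finally show ?thesis using calc_L2[OF \<eta> f] by (simp add: spectral_domain_iff[OF \<phi>])
qed

text \<open>Smoothing by \<open>\<eta>\<close> brings every vector into the domain as soon as
  \<open>\<phi> * \<eta>\<close> is bounded. This is how the minimiser of the variational problem is
  seen to lie in the form domain.\<close>

lemma spectral_integral_calc:
  assumes \<phi>: "\<phi> \<in> borel_measurable borel" and \<eta>: "\<eta> \<in> bdd_borel" and f: "f \<in> L2 m"
    and prod: "(\<lambda>l. \<phi> l * \<eta> l) \<in> bdd_borel"
  shows "(calc \<eta> f, calc (\<lambda>l. \<phi> l * \<eta> l) f) \<in> spectral_integral m P \<phi>"
proof -
  have "ip m (calc (\<lambda>l. \<phi> l * \<eta> l) f) g = polar \<phi> (calc \<eta> f) g" if g: "g \<in> spectral_domain m P \<phi>" for g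
  proof (rule LIMSEQ_unique)
    have gL: "g \<in> L2 m" using g by (rule spectral_domain_L2)
    show "(\<lambda>n. polar (trunc \<phi> n) (calc \<eta> f) g) \<longlonglongrightarrow> polar \<phi> (calc \<eta> f) g"
      by (intro polar_trunc_tendsto calc_in_spectral_domain g assms)
    obtain K where K: "\<And>l. \<bar>\<phi> l * \<eta> l\<bar> \<le> K" using prod by (metis bdd_borel_bound)
    have "(\<lambda>n. polar (\<lambda>l. trunc \<phi> n l * \<eta> l) g f) \<longlonglongrightarrow> polar (\<lambda>l. \<phi> l * \<eta> l) g f"
    proof (intro polar_tendsto[where K = K] gL f tendsto_intros trunc_tendsto)
      show "\<bar>trunc \<phi> n l * \<eta> l\<bar> \<le> K" for n l
        using mult_right_mono[OF trunc_abs_le[of \<phi> n l] abs_ge_zero[of "\<eta> l"]] K[of l]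
        by (simp add: abs_mult)
    qed (use bdd_borel_measurable[OF prod] bdd_borel_measurable[OF bdd_borel_mult[OF trunc_bdd_borel[OF \<phi>] \<eta>]] in auto)
    also have "polar (\<lambda>l. \<phi> l * \<eta> l) g f = ip m (calc (\<lambda>l. \<phi> l * \<eta> l) f) g"
      using prod f gL by (simp add: ip_calc polar_commute[of g f])
    also have "(\<lambda>n. polar (\<lambda>l. trunc \<phi> n l * \<eta> l) g f) = (\<lambda>n. polar (trunc \<phi> n) (calc \<eta> f) g)"
      using polar_calc_right[OF trunc_bdd_borel[OF \<phi>] \<eta> gL f] calc_L2[OF \<eta> f] gL
      by (simp add: polar_commute[of "calc \<eta> f"])
    finally show "(\<lambda>n. polar (trunc \<phi> n) (calc \<eta> f) g) \<longlonglongrightarrow> ip m (calc (\<lambda>l. \<phi> l * \<eta> l) f) g" .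
  qed
  then show ?thesis
    using calc_L2[OF prod f] calc_in_spectral_domain[OF assms] by (simp add: spectral_integral_iff)
qed

text \<open>Cutting \<open>h\<close> down to \<open>{\<bar>\<phi>\<bar> \<le> n}\<close> gives the vector obtained from \<open>f\<close> by the truncation of
  \<open>\<phi>\<close>, whose norm is known.\<close>

lemma spectral_integral_norm:
  assumes \<phi>: "\<phi> \<in> borel_measurable borel" and fh: "(f, h) \<in> spectral_integral m P \<phi>"
  shows "ip m h h = (\<integral>l. (\<phi> l)\<^sup>2 \<partial>diag_measure m P f)"
proof (rule LIMSEQ_unique)
  note [measurable] = \<phi>
  have fd: "f \<in> spectral_domain m P \<phi>" and h: "h \<in> L2 m"
    and hg: "\<And>g. g \<in> spectral_domain m P \<phi> \<Longrightarrow> ip m h g = polar \<phi> f g"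
    using fh by (auto simp: spectral_integral_iff)
  have f: "f \<in> L2 m" using fd by (rule spectral_domain_L2)
  define cut :: "nat \<Rightarrow> real \<Rightarrow> real" where "cut n = indicator {l. \<bar>\<phi> l\<bar> \<le> real n}" for n
  have cut: "cut n \<in> bdd_borel" for n
    unfolding cut_def by (rule bdd_borel_indicator) measurable
  have trunc: "trunc \<phi> n = (\<lambda>l. \<phi> l * cut n l)" for n
    by (simp add: trunc_def cut_def fun_eq_iff)
  have cut_self: "(cut n l)\<^sup>2 = cut n l" for n l by (simp add: cut_def indicator_def)
  have eq: "ip m h (calc (cut n) g) = ip m (calc (trunc \<phi> n) f) g" if g: "g \<in> L2 m" for g n
  proof -
    have dom: "calc (cut n) g \<in> spectral_domain m P \<phi>"
      using trunc_bdd_borel[OF \<phi>, of n] unfolding trunc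
      by (intro calc_in_spectral_domain \<phi> cut g)
    \<comment> \<open>After the cut at level \<open>n\<close> all higher truncations coincide, so
      the limit over \<open>k\<close> is that of an eventually constant sequence.\<close>
    have "polar (trunc \<phi> k) f (calc (cut n) g) = polar (trunc \<phi> n) f g" if "n \<le> k" for k
    proof -
      have "(\<lambda>l. trunc \<phi> k l * cut n l) = trunc \<phi> n"
        using that by (auto simp: trunc_def cut_def indicator_def fun_eq_iff)
      then show ?thesis
        using polar_calc_right[OF trunc_bdd_borel[OF \<phi>] cut f g, of k n] by simp
    qed
    then have "(\<lambda>k. polar (trunc \<phi> k) f (calc (cut n) g)) \<longlonglongrightarrow> polar (trunc \<phi> n) f g"
      by (intro tendsto_eventually) (auto simp: eventually_sequentially)
    moreover have "(\<lambda>k. polar (trunc \<phi> k) f (calc (cut n) g)) \<longlonglongrightarrow> polar \<phi> f (calc (cut n) g)"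
      by (intro polar_trunc_tendsto \<phi> fd dom)
    ultimately have "polar \<phi> f (calc (cut n) g) = polar (trunc \<phi> n) f g"
      using LIMSEQ_unique by blast
    then show ?thesis
      using hg[OF dom] trunc_bdd_borel[OF \<phi>] f g by (simp add: ip_calc)
  qed
  have "(\<integral>l. cut n l \<partial>diag_measure m P h) = (\<integral>l. (trunc \<phi> n l)\<^sup>2 \<partial>diag_measure m P f)" for n
  proof -
    let ?h = "calc (cut n) h" and ?t = "calc (trunc \<phi> n) f"
    have t: "?t \<in> L2 m" and hL: "?h \<in> L2 m" by (auto intro!: calc_L2 cut f h \<phi>)
    \<comment> \<open>The cut is symmetric, so \<open>eq\<close> says that \<open>?h\<close> and
      \<open>?t\<close> have the same inner product with every vector. Testing with
      \<open>?h\<close> and then with \<open>?t\<close> identifies their norms.\<close>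
    have sym: "ip m ?h g = ip m h (calc (cut n) g)" if "g \<in> L2 m" for g
      using that h cut by (simp add: ip_calc calc_L2 ip_commute[of m h] polar_commute[of h g])
    have "(\<integral>l. cut n l \<partial>diag_measure m P h) = ip m ?h ?h"
      using ip_calc_self[OF cut h] by (simp add: cut_self)
    also have "\<dots> = ip m ?h ?t"
      using sym[OF hL] eq[OF hL] by (simp add: ip_commute)
    also have "\<dots> = ip m ?t ?t"
      using sym[OF t] eq[OF t] by simp
    finally show ?thesis using ip_calc_self[OF trunc_bdd_borel[OF \<phi>] f] by simp
  qed
  moreover have "(\<lambda>n. \<integral>l. (trunc \<phi> n l)\<^sup>2 \<partial>diag_measure m P f) \<longlonglongrightarrow> (\<integral>l. (\<phi> l)\<^sup>2 \<partial>diag_measure m P f)"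
  proof (rule integral_dominated_convergence[where w = "\<lambda>l. (\<phi> l)\<^sup>2"])
    show "integrable (diag_measure m P f) (\<lambda>l. (\<phi> l)\<^sup>2)"
      using fd by (simp add: spectral_domain_def)
    show "AE l in diag_measure m P f. norm ((trunc \<phi> n l)\<^sup>2) \<le> (\<phi> l)\<^sup>2" for n
      using trunc_abs_le[of \<phi> n] by (simp add: abs_le_square_iff)
  qed (use bdd_borel_measurable[OF trunc_bdd_borel[OF \<phi>]] in \<open>auto intro!: tendsto_intros trunc_tendsto\<close>)
  ultimately show "(\<lambda>n. \<integral>l. cut n l \<partial>diag_measure m P h) \<longlonglongrightarrow> (\<integral>l. (\<phi> l)\<^sup>2 \<partial>diag_measure m P f)"
    by simp
  have "(\<lambda>n. cut n l) \<longlonglongrightarrow> 1" for l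
  proof (rule tendsto_eventually)
    obtain N where "\<bar>\<phi> l\<bar> \<le> real N" using real_arch_simple by blast
    then show "\<forall>\<^sub>F n in sequentially. cut n l = 1"
      by (auto simp: eventually_sequentially cut_def intro!: exI[of _ N])
  qed
  then have "(\<lambda>n. \<integral>l. cut n l \<partial>diag_measure m P h) \<longlonglongrightarrow> (\<integral>l. 1 \<partial>diag_measure m P h)"
    using bdd_borel_measurable[OF cut]
    by (intro integral_diag_tendsto[where K = 1] h) (auto simp: cut_def indicator_def)
  then show "(\<lambda>n. \<integral>l. cut n l \<partial>diag_measure m P h) \<longlonglongrightarrow> ip m h h"
    using h by (simp add: measure_diag ip_P_UNIV)
qed

lemma op_app_in: "f \<in> Domain S \<Longrightarrow> (f, op_app S f) \<in> S"
  by (auto simp: op_app_def intro: someI[where P = "\<lambda>h. (f, h) \<in> S"])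

lemma op_form_spectral_integral:
  assumes "\<phi> \<in> borel_measurable borel" "f \<in> Domain (spectral_integral m P \<phi>)"
  shows "op_form m (spectral_integral m P \<phi>) f f = (\<integral>l. (\<phi> l)\<^sup>2 \<partial>diag_measure m P f)"
  unfolding op_form_def by (rule spectral_integral_norm[OF assms(1) op_app_in[OF assms(2)]])

lemma spectral_integral_Domain_subset: "Domain (spectral_integral m P \<phi>) \<subseteq> spectral_domain m P \<phi>"
  by (auto simp: spectral_integral_iff)

section \<open>Cauchy-Schwarz inequalities with spectral weights\<close>

lemma abs_ip_calc_le:
  assumes "\<phi> \<in> bdd_borel" "\<eta> \<in> bdd_borel" "f \<in> L2 m" "g \<in> L2 m"
  shows "\<bar>ip m f (calc (\<lambda>l. \<phi> l * \<eta> l) g)\<bar>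
    \<le> sqrt (\<integral>l. (\<phi> l)\<^sup>2 \<partial>diag_measure m P f) * sqrt (\<integral>l. (\<eta> l)\<^sup>2 \<partial>diag_measure m P g)"
proof -
  have "ip m f (calc (\<lambda>l. \<phi> l * \<eta> l) g) = ip m (calc (\<lambda>l. \<phi> l * \<eta> l) g) f"
    by (rule ip_commute)
  also have "\<dots> = polar (\<lambda>l. \<phi> l * \<eta> l) f g"
    using assms by (simp add: ip_calc bdd_borel_mult polar_commute[of g f])
  also have "\<dots> = ip m (calc \<phi> f) (calc \<eta> g)"
    using assms by (simp add: ip_calc_calc)
  finally show ?thesis
    using ip_Cauchy_Schwarz[of "calc \<phi> f" m "calc \<eta> g"] assms
    by (simp add: calc_L2 l2norm_def ip_calc_self)
qed

text \<open>The junk value \<open>x / 0 = 0\<close> is harmless because \<open>\<omega>\<close> vanishes where \<open>w\<close> does.\<close>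

lemma weighted_Cauchy_Schwarz:
  assumes w: "w \<in> borel_measurable borel" "\<And>l. 0 \<le> w l" and \<omega>: "\<omega> \<in> bdd_borel"
    and fg: "f \<in> L2 m" "g \<in> L2 m"
    and null: "AE l in diag_measure m P g. w l = 0 \<longrightarrow> \<omega> l = 0"
    and int_w: "integrable (diag_measure m P f) w"
    and int_\<omega>: "integrable (diag_measure m P g) (\<lambda>l. (\<omega> l)\<^sup>2 / w l)"
  shows "\<bar>ip m f (calc \<omega> g)\<bar>
    \<le> sqrt (\<integral>l. w l \<partial>diag_measure m P f) * sqrt (\<integral>l. (\<omega> l)\<^sup>2 / w l \<partial>diag_measure m P g)"
proof (rule LIMSEQ_le_const2)
  note [measurable] = w(1) \<omega>[THEN bdd_borel_measurable]
  \<comment> \<open>On \<open>S n\<close> both \<open>w\<close> and its reciprocal are bounded, so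
    sqrt w and \<omega> / sqrt w, restricted to \<open>S n\<close>, are bounded multipliers whose
    product is \<omega> on \<open>S n\<close>.\<close>
  define S where "S n = {l. 1 / real (Suc n) \<le> w l \<and> w l \<le> real (Suc n)}" for n
  have [measurable]: "S n \<in> sets borel" for n unfolding S_def by measurable
  define \<phi> where "\<phi> n l = sqrt (w l) * indicator (S n) l" for n l
  define \<eta> where "\<eta> n l = \<omega> l / sqrt (w l) * indicator (S n) l" for n l
  obtain K where K: "0 \<le> K" "\<And>l. \<bar>\<omega> l\<bar> \<le> K" using \<omega> by (metis bdd_borel_bound)
  have \<phi>: "\<phi> n \<in> bdd_borel" for n
    unfolding \<phi>_def
    by (rule bdd_borelI[of _ "sqrt (real (Suc n))"]) (auto simp: indicator_def S_def w(2))
  have \<eta>: "\<eta> n \<in> bdd_borel" for n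
  proof (rule bdd_borelI)
    show "\<eta> n \<in> borel_measurable borel" unfolding \<eta>_def by measurable
    show "\<bar>\<eta> n l\<bar> \<le> K * sqrt (real (Suc n))" for l
    proof (cases "l \<in> S n")
      case True
      then have *: "1 / real (Suc n) \<le> w l" by (simp add: S_def)
      then have "0 < w l" by (rule order.strict_trans2[rotated]) simp
      then have "1 / w l \<le> real (Suc n)" using * by (simp add: field_simps)
      then have "sqrt (1 / w l) \<le> sqrt (real (Suc n))" by (rule real_sqrt_le_mono)
      then have "\<bar>\<omega> l\<bar> * sqrt (1 / w l) \<le> K * sqrt (real (Suc n))"
        using K w(2)[of l] by (intro mult_mono) auto
      then show ?thesis using True w(2)[of l] by (simp add: \<eta>_def real_sqrt_divide abs_mult)
    qed (use K in \<open>simp add: \<eta>_def\<close>)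
  qed
  have prod: "(\<lambda>l. \<phi> n l * \<eta> n l) = (\<lambda>l. \<omega> l * indicator (S n) l)" for n
  proof
    fix l
    have "0 < w l" if "l \<in> S n"
      using that by (auto simp: S_def intro: order.strict_trans2[rotated])
    then show "\<phi> n l * \<eta> n l = \<omega> l * indicator (S n) l"
      by (auto simp: \<phi>_def \<eta>_def indicator_def)
  qed
  show "\<exists>N. \<forall>n\<ge>N. \<bar>ip m f (calc (\<lambda>l. \<phi> n l * \<eta> n l) g)\<bar>
      \<le> sqrt (\<integral>l. w l \<partial>diag_measure m P f) * sqrt (\<integral>l. (\<omega> l)\<^sup>2 / w l \<partial>diag_measure m P g)"
  proof (intro exI allI impI)
    fix n :: nat
    have "(\<integral>l. (\<phi> n l)\<^sup>2 \<partial>diag_measure m P f) \<le> (\<integral>l. w l \<partial>diag_measure m P f)"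
      by (rule integral_mono[OF integrable_diag[OF fg(1) bdd_borel_power2[OF \<phi>]] int_w])
         (simp add: \<phi>_def indicator_def w(2))
    moreover have "(\<integral>l. (\<eta> n l)\<^sup>2 \<partial>diag_measure m P g) \<le> (\<integral>l. (\<omega> l)\<^sup>2 / w l \<partial>diag_measure m P g)"
      by (rule integral_mono[OF integrable_diag[OF fg(2) bdd_borel_power2[OF \<eta>]] int_\<omega>])
         (simp add: \<eta>_def indicator_def power_divide w(2))
    ultimately show "\<bar>ip m f (calc (\<lambda>l. \<phi> n l * \<eta> n l) g)\<bar>
        \<le> sqrt (\<integral>l. w l \<partial>diag_measure m P f) * sqrt (\<integral>l. (\<omega> l)\<^sup>2 / w l \<partial>diag_measure m P g)"
      by (intro order_trans[OF abs_ip_calc_le[OF \<phi> \<eta> fg]] mult_mono real_sqrt_le_mono)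
         (auto intro!: integral_nonneg_AE w(2))
  qed
  \<comment> \<open>The sets \<open>S n\<close> exhaust only the region where \<open>w\<close> is
    nonzero. The remaining part \<open>\<rho>\<close> of \<open>\<omega>\<close> vanishes almost
    everywhere for the spectral measure of \<open>g\<close>, hence annihilates
    \<open>g\<close>.\<close>
  define \<omega>' where "\<omega>' l = \<omega> l * indicator {l. w l \<noteq> 0} l" for l
  define \<rho> where "\<rho> l = \<omega> l * indicator {l. w l = 0} l" for l
  have \<omega>': "\<omega>' \<in> bdd_borel" and \<rho>: "\<rho> \<in> bdd_borel"
    unfolding \<omega>'_def \<rho>_def by (auto intro!: bdd_borel_mult \<omega> bdd_borel_indicator)
  have lim: "(\<lambda>n. polar (\<lambda>l. \<omega> l * indicator (S n) l) f g) \<longlonglongrightarrow> polar \<omega>' f g"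
  proof (rule polar_tendsto[where K = K])
    show "\<bar>\<omega> l * indicator (S n) l\<bar> \<le> K" for n l using K by (simp add: indicator_def)
    fix l
    show "(\<lambda>n. \<omega> l * indicator (S n) l) \<longlonglongrightarrow> \<omega>' l"
    proof (cases "w l = 0")
      case False
      with w(2)[of l] have pos: "0 < w l" by (simp add: order_less_le)
      obtain N where N: "w l \<le> real N" "1 / w l \<le> real N"
        using real_arch_simple[of "max (w l) (1 / w l)"] by auto
      have "l \<in> S n" if "N \<le> n" for n
      proof -
        have "w l \<le> real (Suc n)" "1 / w l \<le> real (Suc n)" using N that by linarith+
        with pos show ?thesis by (simp add: S_def field_simps)
      qed
      then have "\<forall>\<^sub>F n in sequentially. \<omega> l * indicator (S n) l = \<omega>' l"
        using False by (auto simp: eventually_sequentially \<omega>'_def intro!: exI[of _ N])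
      then show ?thesis by (rule tendsto_eventually)
    qed (simp add: \<omega>'_def S_def indicator_def)
  qed (use fg \<omega>'[THEN bdd_borel_measurable] in measurable)
  have "polar \<rho> f g = 0"
  proof -
    have "(\<integral>l. (\<rho> l)\<^sup>2 \<partial>diag_measure m P g) = (\<integral>l. 0 \<partial>diag_measure m P g)"
    proof (rule integral_cong_AE)
      show "AE l in diag_measure m P g. (\<rho> l)\<^sup>2 = 0"
        using null by eventually_elim (auto simp: \<rho>_def indicator_def)
    qed (use \<rho>[THEN bdd_borel_measurable] in auto)
    then have "l2norm m (calc \<rho> g) = 0"
      using \<rho> fg by (simp add: l2norm_def ip_calc_self)
    then have "ip m (calc \<rho> g) f = 0"
      using ip_Cauchy_Schwarz[OF calc_L2[OF \<rho> fg(2)] fg(1)] by simp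
    then show ?thesis using \<rho> fg by (simp add: ip_calc polar_commute[of f g])
  qed
  moreover have "(\<lambda>l. \<omega>' l + \<rho> l) = \<omega>"
    by (auto simp: \<omega>'_def \<rho>_def indicator_def)
  ultimately have "polar \<omega>' f g = polar \<omega> f g"
    using polar_add_fun[OF \<omega>' \<rho> fg] by simp
  also have "polar \<omega> f g = ip m f (calc \<omega> g)"
    using \<omega> fg by (simp add: ip_calc polar_commute[of f g] ip_commute[of m f])
  finally have "(\<lambda>n. polar (\<lambda>l. \<omega> l * indicator (S n) l) f g) \<longlonglongrightarrow> ip m f (calc \<omega> g)"
    using lim by simp
  also have "(\<lambda>n. polar (\<lambda>l. \<omega> l * indicator (S n) l) f g) = (\<lambda>n. ip m f (calc (\<lambda>l. \<phi> n l * \<eta> n l) g))"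
    using fg bdd_borel_mult[OF \<omega> bdd_borel_indicator]
    by (simp add: prod ip_calc polar_commute[of f g] ip_commute[of m f])
  finally show "(\<lambda>n. \<bar>ip m f (calc (\<lambda>l. \<phi> n l * \<eta> n l) g)\<bar>) \<longlonglongrightarrow> \<bar>ip m f (calc \<omega> g)\<bar>"
    by (rule tendsto_rabs)
qed

end


section \<open>Dyadic weights and the wave multiplier\<close>

lemma power2_sqrt: "(sqrt l)\<^sup>2 = \<bar>l\<bar>"
  by (simp add: power2_eq_square)

lemma abs_sqrt: "\<bar>sqrt l\<bar> = sqrt \<bar>l\<bar>"
  by (cases "0 \<le> l") (auto simp: real_sqrt_minus)

lemma power2_powr_half: "(l powr (b / 2))\<^sup>2 = \<bar>l\<bar> powr b" for l :: real
proof (cases "l = 0")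
  case False
  have "ln \<bar>l\<bar> = ln l" by (simp add: abs_if ln_minus)
  with False show ?thesis by (simp add: powr_def exp_double[symmetric])
qed simp

text \<open>The Yosida approximation s (1 - s / (|l| + s)) of |l|, in other words the parallel sum
  of |l| and s; it is comparable to their minimum.\<close>

definition psi :: "real \<Rightarrow> real \<Rightarrow> real" where
  "psi s l = \<bar>l\<bar> * s / (\<bar>l\<bar> + s)"

lemma psi_nonneg: "0 < s \<Longrightarrow> 0 \<le> psi s l"
  by (simp add: psi_def)

lemma psi_le: "0 < s \<Longrightarrow> psi s l \<le> s" and psi_le_abs: "0 < s \<Longrightarrow> psi s l \<le> \<bar>l\<bar>"
  by (simp_all add: psi_def divide_le_eq algebra_simps)

lemma psi_measurable [measurable]: "psi s \<in> borel_measurable borel"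
  unfolding psi_def by measurable

lemma psi_bdd_borel: "0 < s \<Longrightarrow> psi s \<in> bdd_borel"
  by (rule bdd_borelI[of _ s]) (auto simp: psi_nonneg psi_le)

text \<open>For nonzero l this is 1 / \<psi> = 1 / |l| + 1 / s multiplied by \<psi>^2; at l = 0
  everything vanishes, including the quotient. It splits the integral of \<open>psi s\<close> into
  the two parts that match the two terms of the variational problem.\<close>

lemma psi_square_identity:
  assumes "0 < s"
  shows "(psi s l)\<^sup>2 / \<bar>l\<bar> = psi s l - (psi s l)\<^sup>2 / s"
proof (cases "l = 0")
  case False
  then have pos: "0 < \<bar>l\<bar>" by simp
  then have "psi s l * (\<bar>l\<bar> + s) = \<bar>l\<bar> * s" using assms by (simp add: psi_def)
  then have "psi s l * (psi s l * (\<bar>l\<bar> + s)) / (\<bar>l\<bar> * s) = psi s l" using pos assms by simp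
  moreover have "psi s l * (psi s l * (\<bar>l\<bar> + s)) / (\<bar>l\<bar> * s) = (psi s l)\<^sup>2 / \<bar>l\<bar> + (psi s l)\<^sup>2 / s"
    using pos assms by (simp add: power2_eq_square distrib_left add_divide_distrib)
  ultimately show ?thesis by simp
qed (simp add: psi_def)

text \<open>\<open>psi s l\<close> is below the minimum of |l| and s, and a minimum is at most any
  weighted geometric mean.\<close>

lemma psi_le_powr:
  assumes "0 < s" "0 < b" "b < 1"
  shows "psi s l \<le> \<bar>l\<bar> powr b * s powr (1 - b)"
proof (cases "l = 0")
  case False
  show ?thesis
  proof (cases "\<bar>l\<bar> \<le> s")
    case True
    have "psi s l \<le> \<bar>l\<bar> powr b * \<bar>l\<bar> powr (1 - b)"
      using psi_le_abs[OF assms(1), of l] False by (simp add: powr_add[symmetric])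
    also have "\<dots> \<le> \<bar>l\<bar> powr b * s powr (1 - b)"
      using True assms by (intro mult_left_mono powr_mono2) auto
    finally show ?thesis .
  next
    case False
    have "psi s l \<le> s powr b * s powr (1 - b)"
      using psi_le[OF assms(1), of l] assms(1) by (simp add: powr_add[symmetric])
    also have "\<dots> \<le> \<bar>l\<bar> powr b * s powr (1 - b)"
      using False assms by (intro mult_right_mono powr_mono2) auto
    finally show ?thesis .
  qed
qed (simp add: psi_def)

definition wave_mult :: "real \<Rightarrow> real \<Rightarrow> real" where
  "wave_mult t l = (if l = 0 then t else sin (t * sqrt l) / sqrt l)"

lemma wave_mult_bdd_borel: "wave_mult t \<in> bdd_borel"
proof (rule bdd_borelI[of _ "\<bar>t\<bar>"])
  show "wave_mult t \<in> borel_measurable borel"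
    unfolding wave_mult_def by measurable
  show "\<bar>wave_mult t l\<bar> \<le> \<bar>t\<bar>" for l
    using abs_sin_x_le_abs_x[of "t * sqrt l"]
    by (auto simp: wave_mult_def abs_mult divide_le_eq)
qed

lemma wave_mult_square: "l \<noteq> 0 \<Longrightarrow> (wave_mult t l)\<^sup>2 = (sin (t * sqrt \<bar>l\<bar>))\<^sup>2 / \<bar>l\<bar>"
  by (auto simp: wave_mult_def power_divide power2_sqrt abs_if real_sqrt_minus)

text \<open>Taylor's bound gives sin t >= t - t^2 / 2, which is at least t / 2 on the unit
  interval.\<close>

lemma sin_square_ge:
  assumes "0 \<le> t" "t \<le> (1 :: real)"
  shows "t\<^sup>2 / 4 \<le> (sin t)\<^sup>2"
proof -
  have "\<bar>sin t - (\<Sum>k<2. sin_coeff k * t ^ k)\<bar> \<le> inverse (fact 2) * \<bar>t\<bar> ^ 2"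
    by (rule Maclaurin_sin_bound)
  then have "\<bar>sin t - t\<bar> \<le> t\<^sup>2 / 2"
    by (simp add: numeral_2_eq_2 sin_coeff_def)
  then have "t - sin t \<le> t\<^sup>2 / 2" by linarith
  moreover have "t\<^sup>2 \<le> t"
    using assms by (simp add: power2_eq_square mult_left_le)
  ultimately have "t / 2 \<le> sin t" by simp
  then have "(t / 2)\<^sup>2 \<le> (sin t)\<^sup>2"
    using assms by (intro power_mono) auto
  then show ?thesis by (simp add: power_divide)
qed

text \<open>A weight comparable to \<open>\<bar>l\<bar>\<^bsup>\<gamma>\<^esup>\<close> near \<open>0\<close>, where \<open>p = 2\<^bsup>1-\<beta>\<^esup>\<close> and \<open>\<gamma> = (1 + \<beta>) / 2\<close>. It lies
  between the exponent \<open>\<beta>\<close> of the form and the exponent \<open>1\<close> controlled by the wave equation, and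
  it is a superposition of the functions \<^const>\<open>psi\<close>, to which the contraction
  property of the form passes.\<close>

definition dyadic_weight :: "real \<Rightarrow> real \<Rightarrow> real" where
  "dyadic_weight p l = (\<Sum>k. p ^ k * psi ((1 / 4) ^ k) l)"

context
  fixes b p :: real
  assumes b: "0 < b" "b < 1" and p: "p = 2 powr (1 - b)"
begin

lemma p_gt_1: "1 < p"
  using b p by simp

lemma dyadic_term_nonneg: "0 \<le> p ^ k * psi ((1 / 4) ^ k) l"
  using p_gt_1 by (simp add: psi_nonneg)

text \<open>The geometric mean bound contributes 4^(-k(1-b)) = p^(-2k). Half of this decay absorbs
  the coefficient p^k; the other half remains and is summable since b < 1.\<close>

lemma dyadic_term_le: "p ^ k * psi ((1 / 4) ^ k) l \<le> \<bar>l\<bar> powr b * (1 / p) ^ k"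
proof -
  have "((1 / 4) ^ k) powr (1 - b) = ((1 / 4 :: real) powr (1 - b)) ^ k"
    by (simp add: powr_power powr_realpow[symmetric] powr_powr mult.commute)
  also have "(1 / 4 :: real) powr (1 - b) = (1 / p) * (1 / p)"
    unfolding p by (simp add: powr_divide powr_mult[symmetric])
  finally have "p ^ k * psi ((1 / 4) ^ k) l \<le> p ^ k * (\<bar>l\<bar> powr b * ((1 / p) * (1 / p)) ^ k)"
    using psi_le_powr[of "(1 / 4) ^ k" b l] b p_gt_1 by (intro mult_left_mono) auto
  also have "\<dots> = \<bar>l\<bar> powr b * (1 / p) ^ k"
    using p_gt_1 by (simp add: power_mult_distrib power_divide)
  finally show ?thesis .
qed

lemma summable_inverse_p: "summable (\<lambda>k. (1 / p) ^ k)"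
  using p_gt_1 by (intro summable_geometric) simp

lemma summable_dyadic: "summable (\<lambda>k. p ^ k * psi ((1 / 4) ^ k) l)"
proof (rule summable_comparison_test[OF _ summable_mult[OF summable_inverse_p]])
  show "\<exists>N. \<forall>n\<ge>N. norm (p ^ n * psi ((1 / 4) ^ n) l) \<le> \<bar>l\<bar> powr b * (1 / p) ^ n"
    using dyadic_term_nonneg[of _ l] dyadic_term_le[of _ l] by auto
qed

lemma dyadic_weight_measurable: "dyadic_weight p \<in> borel_measurable borel"
  unfolding dyadic_weight_def by measurable

lemma dyadic_weight_ge: "p ^ k * psi ((1 / 4) ^ k) l \<le> dyadic_weight p l"
  unfolding dyadic_weight_def
  using sum_le_suminf[OF summable_dyadic, of "{k}"] dyadic_term_nonneg by simp

lemma dyadic_weight_nonneg: "0 \<le> dyadic_weight p l"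
  unfolding dyadic_weight_def by (intro suminf_nonneg summable_dyadic dyadic_term_nonneg)

lemma dyadic_weight_le: "dyadic_weight p l \<le> (\<Sum>k. (1 / p) ^ k) * \<bar>l\<bar> powr b"
proof -
  have "dyadic_weight p l \<le> (\<Sum>k. \<bar>l\<bar> powr b * (1 / p) ^ k)"
    unfolding dyadic_weight_def
    by (intro suminf_le dyadic_term_le summable_dyadic summable_mult summable_inverse_p)
  then show ?thesis
    unfolding suminf_mult[OF summable_inverse_p] by (simp only: mult.commute)
qed

lemma ennreal_dyadic_weight:
  "ennreal (dyadic_weight p l) = (\<Sum>k. ennreal (p ^ k) * ennreal (psi ((1 / 4) ^ k) l))"
  unfolding dyadic_weight_def
  using p_gt_1
  by (subst suminf_ennreal2[symmetric])
     (auto simp: summable_dyadic dyadic_term_nonneg ennreal_mult[symmetric] psi_nonneg)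

lemma dyadic_weight_pos: "l \<noteq> 0 \<Longrightarrow> 0 < dyadic_weight p l"
  by (rule order.strict_trans2[OF _ dyadic_weight_ge[of 0]]) (simp add: psi_def)

text \<open>For |l| >= 1 the term k = 0 of the weight is at least 1/2. Otherwise |l| lies in a shell
  (4^(-k-1), 4^(-k)], where term k alone is at least p^k |l| / 2, and at time 2^k the argument of
  the sine lies in (1/2, 1], away from its zeros, so the squared wave multiplier is comparable to 1
  / |l|.\<close>

lemma inverse_dyadic_weight_le:
  assumes "l \<noteq> 0"
  shows "1 / dyadic_weight p l \<le> 2 \<or>
    (\<exists>k. 1 / dyadic_weight p l \<le> 32 * (1 / p) ^ k * (wave_mult (2 ^ k) l)\<^sup>2)"
proof (cases "1 \<le> \<bar>l\<bar>")
  case True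
  have "1 / 2 \<le> psi 1 l" using True by (simp add: psi_def field_simps)
  also have "\<dots> \<le> dyadic_weight p l" using dyadic_weight_ge[of 0 l] by simp
  finally show ?thesis by (simp add: field_simps)
next
  case False
  \<comment> \<open>\<open>n\<close> is the first exponent with 4^(-n) < |l|. It is positive since
    |l| < 1, and the shell index is its predecessor \<open>k\<close>, for which 4^(-k) is still at
    least |l|.\<close>
  define n where "n = (LEAST n. (1 / 4 :: real) ^ n < \<bar>l\<bar>)"
  have "\<exists>n. (1 / 4 :: real) ^ n < \<bar>l\<bar>"
    using assms by (intro real_arch_pow_inv) auto
  then have n: "(1 / 4 :: real) ^ n < \<bar>l\<bar>"
    unfolding n_def by (rule LeastI_ex)
  with False have "n \<noteq> 0" by (cases n) auto
  then obtain k where k: "n = Suc k" by (cases n) auto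
  have not: "\<not> (1 / 4 :: real) ^ k < \<bar>l\<bar>"
    using not_less_Least[of k "\<lambda>n. (1 / 4 :: real) ^ n < \<bar>l\<bar>"] k by (simp add: n_def)
  define s :: real where "s = (1 / 4) ^ k"
  have s: "0 < s" "\<bar>l\<bar> \<le> s" "s < 4 * \<bar>l\<bar>" "0 < \<bar>l\<bar>"
    using n not k assms by (auto simp: s_def)
  have "1 / 2 \<le> s / (\<bar>l\<bar> + s)" using s by (simp add: field_simps)
  from mult_left_mono[OF this abs_ge_zero[of l]] have "\<bar>l\<bar> / 2 \<le> psi s l"
    by (simp add: psi_def)
  then have "p ^ k * (\<bar>l\<bar> / 2) \<le> dyadic_weight p l"
    using p_gt_1 by (intro order_trans[OF mult_left_mono dyadic_weight_ge[of k l]]) (auto simp: s_def)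
  then have "1 / dyadic_weight p l \<le> 1 / (p ^ k * (\<bar>l\<bar> / 2))"
    using s p_gt_1 by (intro divide_left_mono) (auto intro!: mult_pos_pos dyadic_weight_pos[OF assms])
  also have "\<dots> = 2 * (1 / p) ^ k * (1 / \<bar>l\<bar>)"
    by (simp add: power_divide)
  \<comment> \<open>The factor 16: with t = 2^k sqrt |l| one has t^2 = |l| / s > 1/4, so sin^2 t >=
    t^2 / 4 > 1/16.\<close>
  also have "\<dots> \<le> 2 * (1 / p) ^ k * (16 * (wave_mult (2 ^ k) l)\<^sup>2)"
  proof (rule mult_left_mono)
    define t where "t = 2 ^ k * sqrt \<bar>l\<bar>"
    have t2: "t\<^sup>2 = \<bar>l\<bar> / s"
    proof -
      have "((2 :: real) ^ k)\<^sup>2 = 4 ^ k"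
        by (simp add: power2_eq_square flip: power_mult_distrib)
      then show ?thesis by (simp add: t_def s_def power_mult_distrib power_divide)
    qed
    have "t\<^sup>2 \<le> 1" using s t2 by simp
    then have "t\<^sup>2 / 4 \<le> (sin t)\<^sup>2"
      by (intro sin_square_ge) (auto simp: t_def power_le_one_iff intro: power2_le_imp_le)
    then have "\<bar>l\<bar> / s / 4 \<le> (sin t)\<^sup>2" by (simp only: t2)
    from divide_right_mono[OF this abs_ge_zero]
    have "(\<bar>l\<bar> / s / 4) / \<bar>l\<bar> \<le> (wave_mult (2 ^ k) l)\<^sup>2"
      by (simp only: wave_mult_square[OF assms] t_def)
    moreover have "1 / \<bar>l\<bar> \<le> 16 * ((\<bar>l\<bar> / s / 4) / \<bar>l\<bar>)"
      using s by (simp add: field_simps)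
    ultimately show "1 / \<bar>l\<bar> \<le> 16 * (wave_mult (2 ^ k) l)\<^sup>2" by linarith
  qed (use p_gt_1 in simp)
  finally show ?thesis by (intro disjI2 exI[of _ k]) simp
qed

end

section \<open>The variational formula and the pairing estimate\<close>

context pvm
begin

lemma ip_calc_one:
  assumes "f \<in> L2 m" "g \<in> L2 m"
  shows "ip m f (calc (\<lambda>l. 1) g) = ip m f g"
proof -
  have one: "(\<lambda>l. 1) = (indicator UNIV :: real \<Rightarrow> real)" by auto
  have "ip m f (calc (\<lambda>l. 1) g) = ip m (calc (indicator UNIV) g) f"
    unfolding one by (rule ip_commute)
  also have "\<dots> = polar (indicator UNIV) g f"
    using assms by (intro ip_calc bdd_borel_indicator) auto
  also have "\<dots> = ip m (P UNIV g) f"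
    using assms by (intro polar_indicator) auto
  also have "\<dots> = ip m g f"
    using assms by (intro ip_P_UNIV)
  finally show ?thesis by (simp only: ip_commute)
qed

lemma integral_diag_one: "f \<in> L2 m \<Longrightarrow> (\<integral>l. 1 \<partial>diag_measure m P f) = ip m f f"
  by (simp add: measure_diag ip_P_UNIV)

text \<open>\<open>\<integral>\<psi>\<^sub>s d\<langle>P f, f\<rangle> = min\<^sub>v (\<integral>\<bar>l\<bar> d\<langle>P v, v\<rangle> + s \<parallel>f - v\<parallel>\<^sup>2)\<close>: this inequality and the attainment
  below make contraction properties of the form pass to \<open>\<psi>\<^sub>s\<close>.\<close>

lemma integral_psi_le:
  assumes s: "0 < s" and f: "f \<in> L2 m" and v: "v \<in> spectral_domain m P sqrt"
  shows "(\<integral>l. psi s l \<partial>diag_measure m P f)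
    \<le> (\<integral>l. \<bar>l\<bar> \<partial>diag_measure m P v) + s * (l2norm m (\<lambda>x. f x - v x))\<^sup>2"
proof -
  let ?w = "calc (psi s) f"
  define a where "a l = (psi s l)\<^sup>2 / \<bar>l\<bar>" for l
  have psi: "psi s \<in> bdd_borel" by (rule psi_bdd_borel[OF s])
  have vL: "v \<in> L2 m" using v by (rule spectral_domain_L2)
  have w: "?w \<in> L2 m" by (intro calc_L2 psi f)
  \<comment> \<open>The identity removes the division by |l|, which shows that \<open>a\<close> is a
    bounded multiplier.\<close>
  have a_eq: "a l = psi s l - (1 / s) * (psi s l)\<^sup>2" for l
    using psi_square_identity[OF s, of l] by (simp add: a_def)
  have a_bdd: "a \<in> bdd_borel"
    unfolding a_eq[abs_def] by (intro bdd_borel_intros psi)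
  have int_v: "integrable (diag_measure m P v) (\<lambda>l. \<bar>l\<bar>)"
    using v by (simp add: spectral_domain_def power2_sqrt)
  define Q X Y \<alpha> \<beta> where "Q = (\<integral>l. psi s l \<partial>diag_measure m P f)"
    and "X = (\<integral>l. \<bar>l\<bar> \<partial>diag_measure m P v)" and "Y = l2norm m (\<lambda>x. f x - v x)"
    and "\<alpha> = (\<integral>l. a l \<partial>diag_measure m P f)" and "\<beta> = (\<integral>l. (psi s l)\<^sup>2 \<partial>diag_measure m P f)"
  have "\<alpha> = Q - (1 / s) * \<beta>"
    unfolding \<alpha>_def Q_def \<beta>_def a_eq
    using f psi by (simp add: integrable_diag bdd_borel_power2)
  have nonneg: "0 \<le> X" "0 \<le> Y" "0 \<le> \<alpha>" "0 \<le> \<beta>"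
    unfolding X_def Y_def \<alpha>_def \<beta>_def
    by (auto intro!: integral_nonneg_AE simp: l2norm_nonneg a_def)
  \<comment> \<open>The pairing is split along f = v + (f - v), with weight |l| for the first part
    and no weight for the second. Since \<alpha> + \<beta> / s = Q, two arithmetic-geometric mean
    inequalities leave Q / 2 on the right, which is absorbed.\<close>
  have "Q = ip m f ?w"
    using f psi by (simp add: Q_def ip_commute[of m f] ip_calc polar_self)
  also have "\<dots> = ip m v ?w + ip m (\<lambda>x. f x - v x) ?w"
    using f vL w by (simp add: ip_diff_left)
  also have "ip m v ?w \<le> sqrt X * sqrt \<alpha>"
  proof -
    have "\<bar>ip m v ?w\<bar> \<le> sqrt (\<integral>l. \<bar>l\<bar> \<partial>diag_measure m P v)
        * sqrt (\<integral>l. (psi s l)\<^sup>2 / \<bar>l\<bar> \<partial>diag_measure m P f)"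
      using int_v integrable_diag[OF f a_bdd]
      by (intro weighted_Cauchy_Schwarz psi vL f) (auto simp: psi_def a_def[abs_def])
    then show ?thesis by (simp add: X_def \<alpha>_def a_def)
  qed
  also have "ip m (\<lambda>x. f x - v x) ?w \<le> Y * sqrt \<beta>"
    using ip_Cauchy_Schwarz[OF L2_diff[OF f vL] w] ip_calc_self[OF psi f]
    by (simp add: Y_def \<beta>_def l2norm_def[of m ?w])
  also have "sqrt X * sqrt \<alpha> \<le> (X + \<alpha>) / 2"
    using arith_geo_mean_sqrt[of X \<alpha>] nonneg by (simp add: real_sqrt_mult)
  also have "Y * sqrt \<beta> \<le> (s * Y\<^sup>2 + \<beta> / s) / 2"
    using arith_geo_mean_sqrt[of "s * Y\<^sup>2" "\<beta> / s"] nonneg s by (simp add: real_sqrt_mult)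
  finally have "Q \<le> X + s * Y\<^sup>2"
    using \<open>\<alpha> = Q - (1 / s) * \<beta>\<close> by (simp add: field_simps)
  then show ?thesis by (simp add: Q_def X_def Y_def)
qed

lemma integral_psi_attained:
  assumes s: "0 < s" and f: "f \<in> L2 m"
  obtains v where "v \<in> Domain (spectral_integral m P sqrt)"
    "(\<integral>l. \<bar>l\<bar> \<partial>diag_measure m P v) + s * (l2norm m (\<lambda>x. f x - v x))\<^sup>2
      = (\<integral>l. psi s l \<partial>diag_measure m P f)"
proof -
  \<comment> \<open>The minimiser is obtained by applying the multiplier s / (|l| + s) to
    \<open>f\<close>: stationarity of the functional reads |l| v = s (f - v) at each spectral value.
    Boundedness of \<open>sqrt l * \<rho> l\<close> puts it into the form domain.\<close>
  define \<rho> where "\<rho> l = s / (\<bar>l\<bar> + s)" for l :: real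
  have \<rho>: "\<rho> \<in> bdd_borel"
  proof (rule bdd_borelI[of _ 1])
    show "\<rho> \<in> borel_measurable borel" unfolding \<rho>_def by measurable
  qed (use s in \<open>simp add: \<rho>_def divide_le_eq\<close>)
  have prod: "(\<lambda>l. sqrt l * \<rho> l) \<in> bdd_borel"
  proof (rule bdd_borelI[of _ "1 + s"])
    show "(\<lambda>l. sqrt l * \<rho> l) \<in> borel_measurable borel" unfolding \<rho>_def by measurable
    fix l :: real
    have "sqrt \<bar>l\<bar> \<le> 1 + \<bar>l\<bar>"
      by (rule real_le_lsqrt) (auto simp: power2_eq_square algebra_simps)
    then have "\<bar>sqrt l * \<rho> l\<bar> \<le> (1 + \<bar>l\<bar>) * \<rho> l"
      using s unfolding abs_mult abs_sqrt by (intro mult_mono) (auto simp: \<rho>_def)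
    also have "\<dots> \<le> 1 + s"
      using s by (simp add: \<rho>_def field_simps)
    finally show "\<bar>sqrt l * \<rho> l\<bar> \<le> 1 + s" .
  qed
  let ?v = "calc \<rho> f"
  have v: "?v \<in> L2 m" by (intro calc_L2 \<rho> f)
  have si: "(?v, calc (\<lambda>l. sqrt l * \<rho> l) f) \<in> spectral_integral m P sqrt"
    by (rule spectral_integral_calc[OF _ \<rho> f prod]) simp
  have "(\<integral>l. \<bar>l\<bar> \<partial>diag_measure m P ?v) = (\<integral>l. \<bar>l\<bar> * (\<rho> l)\<^sup>2 \<partial>diag_measure m P f)"
    using spectral_integral_norm[OF _ si] ip_calc_self[OF prod f]
    by (simp add: power2_sqrt power_mult_distrib)
  moreover have "(l2norm m (\<lambda>x. f x - ?v x))\<^sup>2 = (\<integral>l. 1 - 2 * \<rho> l + (\<rho> l)\<^sup>2 \<partial>diag_measure m P f)"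
  proof -
    have "ip m ?v f = (\<integral>l. \<rho> l \<partial>diag_measure m P f)"
      using \<rho> f by (simp add: ip_calc polar_self)
    then show ?thesis
      using f v \<rho> ip_calc_self[OF \<rho> f] integral_diag_one[OF f]
      by (simp add: l2norm_power2 ip_linear L2_intros ip_commute[of m f ?v] integrable_diag bdd_borel_intros
          del: lebesgue_integral_const)
  qed
  moreover have "(\<integral>l. \<bar>l\<bar> * (\<rho> l)\<^sup>2 \<partial>diag_measure m P f) + s * (\<integral>l. 1 - 2 * \<rho> l + (\<rho> l)\<^sup>2 \<partial>diag_measure m P f)
      = (\<integral>l. psi s l \<partial>diag_measure m P f)"
  proof -
    have eq: "\<bar>l\<bar> * (\<rho> l)\<^sup>2 + s * (1 - 2 * \<rho> l + (\<rho> l)\<^sup>2) = psi s l" for l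
    proof -
      have "\<bar>l\<bar> + s \<noteq> 0" using s by (smt (verit) abs_ge_zero)
      then have "\<rho> l * (\<bar>l\<bar> + s) = s" "psi s l = \<bar>l\<bar> * \<rho> l" by (auto simp: \<rho>_def psi_def)
      moreover have "\<bar>l\<bar> * (\<rho> l)\<^sup>2 + s * (1 - 2 * \<rho> l + (\<rho> l)\<^sup>2)
          = \<rho> l * (\<rho> l * (\<bar>l\<bar> + s)) + s - 2 * s * \<rho> l"
        by (simp add: power2_eq_square algebra_simps)
      ultimately show ?thesis by (simp add: algebra_simps)
    qed
    have "(\<lambda>l. (sqrt l * \<rho> l)\<^sup>2) \<in> bdd_borel" by (intro bdd_borel_power2 prod)
    then have "(\<lambda>l. \<bar>l\<bar> * (\<rho> l)\<^sup>2) \<in> bdd_borel" by (simp add: power_mult_distrib power2_sqrt)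
    then have "(\<integral>l. \<bar>l\<bar> * (\<rho> l)\<^sup>2 + s * (1 - 2 * \<rho> l + (\<rho> l)\<^sup>2) \<partial>diag_measure m P f)
        = (\<integral>l. \<bar>l\<bar> * (\<rho> l)\<^sup>2 \<partial>diag_measure m P f) + s * (\<integral>l. 1 - 2 * \<rho> l + (\<rho> l)\<^sup>2 \<partial>diag_measure m P f)"
      using \<rho> f
      by (subst Bochner_Integration.integral_add)
         (auto intro!: integrable_diag bdd_borel_intros)
    then show ?thesis by (simp add: eq)
  qed
  ultimately show thesis using si by (intro that[of ?v]) auto
qed

text \<open>An atom of mass M at 0 would contribute t^2 M to the squared norm of the wave,
  contradicting the bound for large t. Off 0 the reciprocal weight is dominated by 2 plus the sum
  over all k of the bounds of \<open>inverse_dyadic_weight_le\<close>; integrating termwise costs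
  \<open>C\<close> per shell, and the factors p^(-k) sum.\<close>

lemma integrable_inverse_dyadic_weight:
  assumes b: "0 < b" "b < 1" and p: "p = 2 powr (1 - b)" and g: "g \<in> L2 m"
    and C: "\<And>t. 0 \<le> t \<Longrightarrow> (\<integral>l. (wave_mult t l)\<^sup>2 \<partial>diag_measure m P g) \<le> C"
  shows "AE l in diag_measure m P g. l \<noteq> 0"
    and "integrable (diag_measure m P g) (\<lambda>l. 1 / dyadic_weight p l)"
proof -
  interpret finite_measure "diag_measure m P g" by (rule finite_measure_diag[OF g])
  have wave: "integrable (diag_measure m P g) (\<lambda>l. (wave_mult t l)\<^sup>2)" for t
    by (intro integrable_diag g bdd_borel_power2 wave_mult_bdd_borel)
  note [measurable] = wave_mult_bdd_borel[THEN bdd_borel_measurable] dyadic_weight_measurable[OF b p]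
  have "0 \<le> C" by (rule order_trans[OF _ C[of 0]]) (auto intro!: integral_nonneg_AE)
  have "measure (diag_measure m P g) {0} = 0"
  proof (rule ccontr)
    let ?M = "measure (diag_measure m P g) {0}"
    assume "?M \<noteq> 0"
    then have M: "0 < ?M" by (simp add: order_less_le)
    have "t\<^sup>2 * ?M \<le> C" if "0 \<le> t" for t
    proof -
      have "t\<^sup>2 * ?M = (\<integral>l. t\<^sup>2 * indicator {0} l \<partial>diag_measure m P g)" by simp
      also have "\<dots> \<le> (\<integral>l. (wave_mult t l)\<^sup>2 \<partial>diag_measure m P g)"
        using integrable_diag[OF g bdd_borel_mult[OF bdd_borel_const bdd_borel_indicator], of "{0}" "t\<^sup>2"]
        by (intro integral_mono wave) (auto simp: wave_mult_def indicator_def)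
      finally show ?thesis using C[OF that] by simp
    qed
    \<comment> \<open>At this time the left side equals \<open>C + 1\<close>.\<close>
    from this[of "sqrt ((C + 1) / ?M)"] M \<open>0 \<le> C\<close> show False by simp
  qed
  then have "{0} \<in> null_sets (diag_measure m P g)"
    by (auto simp: null_sets_def emeasure_eq_measure)
  then have nz: "AE l in diag_measure m P g. l \<notin> {0}" by (rule AE_not_in)
  then show "AE l in diag_measure m P g. l \<noteq> 0" by simp
  have "(\<integral>\<^sup>+l. ennreal (1 / dyadic_weight p l) \<partial>diag_measure m P g)
      \<le> (\<integral>\<^sup>+l. 2 + (\<Sum>k. ennreal (32 * (1 / p) ^ k) * ennreal ((wave_mult (2 ^ k) l)\<^sup>2)) \<partial>diag_measure m P g)"
  proof (rule nn_integral_mono_AE)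
    show "AE l in diag_measure m P g. ennreal (1 / dyadic_weight p l)
        \<le> 2 + (\<Sum>k. ennreal (32 * (1 / p) ^ k) * ennreal ((wave_mult (2 ^ k) l)\<^sup>2))"
      using nz
    proof eventually_elim
      case (elim l)
      let ?S = "\<lambda>k. ennreal (32 * (1 / p) ^ k) * ennreal ((wave_mult (2 ^ k) l)\<^sup>2)"
      from elim consider "1 / dyadic_weight p l \<le> 2"
        | k where "1 / dyadic_weight p l \<le> 32 * (1 / p) ^ k * (wave_mult (2 ^ k) l)\<^sup>2"
        using inverse_dyadic_weight_le[OF b p, of l] by auto
      then show ?case
      proof cases
        case 1
        then have "ennreal (1 / dyadic_weight p l) \<le> 2" by (simp add: ennreal_leI flip: ennreal_numeral)
        then show ?thesis by (rule order_trans) simp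
      next
        case 2
        then have "ennreal (1 / dyadic_weight p l) \<le> ?S k"
          using p_gt_1[OF b p] by (subst ennreal_mult[symmetric]) (auto intro: ennreal_leI)
        also have "\<dots> \<le> (\<Sum>k. ?S k)" using sum_le_suminf[of ?S "{k}"] by simp
        also have "\<dots> \<le> 2 + (\<Sum>k. ?S k)" by simp
        finally show ?thesis .
      qed
    qed
  qed
  also have "\<dots> = 2 * emeasure (diag_measure m P g) UNIV
      + (\<Sum>k. ennreal (32 * (1 / p) ^ k) * (\<integral>\<^sup>+l. ennreal ((wave_mult (2 ^ k) l)\<^sup>2) \<partial>diag_measure m P g))"
    by (subst nn_integral_add) (auto simp: nn_integral_suminf nn_integral_cmult)
  also have "\<dots> \<le> 2 * emeasure (diag_measure m P g) UNIV
      + (\<Sum>k. ennreal (32 * (1 / p) ^ k) * ennreal C)"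
    by (intro add_mono suminf_le mult_left_mono order_refl)
       (auto simp: nn_integral_eq_integral[OF wave] intro!: ennreal_leI C)
  also have "(\<Sum>k. ennreal (32 * (1 / p) ^ k) * ennreal C) = ennreal (\<Sum>k. 32 * (1 / p) ^ k * C)"
  proof -
    have nonneg: "0 \<le> 32 * (1 / p) ^ k" for k using p_gt_1[OF b p] by simp
    have "(\<Sum>k. ennreal (32 * (1 / p) ^ k) * ennreal C) = (\<Sum>k. ennreal (32 * (1 / p) ^ k * C))"
      by (simp only: ennreal_mult[OF nonneg \<open>0 \<le> C\<close>])
    also have "\<dots> = ennreal (\<Sum>k. 32 * (1 / p) ^ k * C)"
      by (intro suminf_ennreal2 mult_nonneg_nonneg nonneg \<open>0 \<le> C\<close>
          summable_mult2 summable_mult summable_inverse_p[OF b p])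
    finally show ?thesis .
  qed
  also have "2 * emeasure (diag_measure m P g) UNIV + ennreal (\<Sum>k. 32 * (1 / p) ^ k * C) < \<infinity>"
    using emeasure_finite[of UNIV] by (auto simp: ennreal_mult_less_top ennreal_mult_eq_top_iff less_top[symmetric])
  finally show "integrable (diag_measure m P g) (\<lambda>l. 1 / dyadic_weight p l)"
    using dyadic_weight_nonneg[OF b p] by (intro integrableI_nonneg) auto
qed

text \<open>\<open>f\<close> will be the absolute value of \<open>u\<close>. Nothing is assumed
  about \<open>f\<close> with respect to the power form: comparing the \<open>psi\<close> integrals
  termwise bounds its dyadic weight by that of \<open>u\<close>, which also supplies the
  integrability needed for the weighted Cauchy-Schwarz inequality. The constant depends on
  \<open>g\<close> and \<open>b\<close> only.\<close>

lemma abs_ip_le_of_psi_dominated: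
  assumes b: "0 < b" "b < 1" and g: "g \<in> L2 m"
    and C: "\<And>t. 0 \<le> t \<Longrightarrow> (\<integral>l. (wave_mult t l)\<^sup>2 \<partial>diag_measure m P g) \<le> C"
  obtains K where "0 \<le> K"
    "\<And>f u. f \<in> L2 m \<Longrightarrow> u \<in> spectral_domain m P (\<lambda>l. l powr (b / 2)) \<Longrightarrow>
      (\<And>s. 0 < s \<Longrightarrow> (\<integral>l. psi s l \<partial>diag_measure m P f) \<le> (\<integral>l. psi s l \<partial>diag_measure m P u)) \<Longrightarrow>
      \<bar>ip m f g\<bar> \<le> K * sqrt (\<integral>l. (l powr (b / 2))\<^sup>2 \<partial>diag_measure m P u)"
proof -
  define p :: real where "p = 2 powr (1 - b)"
  note weight = dyadic_weight_measurable[OF b p_def] dyadic_weight_nonneg[OF b p_def]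
  note [measurable] = weight(1)
  define S where "S = (\<Sum>k. (1 / p) ^ k)"
  define G where "G = (\<integral>l. 1 / dyadic_weight p l \<partial>diag_measure m P g)"
  have S: "0 \<le> S" unfolding S_def
    using p_gt_1[OF b p_def] by (intro suminf_nonneg summable_inverse_p[OF b p_def]) auto
  have G: "0 \<le> G" unfolding G_def using weight(2) by (auto intro!: integral_nonneg_AE)
  have int_g: "AE l in diag_measure m P g. l \<noteq> 0"
      "integrable (diag_measure m P g) (\<lambda>l. 1 / dyadic_weight p l)"
    using integrable_inverse_dyadic_weight[OF b p_def g] C by blast+
  have "\<bar>ip m f g\<bar> \<le> (sqrt S * sqrt G) * sqrt (\<integral>l. (l powr (b / 2))\<^sup>2 \<partial>diag_measure m P u)"
    if f: "f \<in> L2 m" and u: "u \<in> spectral_domain m P (\<lambda>l. l powr (b / 2))"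
      and le: "\<And>s. 0 < s \<Longrightarrow> (\<integral>l. psi s l \<partial>diag_measure m P f) \<le> (\<integral>l. psi s l \<partial>diag_measure m P u)"
    for f u
  proof -
    have uL: "u \<in> L2 m" using u by (rule spectral_domain_L2)
    let ?U = "\<integral>l. (l powr (b / 2))\<^sup>2 \<partial>diag_measure m P u"
    have int_u: "integrable (diag_measure m P u) (\<lambda>l. (l powr (b / 2))\<^sup>2)"
      using u by (simp add: spectral_domain_def)
    have psi_int: "(\<integral>\<^sup>+l. ennreal (psi s l) \<partial>diag_measure m P h) = ennreal (\<integral>l. psi s l \<partial>diag_measure m P h)"
      if "0 < s" "h \<in> L2 m" for s h
      using that by (intro nn_integral_eq_integral integrable_diag psi_bdd_borel) (auto simp: psi_nonneg)
    have sum: "(\<integral>\<^sup>+l. ennreal (dyadic_weight p l) \<partial>diag_measure m P h)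
        = (\<Sum>k. ennreal (p ^ k) * ennreal (\<integral>l. psi ((1 / 4) ^ k) l \<partial>diag_measure m P h))"
      if "h \<in> L2 m" for h
      using that by (simp add: ennreal_dyadic_weight[OF b p_def] nn_integral_suminf nn_integral_cmult psi_int)
    have "(\<integral>\<^sup>+l. ennreal (dyadic_weight p l) \<partial>diag_measure m P f)
        \<le> (\<integral>\<^sup>+l. ennreal (dyadic_weight p l) \<partial>diag_measure m P u)"
      unfolding sum[OF f] sum[OF uL]
      by (intro suminf_le mult_left_mono ennreal_leI le) auto
    also have "\<dots> \<le> (\<integral>\<^sup>+l. ennreal (S * (l powr (b / 2))\<^sup>2) \<partial>diag_measure m P u)"
      using dyadic_weight_le[OF b p_def]
      by (intro nn_integral_mono ennreal_leI) (simp add: S_def power2_powr_half)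
    also have "\<dots> = ennreal (S * ?U)"
      using S int_u by (subst nn_integral_eq_integral) auto
    finally have fin: "(\<integral>\<^sup>+l. ennreal (dyadic_weight p l) \<partial>diag_measure m P f) \<le> ennreal (S * ?U)" .
    have U: "0 \<le> ?U" by (auto intro!: integral_nonneg_AE)
    have int_f: "integrable (diag_measure m P f) (dyadic_weight p)"
      using order.strict_trans1[OF fin ennreal_less_top] weight(2)
      by (intro integrableI_nonneg) auto
    have "(\<integral>l. dyadic_weight p l \<partial>diag_measure m P f) \<le> S * ?U"
      using fin weight(2) S U by (subst (asm) nn_integral_eq_integral[OF int_f]) auto
    \<comment> \<open>The multiplier is \<omega> = 1, so the square root of the weight falls on
      \<open>f\<close> and its reciprocal on \<open>g\<close>. The weight vanishes at most at 0,
      where \<open>g\<close> has no spectral mass.\<close>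
    moreover have "\<bar>ip m f (calc (\<lambda>l. 1) g)\<bar> \<le> sqrt (\<integral>l. dyadic_weight p l \<partial>diag_measure m P f)
        * sqrt (\<integral>l. 1\<^sup>2 / dyadic_weight p l \<partial>diag_measure m P g)"
    proof (rule weighted_Cauchy_Schwarz)
      show "AE l in diag_measure m P g. dyadic_weight p l = 0 \<longrightarrow> (1 :: real) = 0"
        using int_g(1) by eventually_elim (use dyadic_weight_pos[OF b p_def] in fastforce)
    qed (use weight f g int_f int_g(2) bdd_borel_const in auto)
    ultimately have "\<bar>ip m f g\<bar> \<le> sqrt (S * ?U) * sqrt G"
      using f g G
      by (simp add: ip_calc_one G_def) (erule order_trans, intro mult_right_mono, auto)
    then show ?thesis by (simp add: real_sqrt_mult ac_simps)
  qed
  then show thesis using S G by (intro that[of "sqrt S * sqrt G"]) auto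
qed

end


section \<open>Contraction properties of the Schroedinger form\<close>

lemma Cc_measurable: "f \<in> Cc \<Longrightarrow> f \<in> borel_measurable borel"
  by (simp add: Cc_def borel_measurable_continuous_onI)

lemma Cc_bounded:
  assumes "f \<in> Cc"
  obtains K where "0 \<le> K" "\<And>x. \<bar>f x\<bar> \<le> K"
proof -
  let ?A = "closure {x. f x \<noteq> 0}"
  have "compact (f ` ?A)"
    using assms by (intro compact_continuous_image) (auto simp: Cc_def intro: continuous_on_subset)
  then obtain K where K: "\<And>x. x \<in> ?A \<Longrightarrow> \<bar>f x\<bar> \<le> K"
    using compact_imp_bounded[of "f ` ?A"] by (auto simp: bounded_iff)
  have "\<bar>f x\<bar> \<le> max 0 K" for x
  proof (cases "f x = 0")
    case False
    then have "x \<in> ?A" using closure_subset[of "{x. f x \<noteq> 0}"] by auto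
    from K[OF this] show ?thesis by simp
  qed simp
  then show thesis by (intro that[of "max 0 K"]) auto
qed

lemma Cc_zero: "(\<lambda>x. 0) \<in> Cc"
  by (simp add: Cc_def)

lemma Cc_subset_support:
  assumes f: "f \<in> Cc" and g: "continuous_on UNIV g" and sub: "\<And>x. f x = 0 \<Longrightarrow> g x = 0"
  shows "g \<in> Cc"
proof -
  have "closure {x. g x \<noteq> 0} \<subseteq> closure {x. f x \<noteq> 0}"
    using sub by (intro closure_mono) auto
  then have "compact (closure {x. g x \<noteq> 0})"
    using f compact_Int_closed[of "closure {x. f x \<noteq> 0}" "closure {x. g x \<noteq> 0}"]
    by (auto simp: Cc_def Int_absorb1)
  with g show ?thesis by (simp add: Cc_def)
qed

lemma Cc_scale: "f \<in> Cc \<Longrightarrow> (\<lambda>x. c * f x) \<in> Cc"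
  by (rule Cc_subset_support, assumption) (auto simp: Cc_def intro!: continuous_intros)

lemma Cc_abs: "f \<in> Cc \<Longrightarrow> (\<lambda>x. \<bar>f x\<bar>) \<in> Cc"
  by (rule Cc_subset_support, assumption) (auto simp: Cc_def intro!: continuous_intros)

lemma Cc_add:
  assumes "f \<in> Cc" "g \<in> Cc"
  shows "(\<lambda>x. f x + g x) \<in> Cc"
proof -
  have "{x. f x + g x \<noteq> 0} \<subseteq> {x. f x \<noteq> 0} \<union> {x. g x \<noteq> 0}" by auto
  from closure_mono[OF this]
  have sub: "closure {x. f x + g x \<noteq> 0} \<subseteq> closure {x. f x \<noteq> 0} \<union> closure {x. g x \<noteq> 0}"
    by (simp only: closure_Un)
  have "compact (closure {x. f x \<noteq> 0} \<union> closure {x. g x \<noteq> 0})"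
    using assms by (auto simp: Cc_def)
  from compact_Int_closed[OF this closed_closure, of "{x. f x + g x \<noteq> 0}"] sub
  have "compact (closure {x. f x + g x \<noteq> 0})" by (simp only: Int_absorb1)
  with assms show ?thesis by (auto simp: Cc_def intro!: continuous_intros)
qed

lemma Cc_mult_integrable:
  assumes "radon_measure \<rho>" "f \<in> Cc" "g \<in> Cc"
  shows "integrable \<rho> (\<lambda>x. f x * g x)"
proof -
  let ?A = "closure {x. f x \<noteq> 0}"
  have sets: "sets \<rho> = sets borel" and fin: "emeasure \<rho> ?A < \<infinity>"
    using assms by (auto simp: radon_measure_def Cc_def)
  obtain K K' where K: "0 \<le> K" "0 \<le> K'" "\<And>x. \<bar>f x\<bar> \<le> K" "\<And>x. \<bar>g x\<bar> \<le> K'"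
    using Cc_bounded[OF assms(2)] Cc_bounded[OF assms(3)] by metis
  show ?thesis
  proof (rule Bochner_Integration.integrable_bound)
    show "integrable \<rho> (\<lambda>x. K * K' * indicator ?A x)"
      using fin sets by (intro integrable_mult_right integrable_real_indicator) auto
    show "(\<lambda>x. f x * g x) \<in> borel_measurable \<rho>"
      unfolding measurable_cong_sets[OF sets refl]
      using assms(2,3)[THEN Cc_measurable] by (rule borel_measurable_times)
    show "AE x in \<rho>. norm (f x * g x) \<le> norm (K * K' * indicator ?A x)"
    proof (intro AE_I2)
      fix x
      show "norm (f x * g x) \<le> norm (K * K' * indicator ?A x)"
      proof (cases "f x = 0")
        case False
        then have "x \<in> ?A" using closure_subset[of "{x. f x \<noteq> 0}"] by auto
        moreover have "\<bar>f x\<bar> * \<bar>g x\<bar> \<le> K * K'" using K by (intro mult_mono) auto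
        ultimately show ?thesis using K(1,2) by (simp add: abs_mult)
      qed simp
    qed
  qed
qed

lemma Cc_subset_L2: "radon_measure m \<Longrightarrow> f \<in> Cc \<Longrightarrow> f \<in> L2 m"
  using Cc_mult_integrable[of m f f] measurable_cong_sets[of m borel borel borel] Cc_measurable[of f]
  by (auto simp: L2_def power2_eq_square radon_measure_def)

section \<open>The Schroedinger form on its core\<close>

locale dirichlet_with_potential =
  fixes m \<mu>p \<mu>m :: "'a::metric_space measure" and D :: "('a \<Rightarrow> real) set" and E :: "'a form"
  assumes dirichlet: "dirichlet_form m D E"
    and radon_p: "radon_measure \<mu>p" and radon_m: "radon_measure \<mu>m"
    and nonneg: "nonneg_form (D \<inter> Cc) (schroedinger_form E \<mu>p \<mu>m)"
    and closable: "closable_form m (D \<inter> Cc) (schroedinger_form E \<mu>p \<mu>m)"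
begin

abbreviation "S \<equiv> schroedinger_form E \<mu>p \<mu>m"
abbreviation "C \<equiv> D \<inter> Cc"

lemma D_add: "f \<in> D \<Longrightarrow> g \<in> D \<Longrightarrow> (\<lambda>x. f x + g x) \<in> D"
  using dirichlet unfolding dirichlet_form_def symmetric_form_def by blast

lemma D_scale: "f \<in> D \<Longrightarrow> (\<lambda>x. c * f x) \<in> D"
  using dirichlet unfolding dirichlet_form_def symmetric_form_def by blast

lemma D_L2: "f \<in> D \<Longrightarrow> f \<in> L2 m"
  using dirichlet unfolding dirichlet_form_def symmetric_form_def by blast

lemma E_commute: "f \<in> D \<Longrightarrow> g \<in> D \<Longrightarrow> E f g = E g f"
  using dirichlet unfolding dirichlet_form_def symmetric_form_def by blast

lemma E_add_left: "f \<in> D \<Longrightarrow> g \<in> D \<Longrightarrow> h \<in> D \<Longrightarrow> E (\<lambda>x. f x + g x) h = E f h + E g h"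
  using dirichlet unfolding dirichlet_form_def symmetric_form_def by blast

lemma E_scale_left: "f \<in> D \<Longrightarrow> g \<in> D \<Longrightarrow> E (\<lambda>x. c * f x) g = c * E f g"
  using dirichlet unfolding dirichlet_form_def symmetric_form_def by blast

lemma markov:
  assumes "f \<in> D"
  shows "(\<lambda>x. min (max 0 (f x)) 1) \<in> D"
    and "E (\<lambda>x. min (max 0 (f x)) 1) (\<lambda>x. min (max 0 (f x)) 1) \<le> E f f"
  using dirichlet assms by (simp_all add: dirichlet_form_def markovian_form_def)

lemma E_linear:
  assumes "f \<in> D" "g \<in> D" "h \<in> D"
  shows "E (\<lambda>x. f x + c * g x) h = E f h + c * E g h" "E h (\<lambda>x. f x + c * g x) = E h f + c * E h g"
  using assms
  by (simp_all add: E_add_left E_scale_left D_scale D_add E_commute[of h "\<lambda>x. f x + c * g x"]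
      E_commute[of h f] E_commute[of h g])

lemma E_quadratic:
  assumes f: "f \<in> D" and g: "g \<in> D"
  shows "E (\<lambda>x. f x + c * g x) (\<lambda>x. f x + c * g x) = E f f + 2 * c * E f g + c * (c * E g g)"
proof -
  have h: "(\<lambda>x. f x + c * g x) \<in> D" by (intro D_add D_scale f g)
  show ?thesis
    unfolding E_linear(1)[OF f g h] E_linear(2)[OF f g f] E_linear(2)[OF f g g] E_commute[OF g f]
    by (simp add: algebra_simps)
qed

lemma E_scale_both: "f \<in> D \<Longrightarrow> E (\<lambda>x. c * f x) (\<lambda>x. c * f x) = c * (c * E f f)"
  using E_scale_left[OF _ D_scale, of f f c c] E_commute[OF _ D_scale, of f f c]
    E_scale_left[of f f c] by simp

text \<open>Rescaling turns the unit contraction into truncation at level \<open>K\<close>, which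
  leaves a function below \<open>K\<close> untouched from above, so only the positive part remains.
  Bounded functions suffice because the core consists of them.\<close>

lemma max_0:
  assumes f: "f \<in> D" and bdd: "\<And>x. f x \<le> K" and K: "0 < K"
  shows "(\<lambda>x. max 0 (f x)) \<in> D" "E (\<lambda>x. max 0 (f x)) (\<lambda>x. max 0 (f x)) \<le> E f f"
proof -
  let ?g = "\<lambda>x. (1 / K) * f x" and ?h = "\<lambda>x. min (max 0 ((1 / K) * f x)) 1"
  have eq: "(\<lambda>x. max 0 (f x)) = (\<lambda>x. K * ?h x)"
  proof
    fix x
    have "f x / K \<le> 1" using bdd[of x] K by simp
    then show "max 0 (f x) = K * ?h x"
      using K by (auto simp: max_def min_def zero_le_divide_iff)
  qed
  have g: "?g \<in> D" by (rule D_scale[OF f])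
  have h: "?h \<in> D" "E ?h ?h \<le> E ?g ?g" using markov[OF g] by auto
  show "(\<lambda>x. max 0 (f x)) \<in> D" unfolding eq by (rule D_scale[OF h(1)])
  have "E (\<lambda>x. K * ?h x) (\<lambda>x. K * ?h x) = K * (K * E ?h ?h)"
    by (rule E_scale_both[OF h(1)])
  also have "\<dots> \<le> K * (K * E ?g ?g)"
    using h(2) K by (intro mult_left_mono) auto
  also have "E ?g ?g = (1 / K) * ((1 / K) * E f f)"
    by (rule E_scale_both[OF f])
  finally show "E (\<lambda>x. max 0 (f x)) (\<lambda>x. max 0 (f x)) \<le> E f f"
    unfolding eq using K by simp
qed

text \<open>The positive part of \<open>f\<^sup>+ - \<epsilon> f\<^sup>-\<close> is \<open>f\<^sup>+\<close> for every \<open>\<epsilon> > 0\<close>, whence \<open>E f\<^sup>+ f\<^sup>- \<le> 0\<close>.\<close>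

lemma E_abs_le:
  assumes f: "f \<in> D" and bdd: "\<And>x. \<bar>f x\<bar> \<le> K"
  shows "(\<lambda>x. \<bar>f x\<bar>) \<in> D" "E (\<lambda>x. \<bar>f x\<bar>) (\<lambda>x. \<bar>f x\<bar>) \<le> E f f"
proof -
  define p n where "p x = max 0 (f x)" and "n x = max 0 (- f x)" for x
  have K: "0 < \<bar>K\<bar> + 1" "\<And>x. f x \<le> \<bar>K\<bar> + 1" "\<And>x. - f x \<le> \<bar>K\<bar> + 1"
    using bdd by (auto simp: abs_le_iff) (smt (verit) bdd)+
  have p: "p \<in> D" unfolding p_def[abs_def] by (rule max_0(1)[OF f K(2,1)])
  have n: "n \<in> D"
    unfolding n_def[abs_def]
    by (rule max_0(1)[OF _ K(3,1)]) (use D_scale[OF f, of "-1"] in simp)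
  have "0 \<le> - 2 * E p n + e * E n n" if e: "0 < e" "e \<le> 1" for e
  proof -
    let ?g = "\<lambda>x. p x + (- e) * n x"
    have g: "?g \<in> D" by (intro D_add D_scale p n)
    have le: "?g x \<le> \<bar>K\<bar> + 1" for x
    proof -
      have "0 \<le> e * n x" using e by (simp add: n_def)
      moreover have "p x \<le> \<bar>K\<bar> + 1" using K(1) K(2)[of x] by (simp add: p_def)
      ultimately show ?thesis by simp
    qed
    have pos: "(\<lambda>x. max 0 (?g x)) = p"
      using e by (auto simp: p_def n_def max_def fun_eq_iff zero_le_mult_iff mult_le_0_iff)
    have "E p p \<le> E ?g ?g" using max_0(2)[OF g le K(1)] unfolding pos .
    also have "E ?g ?g = E p p - 2 * e * E p n + e * (e * E n n)"
      unfolding E_quadratic[OF p n] by simp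
    \<comment> \<open>Cancelling one factor \<open>e\<close> before it tends to 0 isolates the cross
      term.\<close>
    finally have "0 \<le> e * (- 2 * E p n + e * E n n)" by (simp add: algebra_simps)
    then show ?thesis using e by (simp add: zero_le_mult_iff)
  qed
  then have "2 * E p n \<le> 0 + e * E n n" if "0 < e" "e \<le> 1" for e using that by fastforce
  then have "2 * E p n \<le> 0"
  proof (intro tendsto_lowerbound[where F = "at_right 0" and f = "\<lambda>e. e * E n n"])
    show "((\<lambda>e. e * E n n) \<longlongrightarrow> 0) (at_right 0)" by (auto intro!: tendsto_eq_intros)
    show "\<forall>\<^sub>F e in at_right 0. 2 * E p n \<le> e * E n n"
      using \<open>\<And>e. 0 < e \<Longrightarrow> e \<le> 1 \<Longrightarrow> 2 * E p n \<le> 0 + e * E n n\<close>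
      by (auto simp: eventually_at_right_field intro!: exI[of _ 1])
  qed auto
  then have "E p p + 2 * 1 * E p n + 1 * (1 * E n n) \<le> E p p + 2 * (- 1) * E p n + (- 1) * ((- 1) * E n n)"
    by simp
  then have le: "E (\<lambda>x. p x + 1 * n x) (\<lambda>x. p x + 1 * n x)
      \<le> E (\<lambda>x. p x + (- 1) * n x) (\<lambda>x. p x + (- 1) * n x)"
    by (simp only: E_quadratic[OF p n])
  have abs: "(\<lambda>x. \<bar>f x\<bar>) = (\<lambda>x. p x + 1 * n x)" and f_eq: "f = (\<lambda>x. p x + (- 1) * n x)"
    by (auto simp: p_def n_def max_def fun_eq_iff)
  show "E (\<lambda>x. \<bar>f x\<bar>) (\<lambda>x. \<bar>f x\<bar>) \<le> E f f"
    using le unfolding abs f_eq[symmetric] .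
  show "(\<lambda>x. \<bar>f x\<bar>) \<in> D" unfolding abs by (intro D_add D_scale p n)
qed

lemma C_add_scale: "f \<in> C \<Longrightarrow> g \<in> C \<Longrightarrow> (\<lambda>x. f x + c * g x) \<in> C"
  by (auto intro!: D_add D_scale Cc_add Cc_scale)

lemma C_diff: "f \<in> C \<Longrightarrow> g \<in> C \<Longrightarrow> (\<lambda>x. f x - g x) \<in> C"
  using C_add_scale[of f g "-1"] by simp

lemma S_commute: "f \<in> C \<Longrightarrow> g \<in> C \<Longrightarrow> S f g = S g f"
  by (simp add: schroedinger_form_def E_commute mult.commute)

lemma S_linear:
  assumes "f \<in> C" "g \<in> C" "h \<in> C"
  shows "S (\<lambda>x. f x + c * g x) h = S f h + c * S g h"
proof -
  have "integral\<^sup>L \<rho> (\<lambda>x. (f x + c * g x) * h x) = (\<integral>x. f x * h x \<partial>\<rho>) + c * (\<integral>x. g x * h x \<partial>\<rho>)"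
    if "radon_measure \<rho>" for \<rho>
    using Cc_mult_integrable[OF that, of f h] Cc_mult_integrable[OF that, of g h] assms
    by (simp add: distrib_right mult.assoc)
  then show ?thesis
    using assms radon_p radon_m by (simp add: schroedinger_form_def E_linear algebra_simps)
qed

lemma S_diff_left:
  "f \<in> C \<Longrightarrow> g \<in> C \<Longrightarrow> h \<in> C \<Longrightarrow> S (\<lambda>x. f x - g x) h = S f h - S g h"
  using S_linear[of f g h "-1"] by simp

lemma S_nonneg: "f \<in> C \<Longrightarrow> 0 \<le> S f f"
  using nonneg by (simp add: nonneg_form_def)

lemma S_Cauchy_Schwarz:
  assumes f: "f \<in> C" and g: "g \<in> C"
  shows "\<bar>S f g\<bar> \<le> sqrt (S f f) * sqrt (S g g)"
proof -
  have "0 \<le> S f f + 2 * t * S f g + t\<^sup>2 * S g g" for t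
  proof -
    let ?h = "\<lambda>x. f x + t * g x"
    have h: "?h \<in> C" by (rule C_add_scale[OF f g])
    have "S ?h ?h = S f ?h + t * S g ?h" by (rule S_linear[OF f g h])
    also have "S f ?h = S f f + t * S f g"
      using S_linear[OF f g f, of t] by (simp only: S_commute[OF f h] S_commute[OF f g])
    also have "S g ?h = S f g + t * S g g"
      using S_linear[OF f g g, of t] by (simp only: S_commute[OF g h])
    finally have "S ?h ?h = S f f + 2 * t * S f g + t\<^sup>2 * S g g"
      by (simp add: algebra_simps power2_eq_square)
    then show ?thesis using S_nonneg[OF h] by simp
  qed
  then have "(S f g)\<^sup>2 \<le> S f f * S g g"
    by (rule discriminant_bound) (rule S_nonneg[OF g])
  then have "sqrt ((S f g)\<^sup>2) \<le> sqrt (S f f * S g g)" by (rule real_sqrt_le_mono)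
  then show ?thesis by (simp add: real_sqrt_mult)
qed

text \<open>Both potential terms depend on f only through f^2 and are unchanged, whatever the sign
  of the potential, so only the Dirichlet part moves.\<close>

lemma S_abs_le:
  assumes "f \<in> C"
  shows "(\<lambda>x. \<bar>f x\<bar>) \<in> C" "S (\<lambda>x. \<bar>f x\<bar>) (\<lambda>x. \<bar>f x\<bar>) \<le> S f f"
proof -
  obtain K where "\<And>x. \<bar>f x\<bar> \<le> K" using Cc_bounded[of f] assms by blast
  from E_abs_le[OF _ this] assms
  show "(\<lambda>x. \<bar>f x\<bar>) \<in> C" "S (\<lambda>x. \<bar>f x\<bar>) (\<lambda>x. \<bar>f x\<bar>) \<le> S f f"
    by (auto simp: schroedinger_form_def Cc_abs)
qed

section \<open>The seminorm of the Schroedinger form and the closure of the form\<close>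

definition snorm :: "('a \<Rightarrow> real) \<Rightarrow> real" where
  "snorm f = sqrt (S f f)"

lemma snorm_nonneg: "f \<in> C \<Longrightarrow> 0 \<le> snorm f"
  by (simp add: snorm_def S_nonneg)

lemma snorm_power2: "f \<in> C \<Longrightarrow> (snorm f)\<^sup>2 = S f f"
  by (simp add: snorm_def S_nonneg)

lemma snorm_diff_commute: "snorm (\<lambda>x. f x - g x) = snorm (\<lambda>x. g x - f x)" if "f \<in> C" "g \<in> C"
proof -
  note C = C_diff[OF that] C_diff[OF that(2,1)]
  have "S (\<lambda>x. f x - g x) (\<lambda>x. f x - g x) = S f (\<lambda>x. f x - g x) - S g (\<lambda>x. f x - g x)"
    using that C by (intro S_diff_left)
  also have "\<dots> = S f f - 2 * S f g + S g g"
    using that C by (simp only: S_commute[OF that(1) C(1)] S_commute[OF that(2) C(1)] S_diff_left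
        S_commute[OF that(2,1)])
  also have "\<dots> = S g (\<lambda>x. g x - f x) - S f (\<lambda>x. g x - f x)"
    using that C by (simp only: S_commute[OF that(1) C(2)] S_commute[OF that(2) C(2)] S_diff_left
        S_commute[OF that(2,1)])
  also have "\<dots> = S (\<lambda>x. g x - f x) (\<lambda>x. g x - f x)"
    using that C by (intro S_diff_left[symmetric])
  finally show ?thesis by (simp add: snorm_def)
qed

lemma snorm_triangle:
  assumes f: "f \<in> C" and g: "g \<in> C"
  shows "snorm (\<lambda>x. f x + g x) \<le> snorm f + snorm g"
proof (rule power2_le_imp_le)
  have h: "(\<lambda>x. f x + g x) \<in> C" using C_add_scale[OF f g, of 1] by simp
  have add: "S (\<lambda>x. f x + g x) k = S f k + S g k" if "k \<in> C" for k
    using S_linear[OF f g that, of 1] by simp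
  have "S (\<lambda>x. f x + g x) (\<lambda>x. f x + g x) = S f f + 2 * S f g + S g g"
    using add[OF h] add[OF f] add[OF g]
    by (simp add: S_commute[OF f h] S_commute[OF g h] S_commute[OF g f])
  moreover have "S f g \<le> snorm f * snorm g"
    using S_Cauchy_Schwarz[OF f g] by (simp add: snorm_def)
  ultimately show "(snorm (\<lambda>x. f x + g x))\<^sup>2 \<le> (snorm f + snorm g)\<^sup>2"
    using f g h by (simp add: snorm_power2 power2_sum)
  show "0 \<le> snorm f + snorm g" using f g by (simp add: snorm_nonneg)
qed

lemma snorm_triangle_diff:
  assumes f: "f \<in> C" and g: "g \<in> C"
  shows "\<bar>snorm f - snorm g\<bar> \<le> snorm (\<lambda>x. f x - g x)"
proof -
  have "snorm f \<le> snorm (\<lambda>x. f x - g x) + snorm g"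
    using snorm_triangle[OF C_diff[OF f g] g] by simp
  moreover have "snorm g \<le> snorm (\<lambda>x. f x - g x) + snorm f"
    using snorm_triangle[OF C_diff[OF g f] f] by (simp add: snorm_diff_commute[OF f g])
  ultimately show ?thesis by linarith
qed

lemma form_CauchyD:
  assumes "form_Cauchy S F" "0 < e"
  obtains N where "\<And>i j. N \<le> i \<Longrightarrow> N \<le> j \<Longrightarrow> snorm (\<lambda>x. F i x - F j x) < e"
proof -
  have "0 < e\<^sup>2" using assms(2) by simp
  then obtain N where "\<And>i j. N \<le> i \<Longrightarrow> N \<le> j \<Longrightarrow> S (\<lambda>x. F i x - F j x) (\<lambda>x. F i x - F j x) < e\<^sup>2"
    using assms(1) unfolding form_Cauchy_def by blast
  then have "snorm (\<lambda>x. F i x - F j x) < e" if "N \<le> i" "N \<le> j" for i j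
    using real_sqrt_less_mono[of "S (\<lambda>x. F i x - F j x) (\<lambda>x. F i x - F j x)" "e\<^sup>2"] that assms(2)
    by (simp add: snorm_def)
  then show thesis by (rule that)
qed

lemma form_CauchyI:
  assumes F: "\<And>n. F n \<in> C"
    and Cauchy: "\<And>e. 0 < e \<Longrightarrow> \<exists>N. \<forall>i\<ge>N. \<forall>j\<ge>N. snorm (\<lambda>x. F i x - F j x) < e"
  shows "form_Cauchy S F"
  unfolding form_Cauchy_def
proof (intro allI impI)
  fix e :: real assume "0 < e"
  then obtain N where N: "\<And>i j. N \<le> i \<Longrightarrow> N \<le> j \<Longrightarrow> snorm (\<lambda>x. F i x - F j x) < sqrt e"
    using Cauchy[of "sqrt e"] by auto
  have "S (\<lambda>x. F i x - F j x) (\<lambda>x. F i x - F j x) < e" if "N \<le> i" "N \<le> j" for i j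
    using N[OF that] by (simp add: snorm_def)
  then show "\<exists>N. \<forall>i\<ge>N. \<forall>j\<ge>N. S (\<lambda>x. F i x - F j x) (\<lambda>x. F i x - F j x) < e" by blast
qed

lemma form_Cauchy_convergent:
  assumes F: "\<And>n. F n \<in> C" and Cauchy: "form_Cauchy S F"
  shows "convergent (\<lambda>n. snorm (F n))"
proof (rule Cauchy_convergent, rule CauchyI)
  fix e :: real assume "0 < e"
  then obtain N where N: "\<And>i j. N \<le> i \<Longrightarrow> N \<le> j \<Longrightarrow> snorm (\<lambda>x. F i x - F j x) < e"
    using form_CauchyD[OF Cauchy] by blast
  have "norm (snorm (F i) - snorm (F j)) < e" if "N \<le> i" "N \<le> j" for i j
    using snorm_triangle_diff[OF F F, of i j] N[OF that] by simp
  then show "\<exists>N. \<forall>i\<ge>N. \<forall>j\<ge>N. norm (snorm (F i) - snorm (F j)) < e" by blast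
qed

lemma C_L2: "f \<in> C \<Longrightarrow> f \<in> L2 m"
  by (simp add: D_L2)

text \<open>The difference of the two approximations is Cauchy for the form and tends to 0 in L2,
  which is exactly the situation of closability.\<close>

lemma form_approx_diff_tendsto_0:
  assumes f: "f \<in> L2 m" and F: "form_approx m C S f F" and G: "form_approx m C S f G"
  shows "(\<lambda>n. snorm (\<lambda>x. F n x - G n x)) \<longlonglongrightarrow> 0"
proof -
  have FC: "\<And>n. F n \<in> C" and GC: "\<And>n. G n \<in> C"
    and lims: "(\<lambda>n. l2norm m (\<lambda>x. F n x - f x)) \<longlonglongrightarrow> 0" "(\<lambda>n. l2norm m (\<lambda>x. G n x - f x)) \<longlonglongrightarrow> 0"
    and Cauchy: "form_Cauchy S F" "form_Cauchy S G"
    using F G by (auto simp: form_approx_def)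
  let ?H = "\<lambda>n x. F n x - G n x"
  have HC: "\<And>n. ?H n \<in> C" by (intro C_diff FC GC)
  have "form_Cauchy S ?H"
  proof (rule form_CauchyI[OF HC])
    fix e :: real assume "0 < e"
    then have "0 < e / 2" by simp
    obtain N where N: "\<And>i j. N \<le> i \<Longrightarrow> N \<le> j \<Longrightarrow> snorm (\<lambda>x. F i x - F j x) < e / 2"
      using form_CauchyD[OF Cauchy(1) \<open>0 < e / 2\<close>] by blast
    obtain N' where N': "\<And>i j. N' \<le> i \<Longrightarrow> N' \<le> j \<Longrightarrow> snorm (\<lambda>x. G i x - G j x) < e / 2"
      using form_CauchyD[OF Cauchy(2) \<open>0 < e / 2\<close>] by blast
    have "snorm (\<lambda>x. ?H i x - ?H j x) < e" if "max N N' \<le> i" "max N N' \<le> j" for i j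
    proof -
      have "(\<lambda>x. ?H i x - ?H j x) = (\<lambda>x. (F i x - F j x) + (G j x - G i x))" by auto
      then have "snorm (\<lambda>x. ?H i x - ?H j x) \<le> snorm (\<lambda>x. F i x - F j x) + snorm (\<lambda>x. G j x - G i x)"
        using snorm_triangle[OF C_diff[OF FC FC] C_diff[OF GC GC]] by simp
      with N[of i j] N'[of j i] that show ?thesis by simp
    qed
    then show "\<exists>N. \<forall>i\<ge>N. \<forall>j\<ge>N. snorm (\<lambda>x. ?H i x - ?H j x) < e" by blast
  qed
  moreover have "(\<lambda>n. l2norm m (?H n)) \<longlonglongrightarrow> 0"
  proof (rule tendsto_sandwich[of "\<lambda>_. 0"])
    show "(\<lambda>n. l2norm m (\<lambda>x. F n x - f x) + l2norm m (\<lambda>x. G n x - f x)) \<longlonglongrightarrow> 0"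
      using tendsto_add[OF lims] by simp
    have "l2norm m (?H n) \<le> l2norm m (\<lambda>x. F n x - f x) + l2norm m (\<lambda>x. G n x - f x)" for n
      using l2norm_triangle[OF L2_diff[OF C_L2[OF FC] f] L2_diff[OF f C_L2[OF GC]], of n n]
      by (simp add: l2norm_minus_commute[of m f])
    then show "\<forall>\<^sub>F n in sequentially. l2norm m (?H n)
        \<le> l2norm m (\<lambda>x. F n x - f x) + l2norm m (\<lambda>x. G n x - f x)" by simp
  qed (simp_all add: l2norm_nonneg)
  ultimately have "(\<lambda>n. S (?H n) (?H n)) \<longlonglongrightarrow> 0"
    using HC closable[unfolded closable_form_def, THEN spec, of ?H] by blast
  then show ?thesis
    unfolding snorm_def using tendsto_real_sqrt[of "\<lambda>n. S (?H n) (?H n)" 0] by simp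
qed

text \<open>The \<open>THE\<close> in \<open>closure_form\<close> asks for one limit common to all
  pairs of approximating sequences, even on the diagonal. Writing S(G, H) = S(G - F, H) + S(F, H -
  F) + S(F, F) reduces every pair to the given \<open>F\<close>; the first two terms vanish by
  Cauchy-Schwarz.\<close>

lemma closure_form_limit:
  assumes f: "f \<in> L2 m" and F: "form_approx m C S f F"
  shows "(\<lambda>n. S (F n) (F n)) \<longlonglongrightarrow> closure_form m C S f f"
proof -
  have FC: "\<And>n. F n \<in> C" and "form_Cauchy S F" using F by (auto simp: form_approx_def)
  then obtain a where a: "(\<lambda>n. snorm (F n)) \<longlonglongrightarrow> a"
    using form_Cauchy_convergent by (auto simp: convergent_def)
  then have lim: "(\<lambda>n. S (F n) (F n)) \<longlonglongrightarrow> a\<^sup>2"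
    using tendsto_power[OF a, of 2] FC by (simp only: snorm_power2)
  have "(\<lambda>n. S (G n) (H n)) \<longlonglongrightarrow> a\<^sup>2"
    if G: "form_approx m C S f G" and H: "form_approx m C S f H" for G H
  proof -
    have GC: "\<And>n. G n \<in> C" and HC: "\<And>n. H n \<in> C"
      using G H by (auto simp: form_approx_def)
    have diff_0: "(\<lambda>n. snorm (\<lambda>x. G n x - F n x)) \<longlonglongrightarrow> 0" "(\<lambda>n. snorm (\<lambda>x. H n x - F n x)) \<longlonglongrightarrow> 0"
      by (rule form_approx_diff_tendsto_0[OF f _ F], fact)+
    have "(\<lambda>n. snorm (H n) - snorm (F n)) \<longlonglongrightarrow> 0"
    proof (rule tendsto_rabs_zero_cancel, rule tendsto_sandwich[of "\<lambda>_. 0", OF _ _ _ diff_0(2)])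
      show "\<forall>\<^sub>F n in sequentially. \<bar>snorm (H n) - snorm (F n)\<bar> \<le> snorm (\<lambda>x. H n x - F n x)"
        by (intro always_eventually allI snorm_triangle_diff HC FC)
    qed simp_all
    from tendsto_add[OF this a] have H_lim: "(\<lambda>n. snorm (H n)) \<longlonglongrightarrow> a" by simp
    have "(\<lambda>n. S (\<lambda>x. G n x - F n x) (H n)) \<longlonglongrightarrow> 0"
    proof (rule tendsto_rabs_zero_cancel, rule tendsto_sandwich[of "\<lambda>_. 0"])
      show "(\<lambda>n. snorm (\<lambda>x. G n x - F n x) * snorm (H n)) \<longlonglongrightarrow> 0"
        using tendsto_mult[OF diff_0(1) H_lim] by simp
      show "\<forall>\<^sub>F n in sequentially. \<bar>S (\<lambda>x. G n x - F n x) (H n)\<bar> \<le> snorm (\<lambda>x. G n x - F n x) * snorm (H n)"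
        unfolding snorm_def by (intro always_eventually allI S_Cauchy_Schwarz C_diff GC FC HC)
    qed simp_all
    moreover have "(\<lambda>n. S (F n) (\<lambda>x. H n x - F n x)) \<longlonglongrightarrow> 0"
    proof (rule tendsto_rabs_zero_cancel, rule tendsto_sandwich[of "\<lambda>_. 0"])
      show "(\<lambda>n. snorm (F n) * snorm (\<lambda>x. H n x - F n x)) \<longlonglongrightarrow> 0"
        using tendsto_mult[OF a diff_0(2)] by simp
      show "\<forall>\<^sub>F n in sequentially. \<bar>S (F n) (\<lambda>x. H n x - F n x)\<bar> \<le> snorm (F n) * snorm (\<lambda>x. H n x - F n x)"
        unfolding snorm_def by (intro always_eventually allI S_Cauchy_Schwarz C_diff FC HC)
    qed simp_all
    ultimately have "(\<lambda>n. S (\<lambda>x. G n x - F n x) (H n) + S (F n) (\<lambda>x. H n x - F n x) + S (F n) (F n)) \<longlonglongrightarrow> 0 + 0 + a\<^sup>2"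
      by (intro tendsto_add lim)
    also have "(\<lambda>n. S (\<lambda>x. G n x - F n x) (H n) + S (F n) (\<lambda>x. H n x - F n x) + S (F n) (F n))
        = (\<lambda>n. S (G n) (H n))"
    proof
      fix n
      have "S (F n) (\<lambda>x. H n x - F n x) = S (F n) (H n) - S (F n) (F n)"
        using S_diff_left[OF HC FC FC, of n n n] S_commute[OF FC C_diff[OF HC FC], of n n n]
          S_commute[OF HC FC, of n n] by simp
      then show "S (\<lambda>x. G n x - F n x) (H n) + S (F n) (\<lambda>x. H n x - F n x) + S (F n) (F n) = S (G n) (H n)"
        using S_diff_left[OF GC FC HC, of n n n] by simp
    qed
    finally show ?thesis by simp
  qed
  then have "closure_form m C S f f = a\<^sup>2"
    unfolding closure_form_def
    using F LIMSEQ_unique[OF lim] by (intro the_equality) blast+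
  with lim show ?thesis by simp
qed

lemma form_approx_const:
  assumes f: "f \<in> C"
  shows "form_approx m C S f (\<lambda>n. f)"
proof -
  have "S (\<lambda>x. f x - f x) (\<lambda>x. f x - f x) = 0"
    using S_diff_left[OF f f C_diff[OF f f]] by simp
  with f show ?thesis
    by (simp add: form_approx_def form_Cauchy_def l2norm_def ip_def)
qed

lemma C_subset_closure_dom: "f \<in> C \<Longrightarrow> f \<in> closure_dom m C S"
  using form_approx_const[of f] C_L2[of f] by (auto simp: closure_dom_def)

lemma closure_form_C:
  assumes f: "f \<in> C"
  shows "closure_form m C S f f = S f f"
  using closure_form_limit[OF C_L2[OF f] form_approx_const[OF f]] by (simp add: LIMSEQ_const_iff)

lemma zero_in_C: "(\<lambda>x. 0) \<in> C"
proof -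
  obtain g where "g \<in> D"
    using dirichlet L2_zero[of m] zero_less_one
    unfolding dirichlet_form_def dense_in_L2_def by blast
  from D_scale[OF this, of 0] show ?thesis by (simp add: Cc_zero)
qed

end

text \<open>By the Lindelof property countably many open balls with compact closed balls cover the
  space. The truncated distance to the complement of such a ball, measured from its centre, is
  positive exactly on the open ball.\<close>

lemma locally_compact_bumps:
  assumes "locally_compact_space (euclidean :: 'a::{metric_space, second_countable_topology} topology)"
  obtains \<phi> :: "nat \<Rightarrow> 'a::{metric_space, second_countable_topology} \<Rightarrow> real" where "\<And>k. \<phi> k \<in> Cc" "\<And>k x. 0 \<le> \<phi> k x" "\<And>k x. \<phi> k x \<le> 1"
    "\<And>x. \<exists>k. 0 < \<phi> k x"
proof -
  have "\<exists>r>0. compact (cball x r)" for x :: 'a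
  proof -
    obtain U K where U: "open U" "compact K" "x \<in> U" "U \<subseteq> K"
      using assms by (simp add: locally_compact_space_def) blast
    then obtain r where r: "0 < r" "cball x r \<subseteq> U" by (metis open_contains_cball)
    then have "compact (K \<inter> cball x r)" using U by (intro compact_Int_closed) auto
    with r U show ?thesis by (auto simp: Int_absorb1 intro!: exI[of _ r])
  qed
  then obtain r :: "'a \<Rightarrow> real" where r: "\<And>x. 0 < r x" "\<And>x. compact (cball x (r x))" by metis
  obtain F' where F': "F' \<subseteq> range (\<lambda>x. ball x (r x))" "countable F'" "\<Union>F' = \<Union>(range (\<lambda>x. ball x (r x)))"
    by (rule Lindelof[of "range (\<lambda>x. ball x (r x))"]) auto
  then obtain X where X: "countable X" "F' = (\<lambda>x. ball x (r x)) ` X"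
    by (metis countable_subset_image subset_UNIV)
  have cover: "(\<Union>x\<in>X. ball x (r x)) = UNIV"
    using F'(3) r(1) unfolding X(2) by (auto intro: centre_in_ball[THEN iffD2])
  then have "X \<noteq> {}" by auto
  define \<phi> where "\<phi> k x = min 1 (max 0 (r (from_nat_into X k) - dist (from_nat_into X k) x))" for k x
  show thesis
  proof (rule that[of \<phi>])
    fix k
    let ?q = "from_nat_into X k"
    have "closure {x. \<phi> k x \<noteq> 0} \<subseteq> cball ?q (r ?q)"
      by (rule closure_minimal) (auto simp: \<phi>_def)
    then have "compact (closure {x. \<phi> k x \<noteq> 0})"
      using compact_Int_closed[OF r(2)[of ?q] closed_closure[of "{x. \<phi> k x \<noteq> 0}"]]
      by (simp add: Int_absorb1)
    moreover have "continuous_on UNIV (\<phi> k)"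
      unfolding \<phi>_def by (intro continuous_intros)
    ultimately show "\<phi> k \<in> Cc" by (simp add: Cc_def)
  next
    fix x
    obtain q where "q \<in> X" "x \<in> ball q (r q)" using cover by blast
    moreover obtain k where "from_nat_into X k = q"
      using from_nat_into_surj[OF X(1) \<open>q \<in> X\<close>] by blast
    ultimately show "\<exists>k. 0 < \<phi> k x" by (auto simp: \<phi>_def intro!: exI[of _ k])
  qed (auto simp: \<phi>_def)
qed


section \<open>Subcriticality\<close>

lemma l2norm_abs_diff_le:
  assumes "f \<in> L2 m" "g \<in> L2 m"
  shows "l2norm m (\<lambda>x. \<bar>f x\<bar> - \<bar>g x\<bar>) \<le> l2norm m (\<lambda>x. f x - g x)"
  unfolding l2norm_def ip_def
proof (rule real_sqrt_le_mono, rule integral_mono)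
  show "(\<bar>f x\<bar> - \<bar>g x\<bar>) * (\<bar>f x\<bar> - \<bar>g x\<bar>) \<le> (f x - g x) * (f x - g x)" for x
    using abs_le_square_iff[of "\<bar>f x\<bar> - \<bar>g x\<bar>" "f x - g x"] abs_triangle_ineq3[of "f x" "g x"]
    by (simp add: power2_eq_square)
qed (use assms in \<open>auto intro!: L2_integrable_mult L2_intros\<close>)

text \<open>The link between the closed form and the spectral calculus: the domains agree, and the
  values agree on the diagonal, which is where energies are compared.\<close>

locale schroedinger_calculus =
  dirichlet_with_potential m \<mu>p \<mu>m D E + pvm m P
  for m \<mu>p \<mu>m :: "'a::{metric_space, second_countable_topology} measure"
    and D :: "('a \<Rightarrow> real) set" and E :: "'a form" and P +
  assumes radon: "radon_measure m"
    and closure_dom_eq: "closure_dom m C S = Domain (spectral_integral m P sqrt)"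
    and closure_form_eq: "f \<in> closure_dom m C S \<Longrightarrow>
      closure_form m C S f f = op_form m (spectral_integral m P sqrt) f f"
begin

lemma closure_form_integral:
  assumes "f \<in> closure_dom m C S"
  shows "closure_form m C S f f = (\<integral>l. \<bar>l\<bar> \<partial>diag_measure m P f)"
  using op_form_spectral_integral[of sqrt f] assms
  by (simp add: closure_form_eq closure_dom_eq power2_sqrt)

text \<open>The minimiser \<open>v\<close> for \<open>f\<close> need not lie in the core, where the
  contraction by absolute value is known. It is therefore approximated by core functions
  \<open>F n\<close>, and their absolute values are competitors in the problem for |f|: their energy
  is no larger, and their distance to |f| is at most that of \<open>F n\<close> to f.\<close>

lemma integral_psi_abs_le:
  assumes f: "f \<in> L2 m" and s: "0 < s"
  shows "(\<integral>l. psi s l \<partial>diag_measure m P (\<lambda>x. \<bar>f x\<bar>)) \<le> (\<integral>l. psi s l \<partial>diag_measure m P f)"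
proof -
  obtain v where v: "v \<in> Domain (spectral_integral m P sqrt)"
    and att: "(\<integral>l. \<bar>l\<bar> \<partial>diag_measure m P v) + s * (l2norm m (\<lambda>x. f x - v x))\<^sup>2
      = (\<integral>l. psi s l \<partial>diag_measure m P f)"
    using integral_psi_attained[OF s f] by blast
  have vcl: "v \<in> closure_dom m C S" using v by (simp add: closure_dom_eq)
  then obtain F where vL: "v \<in> L2 m" and F: "form_approx m C S v F"
    by (auto simp: closure_dom_def)
  then have FC: "\<And>n. F n \<in> C" and Fv: "(\<lambda>n. l2norm m (\<lambda>x. F n x - v x)) \<longlonglongrightarrow> 0"
    by (auto simp: form_approx_def)
  have FL: "F n \<in> L2 m" for n by (rule C_L2[OF FC])
  show ?thesis
  proof (rule LIMSEQ_le_const)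
    have "(\<lambda>n. l2norm m (\<lambda>x. f x - F n x) - l2norm m (\<lambda>x. f x - v x)) \<longlonglongrightarrow> 0"
    proof (rule tendsto_rabs_zero_cancel, rule tendsto_sandwich[of "\<lambda>_. 0", OF _ _ _ Fv])
      have "\<bar>l2norm m (\<lambda>x. f x - F n x) - l2norm m (\<lambda>x. f x - v x)\<bar> \<le> l2norm m (\<lambda>x. F n x - v x)" for n
        using l2norm_triangle_diff[OF L2_diff[OF f FL] L2_diff[OF f vL], of n]
        by (simp add: l2norm_minus_commute[of m v])
      then show "\<forall>\<^sub>F n in sequentially.
          \<bar>l2norm m (\<lambda>x. f x - F n x) - l2norm m (\<lambda>x. f x - v x)\<bar> \<le> l2norm m (\<lambda>x. F n x - v x)"
        by simp
    qed simp_all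
    then have "(\<lambda>n. l2norm m (\<lambda>x. f x - F n x)) \<longlonglongrightarrow> l2norm m (\<lambda>x. f x - v x)"
      by (rule LIM_zero_cancel)
    moreover have "(\<lambda>n. S (F n) (F n)) \<longlonglongrightarrow> (\<integral>l. \<bar>l\<bar> \<partial>diag_measure m P v)"
      using closure_form_limit[OF vL F] by (simp add: closure_form_integral[OF vcl])
    ultimately show "(\<lambda>n. S (F n) (F n) + s * (l2norm m (\<lambda>x. f x - F n x))\<^sup>2)
        \<longlonglongrightarrow> (\<integral>l. psi s l \<partial>diag_measure m P f)"
      unfolding att[symmetric] by (intro tendsto_add tendsto_mult tendsto_power tendsto_const)
    show "\<exists>N. \<forall>n\<ge>N. (\<integral>l. psi s l \<partial>diag_measure m P (\<lambda>x. \<bar>f x\<bar>))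
        \<le> S (F n) (F n) + s * (l2norm m (\<lambda>x. f x - F n x))\<^sup>2"
    proof (intro exI allI impI)
      fix n
      let ?a = "\<lambda>x. \<bar>F n x\<bar>"
      have aC: "?a \<in> C" and le: "S ?a ?a \<le> S (F n) (F n)" using S_abs_le[OF FC] by auto
      have acl: "?a \<in> closure_dom m C S" by (rule C_subset_closure_dom[OF aC])
      then have "?a \<in> spectral_domain m P sqrt"
        using spectral_integral_Domain_subset[of sqrt] by (auto simp: closure_dom_eq)
      then have "(\<integral>l. psi s l \<partial>diag_measure m P (\<lambda>x. \<bar>f x\<bar>))
          \<le> (\<integral>l. \<bar>l\<bar> \<partial>diag_measure m P ?a) + s * (l2norm m (\<lambda>x. \<bar>f x\<bar> - \<bar>F n x\<bar>))\<^sup>2"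
        by (intro integral_psi_le s L2_abs f)
      also have "(\<integral>l. \<bar>l\<bar> \<partial>diag_measure m P ?a) = S ?a ?a"
        using closure_form_integral[OF acl] closure_form_C[OF aC] by simp
      also have "\<dots> \<le> S (F n) (F n)" by (rule le)
      also have "(l2norm m (\<lambda>x. \<bar>f x\<bar> - \<bar>F n x\<bar>))\<^sup>2 \<le> (l2norm m (\<lambda>x. f x - F n x))\<^sup>2"
        by (intro power_mono l2norm_abs_diff_le f FL l2norm_nonneg)
      finally show "(\<integral>l. psi s l \<partial>diag_measure m P (\<lambda>x. \<bar>f x\<bar>))
          \<le> S (F n) (F n) + s * (l2norm m (\<lambda>x. f x - F n x))\<^sup>2"
        using s by simp
    qed
  qed
qed

section \<open>The fractional power and its extended form\<close>

context
  fixes b :: real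
  assumes b: "0 < b" "b < 1"
begin

abbreviation "power_op \<equiv> spectral_integral m P (\<lambda>l. l powr (b / 2))"
abbreviation "power_form \<equiv> op_form m power_op"

lemma power_form_nonneg: "0 \<le> power_form f f"
  by (simp add: op_form_def ip_self_nonneg)

text \<open>The value chosen by \<open>op_app\<close> at \<open>f - g\<close> is unrelated to the
  values chosen at \<open>f\<close> and \<open>g\<close>. Its norm is a spectral integral, however,
  and so equals that of the difference of these values, to which the triangle inequality
  applies.\<close>

lemma power_form_diff:
  assumes f: "f \<in> Domain power_op" and g: "g \<in> Domain power_op"
  shows "\<bar>sqrt (power_form f f) - sqrt (power_form g g)\<bar>
    \<le> sqrt (power_form (\<lambda>x. f x - g x) (\<lambda>x. f x - g x))"
proof -
  have meas: "(\<lambda>l :: real. l powr (b / 2)) \<in> borel_measurable borel" by measurable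
  let ?h = "op_app power_op f" and ?k = "op_app power_op g"
  have fh: "(f, ?h) \<in> power_op" "(g, ?k) \<in> power_op" by (intro op_app_in f g)+
  then have L: "?h \<in> L2 m" "?k \<in> L2 m" by (auto simp: spectral_integral_iff)
  have diff: "(\<lambda>x. f x - g x, \<lambda>x. ?h x - ?k x) \<in> power_op"
    by (rule spectral_integral_diff[OF meas fh])
  have "power_form (\<lambda>x. f x - g x) (\<lambda>x. f x - g x) = ip m (\<lambda>x. ?h x - ?k x) (\<lambda>x. ?h x - ?k x)"
    using op_form_spectral_integral[OF meas DomainI[OF diff]] spectral_integral_norm[OF meas diff]
    by simp
  then show ?thesis
    using l2norm_triangle_diff[OF L] by (simp add: l2norm_def op_form_def)
qed

text \<open>Turns the \<open>lim\<close> occurring in \<open>subcritical_form\<close> into an actual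
  limit: the square roots of the energies are Cauchy by the reverse triangle inequality.\<close>

lemma power_form_convergent:
  assumes F: "\<And>n. F n \<in> Domain power_op" and Cauchy: "form_Cauchy power_form F"
  shows "(\<lambda>n. sqrt (power_form (F n) (F n))) \<longlonglongrightarrow> sqrt (lim (\<lambda>n. power_form (F n) (F n)))"
proof -
  have "Cauchy (\<lambda>n. sqrt (power_form (F n) (F n)))"
  proof (rule CauchyI)
    fix e :: real assume "0 < e"
    then have "0 < e\<^sup>2" by simp
    then obtain N where N: "\<And>i j. N \<le> i \<Longrightarrow> N \<le> j \<Longrightarrow>
        power_form (\<lambda>x. F i x - F j x) (\<lambda>x. F i x - F j x) < e\<^sup>2"
      using Cauchy unfolding form_Cauchy_def by blast
    have "norm (sqrt (power_form (F i) (F i)) - sqrt (power_form (F j) (F j))) < e"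
      if "N \<le> i" "N \<le> j" for i j
    proof -
      have "sqrt (power_form (\<lambda>x. F i x - F j x) (\<lambda>x. F i x - F j x)) < sqrt (e\<^sup>2)"
        using N[OF that] by (rule real_sqrt_less_mono)
      then show ?thesis using power_form_diff[OF F F, of i j] \<open>0 < e\<close> by simp
    qed
    then show "\<exists>N. \<forall>i\<ge>N. \<forall>j\<ge>N. norm (sqrt (power_form (F i) (F i)) - sqrt (power_form (F j) (F j))) < e"
      by blast
  qed
  then obtain a where a: "(\<lambda>n. sqrt (power_form (F n) (F n))) \<longlonglongrightarrow> a"
    using Cauchy_convergent by (auto simp: convergent_def)
  then have "(\<lambda>n. (sqrt (power_form (F n) (F n)))\<^sup>2) \<longlonglongrightarrow> a\<^sup>2" by (rule tendsto_power)
  then have "lim (\<lambda>n. power_form (F n) (F n)) = a\<^sup>2"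
    by (intro limI) (simp add: power_form_nonneg)
  moreover have "0 \<le> a"
    by (rule LIMSEQ_le_const[OF a]) (simp add: power_form_nonneg)
  ultimately show ?thesis using a by simp
qed

lemma power_form_dominates:
  assumes g: "g \<in> Cc" "\<And>x. 0 \<le> g x"
    and W: "\<And>t. 0 \<le> t \<Longrightarrow> (\<integral>l. (wave_mult t l)\<^sup>2 \<partial>diag_measure m P g) \<le> W"
  shows "\<exists>K. 0 \<le> K \<and> (\<forall>f F. extended_approx m (Domain power_op) power_form f F \<longrightarrow>
    (\<integral>\<^sup>+x. ennreal (\<bar>f x\<bar> * g x) \<partial>m) \<le> ennreal (K * sqrt (lim (\<lambda>n. power_form (F n) (F n)))))"
proof -
  have gL: "g \<in> L2 m" by (rule Cc_subset_L2[OF radon g(1)])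
  obtain K where K: "0 \<le> K" and bound:
    "\<And>f u. f \<in> L2 m \<Longrightarrow> u \<in> spectral_domain m P (\<lambda>l. l powr (b / 2)) \<Longrightarrow>
      (\<And>s. 0 < s \<Longrightarrow> (\<integral>l. psi s l \<partial>diag_measure m P f) \<le> (\<integral>l. psi s l \<partial>diag_measure m P u)) \<Longrightarrow>
      \<bar>ip m f g\<bar> \<le> K * sqrt (\<integral>l. (l powr (b / 2))\<^sup>2 \<partial>diag_measure m P u)"
    using abs_ip_le_of_psi_dominated[OF b gL W] by blast
  have single: "(\<integral>\<^sup>+x. ennreal (\<bar>u x\<bar> * g x) \<partial>m) \<le> ennreal (K * sqrt (power_form u u))"
    if u: "u \<in> Domain power_op" for u
  proof -
    have ud: "u \<in> spectral_domain m P (\<lambda>l. l powr (b / 2))"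
      using u spectral_integral_Domain_subset by blast
    then have uL: "u \<in> L2 m" by (rule spectral_domain_L2)
    \<comment> \<open>The dominated function is |u| and the dominating one is \<open>u\<close>;
      since \<open>g\<close> is nonnegative, the inner product with |u| is the integral that is
      sought.\<close>
    have "\<bar>ip m (\<lambda>x. \<bar>u x\<bar>) g\<bar> \<le> K * sqrt (power_form u u)"
      using bound[OF L2_abs[OF uL] ud integral_psi_abs_le[OF uL]]
      by (simp add: op_form_spectral_integral[OF _ u])
    moreover have "(\<integral>\<^sup>+x. ennreal (\<bar>u x\<bar> * g x) \<partial>m) = ennreal (ip m (\<lambda>x. \<bar>u x\<bar>) g)"
      unfolding ip_def using g(2)
      by (intro nn_integral_eq_integral L2_integrable_mult L2_abs uL gL) auto
    ultimately show ?thesis by (simp add: ennreal_leI)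
  qed
  have "(\<integral>\<^sup>+x. ennreal (\<bar>f x\<bar> * g x) \<partial>m) \<le> ennreal (K * sqrt (lim (\<lambda>n. power_form (F n) (F n))))"
    if F: "extended_approx m (Domain power_op) power_form f F" for f F
  proof -
    have FD: "\<And>n. F n \<in> Domain power_op" and Cauchy: "form_Cauchy power_form F"
      and lim: "AE x in m. (\<lambda>n. F n x) \<longlonglongrightarrow> f x"
      using F by (auto simp: extended_approx_def)
    have FL: "F n \<in> L2 m" for n
      using FD[of n] by (auto simp: spectral_integral_iff intro: spectral_domain_L2)
    have "(\<integral>\<^sup>+x. ennreal (\<bar>f x\<bar> * g x) \<partial>m) = (\<integral>\<^sup>+x. liminf (\<lambda>n. ennreal (\<bar>F n x\<bar> * g x)) \<partial>m)"
    proof (rule nn_integral_cong_AE)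
      show "AE x in m. ennreal (\<bar>f x\<bar> * g x) = liminf (\<lambda>n. ennreal (\<bar>F n x\<bar> * g x))"
        using lim
      proof eventually_elim
        fix x assume "(\<lambda>n. F n x) \<longlonglongrightarrow> f x"
        then have "(\<lambda>n. ennreal (\<bar>F n x\<bar> * g x)) \<longlonglongrightarrow> ennreal (\<bar>f x\<bar> * g x)"
          by (intro tendsto_ennrealI tendsto_intros)
        from lim_imp_Liminf[OF _ this]
        show "ennreal (\<bar>f x\<bar> * g x) = liminf (\<lambda>n. ennreal (\<bar>F n x\<bar> * g x))" by simp
      qed
    qed
    also have "\<dots> \<le> liminf (\<lambda>n. \<integral>\<^sup>+x. ennreal (\<bar>F n x\<bar> * g x) \<partial>m)"
      using FL[THEN L2_measurable] L2_measurable[OF gL]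
      by (intro nn_integral_liminf) auto
    also have "\<dots> \<le> liminf (\<lambda>n. ennreal (K * sqrt (power_form (F n) (F n))))"
      by (intro Liminf_mono always_eventually allI single FD)
    also have "\<dots> = ennreal (K * sqrt (lim (\<lambda>n. power_form (F n) (F n))))"
      by (intro lim_imp_Liminf tendsto_ennrealI tendsto_mult tendsto_const
          power_form_convergent FD Cauchy) simp
    finally show ?thesis .
  qed
  with K show ?thesis by (intro exI[of _ K]) simp
qed

lemma subcritical_power_form:
  assumes lc: "locally_compact_space (euclidean :: 'a topology)"
    and W: "\<And>g. g \<in> Cc \<Longrightarrow> \<exists>W. \<forall>t\<ge>0. (\<integral>l. (wave_mult t l)\<^sup>2 \<partial>diag_measure m P g) \<le> W"
  shows "subcritical_form m (Domain power_op) power_form"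
proof -
  obtain \<phi> :: "nat \<Rightarrow> 'a \<Rightarrow> real" where \<phi>: "\<And>k. \<phi> k \<in> Cc" "\<And>k x. 0 \<le> \<phi> k x" "\<And>k x. \<phi> k x \<le> 1"
    "\<And>x. \<exists>k. 0 < \<phi> k x"
    by (fact locally_compact_bumps[OF lc])
  define dominated where "dominated k K \<longleftrightarrow> 0 \<le> K \<and>
    (\<forall>f F. extended_approx m (Domain power_op) power_form f F \<longrightarrow>
      (\<integral>\<^sup>+x. ennreal (\<bar>f x\<bar> * \<phi> k x) \<partial>m) \<le> ennreal (K * sqrt (lim (\<lambda>n. power_form (F n) (F n)))))"
    for k K
  have "\<exists>K. dominated k K" for k
  proof -
    obtain w where "\<And>t. 0 \<le> t \<Longrightarrow> (\<integral>l. (wave_mult t l)\<^sup>2 \<partial>diag_measure m P (\<phi> k)) \<le> w"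
      using W[OF \<phi>(1)[of k]] by blast
    then show ?thesis unfolding dominated_def by (rule power_form_dominates[OF \<phi>(1,2)])
  qed
  then obtain K where dom: "\<And>k. dominated k (K k)" by metis
  have K: "\<And>k. 0 \<le> K k"
    "\<And>k f F. extended_approx m (Domain power_op) power_form f F \<Longrightarrow>
      (\<integral>\<^sup>+x. ennreal (\<bar>f x\<bar> * \<phi> k x) \<partial>m) \<le> ennreal (K k * sqrt (lim (\<lambda>n. power_form (F n) (F n))))"
    using dom unfolding dominated_def by simp_all
  have sets: "sets m = sets borel" using radon by (simp add: radon_measure_def)
  have meas [measurable]: "\<phi> k \<in> borel_measurable m" for k
    unfolding measurable_cong_sets[OF sets refl] by (rule Cc_measurable[OF \<phi>(1)])
  have int_\<phi>: "integrable m (\<phi> k)" for k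
  proof -
    let ?A = "closure {x. \<phi> k x \<noteq> 0}"
    have "emeasure m ?A < \<infinity>" using radon \<phi>(1)[of k] unfolding radon_measure_def Cc_def by blast
    then have "integrable m (indicator ?A :: 'a \<Rightarrow> real)"
      using sets by (intro integrable_real_indicator) auto
    then show ?thesis
    proof (rule Bochner_Integration.integrable_bound)
      have "norm (\<phi> k x) \<le> norm (indicator ?A x :: real)" for x
        using \<phi>(2,3)[of k x] closure_subset[of "{x. \<phi> k x \<noteq> 0}"]
        by (cases "\<phi> k x = 0") auto
      then show "AE x in m. norm (\<phi> k x) \<le> norm (indicator ?A x :: real)" by (rule AE_I2)
    qed (rule meas)
  qed
  define I where "I k = (\<integral>x. \<phi> k x \<partial>m)" for k
  have I: "0 \<le> I k" for k unfolding I_def using \<phi>(2) by (auto intro!: integral_nonneg_AE)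
  \<comment> \<open>One choice of coefficients makes three series at most 1: that of
    \<open>c k * \<phi> k x\<close> bounds \<open>g\<close>, that of \<open>c k * I k\<close> makes
    it integrable, and that of \<open>c k * K k\<close> gives the final inequality the constant
    1.\<close>
  define c where "c k = (1 / 2) ^ Suc k / (1 + K k + I k)" for k
  have c_pos: "0 < c k" for k using K(1)[of k] I[of k] by (simp add: c_def)
  have c_le: "c k * a \<le> (1 / 2) ^ Suc k" if "0 \<le> a" "a \<le> 1 + K k + I k" for k a
  proof -
    have nz: "1 + K k + I k \<noteq> 0" using K(1)[of k] I[of k] by linarith
    have "c k * a \<le> c k * (1 + K k + I k)" using that c_pos[of k] by (intro mult_left_mono) auto
    also have "c k * (1 + K k + I k) = (1 / 2) ^ Suc k"
      using nonzero_eq_divide_eq[OF nz] unfolding c_def by blast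
    finally show ?thesis .
  qed
  have half: "(\<Sum>k. ennreal ((1 / 2) ^ Suc k)) = 1"
    using power_half_series by (subst suminf_ennreal2) (auto simp: sums_iff)
  have sum_le_1: "(\<Sum>k. ennreal (c k * a k)) \<le> 1" if "\<And>k. 0 \<le> a k" "\<And>k. a k \<le> 1 + K k + I k" for a
    unfolding half[symmetric] by (intro suminf_le ennreal_leI c_le that) auto
  define g where "g x = (\<Sum>k. c k * \<phi> k x)" for x
  have \<phi>_le: "\<phi> k x \<le> 1 + K k + I k" for k x using \<phi>(3)[of k x] K(1)[of k] I[of k] by linarith
  have c\<phi>: "0 \<le> c k * \<phi> k x" for k x using c_pos[of k] \<phi>(2)[of k x] by simp
  have le_1: "(\<Sum>k. ennreal (c k * \<phi> k x)) \<le> 1" for x by (rule sum_le_1[OF \<phi>(2) \<phi>_le])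
  have summ: "summable (\<lambda>k. c k * \<phi> k x)" for x
    by (rule summable_suminf_not_top[OF c\<phi> neq_top_trans[OF _ le_1]]) simp
  have g_sum: "ennreal (g x) = (\<Sum>k. ennreal (c k * \<phi> k x))" for x
    unfolding g_def by (intro suminf_ennreal2[symmetric] c\<phi> summ)
  have g_pos: "0 < g x" for x
  proof -
    obtain k where "0 < \<phi> k x" using \<phi>(4) by blast
    then have "0 < c k * \<phi> k x" using c_pos by simp
    also have "\<dots> \<le> g x" unfolding g_def using sum_le_suminf[OF summ, of "{k}"] c\<phi> by simp
    finally show ?thesis .
  qed
  have g_le: "g x \<le> 1" for x
    using le_1[of x] unfolding g_sum[symmetric] by simp
  have [measurable]: "g \<in> borel_measurable m" unfolding g_def[abs_def] by measurable
  have nn: "(\<integral>\<^sup>+x. ennreal (a x * g x) \<partial>m) = (\<Sum>k. ennreal (c k) * (\<integral>\<^sup>+x. ennreal (a x * \<phi> k x) \<partial>m))"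
    if [measurable]: "a \<in> borel_measurable m" and a: "\<And>x. 0 \<le> a x" for a
  proof -
    have "ennreal (a x * g x) = (\<Sum>k. ennreal (c k) * ennreal (a x * \<phi> k x))" for x
    proof -
      have "ennreal (a x * g x) = ennreal (a x) * (\<Sum>k. ennreal (c k * \<phi> k x))"
        using g_pos[of x] a[of x] by (simp add: ennreal_mult g_sum)
      also have "\<dots> = (\<Sum>k. ennreal (a x) * ennreal (c k * \<phi> k x))" by simp
      also have "\<dots> = (\<Sum>k. ennreal (c k) * ennreal (a x * \<phi> k x))"
        using a[of x] c_pos \<phi>(2) by (simp add: ennreal_mult' ennreal_mult'' less_imp_le mult.left_commute)
      finally show ?thesis .
    qed
    then show ?thesis by (simp add: nn_integral_suminf nn_integral_cmult)
  qed
  have "(\<integral>\<^sup>+x. ennreal (g x) \<partial>m) \<le> 1"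
  proof -
    have "(\<integral>\<^sup>+x. ennreal (g x) \<partial>m) = (\<Sum>k. ennreal (c k) * (\<integral>\<^sup>+x. ennreal (\<phi> k x) \<partial>m))"
      using nn[of "\<lambda>_. 1"] by simp
    also have "\<dots> = (\<Sum>k. ennreal (c k * I k))"
      using \<phi>(2) I c_pos
      by (simp add: nn_integral_eq_integral[OF int_\<phi>] I_def ennreal_mult less_imp_le)
    also have "\<dots> \<le> 1" using I K(1) by (intro sum_le_1) (auto simp: add_nonneg_nonneg)
    finally show ?thesis .
  qed
  then have g_int: "integrable m g"
    using g_pos by (intro integrableI_nonneg) (auto simp: less_imp_le intro: order.strict_trans1)
  have "(\<integral>\<^sup>+x. ennreal (\<bar>f x\<bar> * g x) \<partial>m) \<le> ennreal (sqrt (lim (\<lambda>n. power_form (F n) (F n))))"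
    if f: "f \<in> borel_measurable m" and F: "extended_approx m (Domain power_op) power_form f F" for f F
  proof -
    let ?a = "sqrt (lim (\<lambda>n. power_form (F n) (F n)))"
    have "0 \<le> ?a"
      using F unfolding extended_approx_def
      by (intro LIMSEQ_le_const[OF power_form_convergent]) (auto simp: power_form_nonneg)
    have "(\<integral>\<^sup>+x. ennreal (\<bar>f x\<bar> * g x) \<partial>m) = (\<Sum>k. ennreal (c k) * (\<integral>\<^sup>+x. ennreal (\<bar>f x\<bar> * \<phi> k x) \<partial>m))"
      using f by (intro nn) auto
    also have "\<dots> \<le> (\<Sum>k. ennreal (c k) * ennreal (K k * ?a))"
      by (intro suminf_le mult_left_mono K(2)[OF F]) auto
    also have "\<dots> = (\<Sum>k. ennreal (c k * K k)) * ennreal ?a"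
    proof -
      have "ennreal (c k) * ennreal (K k * ?a) = ennreal (c k * K k) * ennreal ?a" for k
        using c_pos[of k] K(1)[of k] \<open>0 \<le> ?a\<close> by (simp add: ennreal_mult less_imp_le mult.assoc)
      then show ?thesis by simp
    qed
    also have "\<dots> \<le> 1 * ennreal ?a"
      using I K(1) by (intro mult_right_mono sum_le_1) (auto simp: add_nonneg_nonneg)
    finally show ?thesis by simp
  qed
  moreover have "bounded (range g)"
    using g_pos g_le by (intro boundedI[of _ 1]) (auto simp: abs_of_pos)
  ultimately show ?thesis
    unfolding subcritical_form_def using g_pos g_int
    by (intro exI[of _ g]) (auto simp: extended_dom_def)
qed

end

end

theorem theorem4p10:
  fixes m \<mu>p \<mu>m :: "'a::{metric_space, second_countable_topology} measure"
    and D :: "('a \<Rightarrow> real) set" and E :: "('a \<Rightarrow> real) \<Rightarrow> ('a \<Rightarrow> real) \<Rightarrow> real"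
    and L L\<mu> :: "(('a \<Rightarrow> real) \<times> ('a \<Rightarrow> real)) set"
    and P :: "'a option \<Rightarrow> 'w measure" and X :: "ennreal \<Rightarrow> 'w \<Rightarrow> 'a option"
  assumes "locally_compact_space (euclidean :: 'a topology)"
    and "radon_measure m" and "full_support m"
    and "dirichlet_form m D E" and "regular_form m D E"
    and "generates m L D E" and "irreducible_semigroup m L"
    and "hunt_process P X" and "associated_process m L P X" and "strong_feller P X"
    and "smooth_radon_measure m D E \<mu>p" and "smooth_radon_measure m D E \<mu>m"
    and "nonneg_form (D \<inter> Cc) (schroedinger_form E \<mu>p \<mu>m)"
    and "closable_form m (D \<inter> Cc) (schroedinger_form E \<mu>p \<mu>m)"
    and "generates m L\<mu> (closure_dom m (D \<inter> Cc) (schroedinger_form E \<mu>p \<mu>m))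
           (closure_form m (D \<inter> Cc) (schroedinger_form E \<mu>p \<mu>m))"
    and "kato_class m D E P X \<mu>p"
    and "\<forall>g\<in>Cc. bdd_above ((\<lambda>t. l2norm m (wave_solution m (op_neg L\<mu>) g t)) ` {0..})"
  shows "\<forall>\<beta>. 0 < \<beta> \<and> \<beta> < 1 \<longrightarrow> subcritical_power m (op_neg L\<mu>) \<beta>"
proof (intro allI impI)
  fix \<beta> :: real assume \<beta>: "0 < \<beta> \<and> \<beta> < 1"
  interpret dirichlet_with_potential m \<mu>p \<mu>m D E
    using assms(4,11,12,13,14) by unfold_locales (auto simp: smooth_radon_measure_def)
  let ?A = "op_neg L\<mu>"
  note gen = assms(15)[unfolded generates_def]
  have "(\<lambda>x. 0) \<in> Domain (fun_calc m ?A sqrt)"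
    using C_subset_closure_dom[OF zero_in_C] gen by simp
  then have ex: "\<exists>Q. is_spectral_measure m ?A Q"
    by (auto simp: fun_calc_def split: if_splits)
  \<comment> \<open>The very spectral measure that \<open>fun_calc\<close> selects, so that the
    square root, the power and the wave multiplier are all integrals against the same
    \<open>Q\<close>.\<close>
  define Q where "Q = (SOME Q. is_spectral_measure m ?A Q)"
  have "is_spectral_measure m ?A Q" unfolding Q_def by (rule someI_ex[OF ex])
  then have Q: "projection_valued_measure m Q" by (simp add: is_spectral_measure_def)
  have calculus: "fun_calc m ?A \<phi> = spectral_integral m Q \<phi>" for \<phi>
    using ex by (simp add: fun_calc_def Q_def)
  interpret schroedinger_calculus m \<mu>p \<mu>m D E Q
    using gen Q assms(2) by unfold_locales (auto simp: calculus)
  have "\<exists>W. \<forall>t\<ge>0. (\<integral>l. (wave_mult t l)\<^sup>2 \<partial>diag_measure m Q g) \<le> W" if g: "g \<in> Cc" for g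
  proof -
    have gL: "g \<in> L2 m" by (rule Cc_subset_L2[OF assms(2) g])
    obtain W where W: "\<And>t. 0 \<le> t \<Longrightarrow> l2norm m (wave_solution m ?A g t) \<le> W"
      using assms(17) g unfolding bdd_above_def by (meson atLeast_iff imageI)
    have "(\<integral>l. (wave_mult t l)\<^sup>2 \<partial>diag_measure m Q g) \<le> W\<^sup>2" if t: "0 \<le> t" for t
    proof -
      \<comment> \<open>For fixed \<open>t\<close> the multiplier is bounded, so \<open>g\<close>
        lies in the domain and \<open>op_app\<close> picks a genuine value; its squared norm is then
        the spectral integral.\<close>
      have "(g, calc (wave_mult t) g) \<in> spectral_integral m Q (wave_mult t)"
        by (rule spectral_integral_bdd[OF wave_mult_bdd_borel gL])
      moreover have "wave_solution m ?A g t = op_app (spectral_integral m Q (wave_mult t)) g"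
        unfolding wave_solution_def calculus wave_mult_def[abs_def] ..
      ultimately have "(g, wave_solution m ?A g t) \<in> spectral_integral m Q (wave_mult t)"
        by (simp add: op_app_in DomainI)
      from spectral_integral_norm[OF bdd_borel_measurable[OF wave_mult_bdd_borel] this]
      have "(\<integral>l. (wave_mult t l)\<^sup>2 \<partial>diag_measure m Q g) = (l2norm m (wave_solution m ?A g t))\<^sup>2"
        by (simp add: l2norm_power2)
      also have "\<dots> \<le> W\<^sup>2" using W[OF t] by (intro power_mono l2norm_nonneg)
      finally show ?thesis .
    qed
    then show ?thesis by blast
  qed
  then show "subcritical_power m ?A \<beta>"
    unfolding subcritical_power_def calculus
    using subcritical_power_form[OF _ _ assms(1)] \<beta> by blast
qed

end
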